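(* There exists an $O(mn_1)$ time algorithm that, given an instance $G=(\mathcal{A}\cup\mathcal{B},E)$ of the min-cost popular matchings problem, decides whether $G$ admits a popular matching and, if so, computes a popular matching of minimum cost. Here $m=|E|$ and $n_1=|\mathcal{A}|$.
   Context: Popular matchings: a preference instance is a bipartite graph $G=(\mathcal{A}\cup\mathcal{B},E)$ with $\mathcal{A}$ a set of people and $\mathcal{B}$ a set of items; each person ranks the items adjacent to her in order of preference, with ties allowed; each item $b$ has a fixed positive integer $\mathsf{copies}(b)$ (its capacity). A matching $M$ assigns each person at most one acceptable item such that each item $b$ is assigned to at most $\mathsf{copies}(b)$ people (people may be unmatched); $M(a)$ is the item assigned to $a$. A person $a$ prefers $M$ to $M'$ if $a$ is matched in $M$ and unmatched in $M'$, or matched in both and prefers $M(a)$ to $M'(a)$. $M$ is more popular than $M'$ if more people prefer $M$ to $M'$ than prefer $M'$ to $M$; $M$ is popular if no matching is more popular than $M$. Min-cost popular matchings problem: in addition, each item $b$ has a price $\mathsf{cost}(b)\ge 0$, and the cost of a matching $M$ is $\sum_{b}k_b\,\mathsf{cost}(b)$, where $k_b\le\mathsf{copies}(b)$ is the number of people matched to $b$ in $M$. The task is to decide whether $G$ admits a popular matching and, if so, to find a popular matching of minimum cost. *)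

theory Defs
  imports Complex_Main
begin

section \<open>Popular matchings\<close>

text \<open>
  Vertices are named by numbers: the people are \<open>0, \<dots>, n_people - 1\<close>, the items
  \<open>0, \<dots>, n_items - 1\<close>. A smaller rank is better, equal ranks are ties.
\<close>

record pref_instance =
  n_people :: nat
  n_items :: nat
  edges :: "(nat \<times> nat) set"
  rank :: "nat \<Rightarrow> nat \<Rightarrow> nat"
  copies :: "nat \<Rightarrow> nat"
  cost :: "nat \<Rightarrow> real"

abbreviation people :: "pref_instance \<Rightarrow> nat set" where
  "people G \<equiv> {..<n_people G}"

abbreviation items :: "pref_instance \<Rightarrow> nat set" where
  "items G \<equiv> {..<n_items G}"

definition wf_instance :: "pref_instance \<Rightarrow> bool" where
  "wf_instance G \<longleftrightarrow>
     edges G \<subseteq> people G \<times> items G \<and>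
     (\<forall>b\<in>items G. copies G b \<ge> 1 \<and> cost G b \<ge> 0)"

definition assigned :: "pref_instance \<Rightarrow> (nat \<Rightarrow> nat option) \<Rightarrow> nat \<Rightarrow> nat set" where
  "assigned G M b = {a \<in> people G. M a = Some b}"

definition matching :: "pref_instance \<Rightarrow> (nat \<Rightarrow> nat option) \<Rightarrow> bool" where
  "matching G M \<longleftrightarrow>
     (\<forall>a b. M a = Some b \<longrightarrow> (a, b) \<in> edges G) \<and>
     (\<forall>b\<in>items G. card (assigned G M b) \<le> copies G b)"

definition prefers ::
  "pref_instance \<Rightarrow> nat \<Rightarrow> (nat \<Rightarrow> nat option) \<Rightarrow> (nat \<Rightarrow> nat option) \<Rightarrow> bool" where
  "prefers G a M M' \<longleftrightarrow>
     (\<exists>b. M a = Some b \<and>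
        (M' a = None \<or> (\<exists>b'. M' a = Some b' \<and> rank G a b < rank G a b')))"

definition more_popular ::
  "pref_instance \<Rightarrow> (nat \<Rightarrow> nat option) \<Rightarrow> (nat \<Rightarrow> nat option) \<Rightarrow> bool" where
  "more_popular G M M' \<longleftrightarrow>
     card {a \<in> people G. prefers G a M M'} > card {a \<in> people G. prefers G a M' M}"

definition popular :: "pref_instance \<Rightarrow> (nat \<Rightarrow> nat option) \<Rightarrow> bool" where
  "popular G M \<longleftrightarrow> matching G M \<and> \<not> (\<exists>M'. matching G M' \<and> more_popular G M' M)"

definition matching_cost :: "pref_instance \<Rightarrow> (nat \<Rightarrow> nat option) \<Rightarrow> real" where
  "matching_cost G M = (\<Sum>b\<in>items G. real (card (assigned G M b)) * cost G b)"

definition min_cost_popular :: "pref_instance \<Rightarrow> (nat \<Rightarrow> nat option) \<Rightarrow> bool" where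
  "min_cost_popular G M \<longleftrightarrow>
     popular G M \<and> (\<forall>M'. popular G M' \<longrightarrow> matching_cost G M \<le> matching_cost G M')"


section \<open>Machine model\<close>

text \<open>
  A unit-cost random access machine, programmed in a structured language over named
  one-dimensional arrays; a scalar variable is cell 0 of an array. A program mentions only
  finitely many array names, so the arrays can be interleaved in a single memory with constant
  overhead. There are two sorts of cells: natural numbers (indices, ranks, counters) and reals
  (prices).

  The model is deliberately weak, so that unit cost cannot be exploited. Naturals can only be
  incremented, decremented and compared; in \<open>t\<close> steps they thus exceed the largest input
  number by \<open>O(t)\<close> at most. Reals can be added, subtracted and compared; the
  only real literal is 0 (an arbitrary real literal could encode unbounded advice), and a real
  can never be turned into an index.
\<close>

datatype nexp =
    Lit nat
  | Get string nexp
  | Inc nexp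
  | Dec nexp

datatype rexp =
    Zero
  | RGet string nexp
  | Add rexp rexp
  | Sub rexp rexp

datatype bexp =
    Less nexp nexp
  | RLess rexp rexp
  | Not bexp
  | And bexp bexp

datatype com =
    Skip
  | Put string nexp nexp
  | RPut string nexp rexp
  | Seq com com
  | If bexp com com
  | While bexp com

record state =
  nats :: "string \<Rightarrow> nat \<Rightarrow> nat"
  reals :: "string \<Rightarrow> nat \<Rightarrow> real"

primrec nval :: "nexp \<Rightarrow> state \<Rightarrow> nat" where
  "nval (Lit n) s = n"
| "nval (Get x e) s = nats s x (nval e s)"
| "nval (Inc e) s = nval e s + 1"
| "nval (Dec e) s = nval e s - 1"

primrec rval :: "rexp \<Rightarrow> state \<Rightarrow> real" where
  "rval Zero s = 0"
| "rval (RGet x e) s = reals s x (nval e s)"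
| "rval (Add p q) s = rval p s + rval q s"
| "rval (Sub p q) s = rval p s - rval q s"

primrec bval :: "bexp \<Rightarrow> state \<Rightarrow> bool" where
  "bval (Less e f) s \<longleftrightarrow> nval e s < nval f s"
| "bval (RLess p q) s \<longleftrightarrow> rval p s < rval q s"
| "bval (Not b) s \<longleftrightarrow> \<not> bval b s"
| "bval (And b c) s \<longleftrightarrow> bval b s \<and> bval c s"

definition put :: "string \<Rightarrow> nat \<Rightarrow> nat \<Rightarrow> state \<Rightarrow> state" where
  "put x i v s = s\<lparr>nats := (nats s)(x := (nats s x)(i := v))\<rparr>"

definition rput :: "string \<Rightarrow> nat \<Rightarrow> real \<Rightarrow> state \<Rightarrow> state" where
  "rput x i v s = s\<lparr>reals := (reals s)(x := (reals s x)(i := v))\<rparr>"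

text \<open>
  \<open>exec p s t s'\<close>: started in \<open>s\<close>, the program \<open>p\<close> halts in \<open>s'\<close> after \<open>t\<close> steps.
  Every assignment, every skip and every evaluation of a test is one step. The expressions
  occurring in a fixed program have bounded size, so charging for each operator instead would
  change running times by a constant factor only.
\<close>

inductive exec :: "com \<Rightarrow> state \<Rightarrow> nat \<Rightarrow> state \<Rightarrow> bool" where
  Skip: "exec Skip s 1 s"
| Put: "exec (Put x i e) s 1 (put x (nval i s) (nval e s) s)"
| RPut: "exec (RPut x i p) s 1 (rput x (nval i s) (rval p s) s)"
| Seq: "exec p s t s' \<Longrightarrow> exec q s' t' s'' \<Longrightarrow> exec (Seq p q) s (t + t') s''"
| IfTrue: "bval b s \<Longrightarrow> exec p s t s' \<Longrightarrow> exec (If b p q) s (t + 1) s'"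
| IfFalse: "\<not> bval b s \<Longrightarrow> exec q s t s' \<Longrightarrow> exec (If b p q) s (t + 1) s'"
| WhileFalse: "\<not> bval b s \<Longrightarrow> exec (While b p) s 1 s"
| WhileTrue: "bval b s \<Longrightarrow> exec p s t s' \<Longrightarrow> exec (While b p) s' t' s'' \<Longrightarrow>
    exec (While b p) s (t + t' + 1) s''"

lemma exec_deterministic:
  "exec p s t s' \<Longrightarrow> exec p s u s'' \<Longrightarrow> t = u \<and> s' = s''"
proof (induction arbitrary: u s'' rule: exec.induct)
  case Skip
  then show ?case by (auto elim: exec.cases)
next
  case Put
  then show ?case by (auto elim: exec.cases)
next
  case RPut
  then show ?case by (auto elim: exec.cases)
next
  case (Seq p s t s' q t' s1)
  from Seq.prems show ?case by cases (use Seq.IH in blast)+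
next
  case (IfTrue b s p t s' q)
  from IfTrue.prems show ?case by cases (use IfTrue in blast)+
next
  case (IfFalse b s q t s' p)
  from IfFalse.prems show ?case by cases (use IfFalse in blast)+
next
  case (WhileFalse b s p)
  from WhileFalse.prems show ?case by cases (use WhileFalse in blast)+
next
  case (WhileTrue b s p t s' t' s1)
  from WhileTrue.prems show ?case by cases (use WhileTrue in blast)+
qed


section \<open>Input and output\<close>

definition cells :: "'a::zero list \<Rightarrow> nat \<Rightarrow> 'a" where
  "cells xs i = (if i < length xs then xs ! i else 0)"

text \<open>A preference list of \<open>a\<close>: the items adjacent to \<open>a\<close>, best first, ties in any order.\<close>

definition pref_list :: "pref_instance \<Rightarrow> nat \<Rightarrow> nat list \<Rightarrow> bool" where
  "pref_list G a bs \<longleftrightarrow>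
     distinct bs \<and> set bs = {b. (a, b) \<in> edges G} \<and> sorted (map (rank G a) bs)"

text \<open>
  The preference lists of all people are stored one after the other in the array \<open>item\<close>, and
  the ranks of these items in parallel in \<open>rank\<close>. The list of \<open>a\<close> occupies the indices
  from \<open>first[a]\<close> (inclusive) to \<open>first[a + 1]\<close> (exclusive). All memory not used by the input
  is zero.
\<close>

definition input_state :: "pref_instance \<Rightarrow> (nat \<Rightarrow> nat list) \<Rightarrow> state" where
  "input_state G pl = \<lparr>
     nats = (\<lambda>x i. 0)(
       ''people'' := cells [n_people G],
       ''items'' := cells [n_items G],
       ''first'' := cells (map (\<lambda>a. \<Sum>a'<a. length (pl a')) [0..<n_people G + 1]),
       ''item'' := cells (concat (map pl [0..<n_people G])),
       ''rank'' := cells (concat (map (\<lambda>a. map (rank G a) (pl a)) [0..<n_people G])),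
       ''copies'' := cells (map (copies G) [0..<n_items G])),
     reals = (\<lambda>x i. 0)(
       ''cost'' := cells (map (cost G) [0..<n_items G]))\<rparr>"

definition encodes :: "state \<Rightarrow> pref_instance \<Rightarrow> bool" where
  "encodes s G \<longleftrightarrow> (\<exists>pl. (\<forall>a\<in>people G. pref_list G a (pl a)) \<and> s = input_state G pl)"

lemma encodes_exists:
  assumes "wf_instance G"
  shows "\<exists>s. encodes s G"
proof -
  have "finite {b. (a, b) \<in> edges G}" for a
    by (rule finite_subset[of _ "items G"]) (use assms in \<open>auto simp: wf_instance_def\<close>)
  then have "pref_list G a (sort_key (rank G a) (sorted_list_of_set {b. (a, b) \<in> edges G}))" for a
    by (simp add: pref_list_def)
  then show ?thesis
    unfolding encodes_def
    by (intro exI[of _ "input_state G _"]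
        exI[of _ "\<lambda>a. sort_key (rank G a) (sorted_list_of_set {b. (a, b) \<in> edges G})"]) simp
qed

text \<open>
  The answer is in \<open>popular[0]\<close> (1 for yes, 0 for no). In the case of a yes,
  \<open>match[a]\<close> is 0 if \<open>a\<close> is unmatched and \<open>b + 1\<close> if \<open>a\<close> is matched to \<open>b\<close>.
\<close>

definition output_matching :: "pref_instance \<Rightarrow> state \<Rightarrow> nat \<Rightarrow> nat option" where
  "output_matching G s a =
     (if a \<in> people G \<and> nats s ''match'' a \<noteq> 0 then Some (nats s ''match'' a - 1) else None)"

definition correct_output :: "pref_instance \<Rightarrow> state \<Rightarrow> bool" where
  "correct_output G s \<longleftrightarrow>
     (if \<exists>M. popular G M
      then nats s ''popular'' 0 = 1 \<and> min_cost_popular G (output_matching G s)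
      else nats s ''popular'' 0 = 0)"

end

theory Submission
  imports Defs
begin

text \<open>
  Add a last resort with room for everybody at the end of every nonempty preference list, and let
  \<open>M\<close> be a maximum matching of the graph of top choices. Let \<open>D\<close> be the largest set of items that
  are full in \<open>M\<close> such that the people matched into \<open>D\<close> have all their top choices in \<open>D\<close> (in terms
  of the Gallai-Edmonds decomposition, the items that are not even). An assignment is popular iff
  \<open>D\<close> is full and everybody gets a best item outside \<open>D\<close> or, if all her top choices are in \<open>D\<close>,
  possibly one of these. Necessity is a duality argument: the items that can be reached by one
  improving move followed by moves along ties form a set \<open>D'\<close> with the same properties as \<open>D\<close>, or
  else a few people could be moved to get a more popular assignment. Both \<open>D\<close> and \<open>D'\<close> certify the
  size of a maximum matching of the top choices, whence \<open>D' \<subseteq> D\<close>.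

  Prices belong to items, so the weighted problem has matroid structure: match the people one
  after the other, each time augmenting to a cheapest item with spare capacity that is reachable.
  This maximizes the use of every set of cheapest items; the items in \<open>D\<close> count as cheaper than
  all others, which makes them full. Each search takes time \<open>O(m + n\<^sub>1)\<close>, and at most
  \<open>min(m, n\<^sub>1)\<close> people have a nonempty list. The matching \<open>M\<close> comes from the same procedure with
  \<open>D = {}\<close>, and \<open>D\<close> from one more search from every matched person.
\<close>


section \<open>Matchings with capacities\<close>

text \<open>Optimality is proved by counting. For every initial segment \<open>S\<close> of the
  price order, one closed set \<open>Z\<close> certifies that no complete matching uses
  \<open>S\<close> more. Such certificates must survive all later augmentations. They do because
  people matched into a closed set stay in it. An augmentation that ends outside \<open>Z\<close>
  leaves the same people in \<open>Z\<close>. One that ends at a cheapest free item outside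
  \<open>S\<close> shows that all reachable items of \<open>S\<close> are full, so \<open>Z\<close>
  can absorb the whole reachable set. The same sets show that a failed search is final, so one
  search per person suffices. With \<open>S\<close> everything, the certificate is a Hall violator,
  and in the first phase it yields a Koenig cover. With \<open>S\<close> the dead items, it shows
  that \<open>D\<close> gets filled. With \<open>S\<close> the dead items and those below a price,
  it bounds the cost.

  The time bound has no term for the number of items, which may be far larger than the product of
  the numbers of edges and people. So only items that occur in some list are initialised, and item
  arrays are cleared by running over the edges.\<close>

definition load :: "'p set \<Rightarrow> ('p \<Rightarrow> 'i option) \<Rightarrow> 'i \<Rightarrow> nat" where
  "load A M x = card {a \<in> A. M a = Some x}"

definition closed_set :: "'p set \<Rightarrow> ('p \<Rightarrow> 'i set) \<Rightarrow> ('p \<Rightarrow> 'i option) \<Rightarrow> 'i set \<Rightarrow> bool" where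
  "closed_set A Nb M Z \<longleftrightarrow> (\<forall>a\<in>A. M a \<in> Some ` Z \<longrightarrow> Nb a \<subseteq> Z)"

definition full_on :: "'p set \<Rightarrow> ('i \<Rightarrow> nat) \<Rightarrow> ('p \<Rightarrow> 'i option) \<Rightarrow> 'i set \<Rightarrow> bool" where
  "full_on A cap M Z \<longleftrightarrow> (\<forall>x\<in>Z. cap x \<le> load A M x)"

definition partial_matching ::
  "'p set \<Rightarrow> ('p \<Rightarrow> 'i set) \<Rightarrow> ('i \<Rightarrow> nat) \<Rightarrow> ('p \<Rightarrow> 'i option) \<Rightarrow> bool" where
  "partial_matching A Nb cap M \<longleftrightarrow>
     (\<forall>a\<in>A. \<forall>x. M a = Some x \<longrightarrow> x \<in> Nb a) \<and> (\<forall>x. load A M x \<le> cap x)"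

lemma card_matched_into:
  assumes "finite A" "finite Z"
  shows "card {a \<in> A. M a \<in> Some ` Z} = (\<Sum>x\<in>Z. load A M x)"
proof -
  have "{a \<in> A. M a \<in> Some ` Z} = (\<Union>x\<in>Z. {a \<in> A. M a = Some x})" by auto
  then show ?thesis
    unfolding load_def using assms by (simp, subst card_UN_disjoint) auto
qed

lemma load_pos_iff:
  assumes "finite A"
  shows "0 < load A M x \<longleftrightarrow> (\<exists>a\<in>A. M a = Some x)"
  using assms unfolding load_def by (auto simp: card_gt_0_iff)

lemma load_cong: "(\<And>a. a \<in> A \<Longrightarrow> M a = M' a) \<Longrightarrow> load A M x = load A M' x"
  unfolding load_def by (rule arg_cong[of _ _ card]) auto

lemma load_update:
  assumes "finite A" "a \<in> A"
  shows "load A (M(a := y)) x + of_bool (M a = Some x) = load A M x + of_bool (y = Some x)"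
proof -
  have *: "load A M' x = card {b \<in> A - {a}. M' b = Some x} + of_bool (M' a = Some x)" for M'
  proof -
    have "{b \<in> A. M' b = Some x} =
      {b \<in> A - {a}. M' b = Some x} \<union> (if M' a = Some x then {a} else {})"
      using assms by auto
    then show ?thesis unfolding load_def using assms by (auto simp: card_insert_if)
  qed
  have "{b \<in> A - {a}. (M(a := y)) b = Some x} = {b \<in> A - {a}. M b = Some x}" by auto
  then show ?thesis using *[of M] *[of "M(a := y)"] by simp
qed

text \<open>The effect of an augmenting path from \<open>u\<close> to \<open>t\<close> seen from
  outside: the path itself is not mentioned, so the counting arguments are independent of the
  search.\<close>

definition augments ::
  "'p set \<Rightarrow> ('p \<Rightarrow> 'i set) \<Rightarrow> ('p \<Rightarrow> 'i option) \<Rightarrow> 'p \<Rightarrow> 'i \<Rightarrow> ('p \<Rightarrow> 'i option) \<Rightarrow> bool" where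
  "augments A Nb M u t M' \<longleftrightarrow> u \<in> A \<and> M u = None \<and>
     (\<forall>a\<in>A. M' a = None \<longleftrightarrow> M a = None \<and> a \<noteq> u) \<and>
     (\<forall>a\<in>A. \<forall>x. M' a = Some x \<longrightarrow> x \<in> Nb a) \<and>
     (\<forall>x. load A M' x = load A M x + of_bool (x = t))"

text \<open>For a set \<open>S\<close> of cheap items, \<open>Z\<close> witnesses that no matching of the same people uses more
  of the capacity in \<open>S\<close>; \<open>U\<close> is the set of people for whom the search failed.\<close>

definition certificate ::
  "'p set \<Rightarrow> ('p \<Rightarrow> 'i set) \<Rightarrow> ('i \<Rightarrow> nat) \<Rightarrow> ('p \<Rightarrow> 'i option) \<Rightarrow> 'i set \<Rightarrow> 'p set \<Rightarrow> 'i set \<Rightarrow> bool"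
  where
  "certificate A Nb cap M S U Z \<longleftrightarrow> finite Z \<and> closed_set A Nb M Z \<and> full_on A cap M (Z \<inter> S) \<and>
     (\<forall>a\<in>A. \<forall>x. M a = Some x \<longrightarrow> x \<in> Z \<union> S) \<and> (\<forall>u\<in>U. Nb u \<subseteq> Z)"

text \<open>People matched into a closed set have no neighbours outside it and remain matched, so
  they stay inside; \<open>u\<close> joins them if \<open>t\<close> is in \<open>Z\<close>. Nobody
  else can enter, since the total load of \<open>Z\<close> grows only by the unit at
  \<open>t\<close>.\<close>

lemma augments_matched_into:
  assumes fin: "finite A" "finite Z" and aug: "augments A Nb M u t M'"
    and cl: "closed_set A Nb M Z" and t: "t \<in> Z \<Longrightarrow> Nb u \<subseteq> Z"
  shows "{a \<in> A. M' a \<in> Some ` Z} = (if t \<in> Z then insert u else id) {a \<in> A. M a \<in> Some ` Z}"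
    (is "?L = ?R")
proof -
  have u: "u \<in> A" "M u = None" using aug by (auto simp: augments_def)
  have stays: "M' a \<in> Some ` Z" if "a \<in> A" "Nb a \<subseteq> Z" "M' a \<noteq> None" for a
    using aug that by (force simp: augments_def)
  have sub: "?R \<subseteq> ?L"
  proof
    fix a assume "a \<in> ?R"
    then consider "a \<in> A" "M a \<in> Some ` Z" | "a = u" "t \<in> Z" by (auto split: if_splits)
    then show "a \<in> ?L"
    proof cases
      case 1
      then show ?thesis using stays[of a] cl aug by (auto simp: closed_set_def augments_def)
    next
      case 2
      then show ?thesis using stays[of a] t aug by (auto simp: augments_def)
    qed
  qed
  have "card ?L = (\<Sum>x\<in>Z. load A M x + of_bool (x = t))"
    using aug fin by (simp only: card_matched_into augments_def)
  also have "\<dots> = card {a \<in> A. M a \<in> Some ` Z} + of_bool (t \<in> Z)"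
    using fin by (simp add: card_matched_into sum.distrib of_bool_def sum.delta)
  also have "\<dots> = card ?R" using u fin by (auto simp: card_insert_if)
  finally show ?thesis using card_subset_eq[OF _ sub] fin by simp
qed

lemma certificate_augments:
  assumes fin: "finite A" "finite R" and aug: "augments A Nb M u t M'"
    and cert: "certificate A Nb cap M S U Z"
    and R: "Nb u \<subseteq> R" "closed_set A Nb M R" "t \<in> R" and free: "load A M t < cap t"
    and min: "t \<notin> S \<Longrightarrow> full_on A cap M (R \<inter> S)"
  shows "\<exists>Z. certificate A Nb cap M' S U Z"
proof -
  \<comment> \<open>If \<open>t\<close> is in \<open>S\<close>, it lies outside \<open>Z\<close>,
    because \<open>Z \<inter> S\<close> is full and \<open>t\<close> is not; then \<open>Z\<close>
    can be kept. If \<open>t\<close> is not in \<open>S\<close>, everything reachable in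
    \<open>S\<close> is full by \<open>min\<close>, so \<open>R\<close> may be absorbed.\<close>
  define Z' where "Z' = (if t \<in> S then Z else Z \<union> R)"
  have t: "t \<in> Z' \<longleftrightarrow> t \<notin> S"
    using cert free R(3) by (force simp: Z'_def certificate_def full_on_def)
  have finZ': "finite Z'" using fin cert by (auto simp: Z'_def certificate_def)
  have cl: "closed_set A Nb M Z'"
    using cert R by (fastforce simp: Z'_def certificate_def closed_set_def)
  have nb: "t \<in> Z' \<Longrightarrow> Nb u \<subseteq> Z'" using R t by (auto simp: Z'_def)
  note into = augments_matched_into[OF fin(1) finZ' aug cl nb]
  have "closed_set A Nb M' Z'"
    unfolding closed_set_def
  proof (intro ballI impI)
    fix a assume "a \<in> A" "M' a \<in> Some ` Z'"
    then have "a \<in> (if t \<in> Z' then insert u else id) {a \<in> A. M a \<in> Some ` Z'}"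
      using into by blast
    then show "Nb a \<subseteq> Z'"
      using cl nb by (auto simp: closed_set_def split: if_splits)
  qed
  moreover have "full_on A cap M' (Z' \<inter> S)"
  proof -
    have "full_on A cap M (Z' \<inter> S)"
      using cert min by (auto simp: Z'_def certificate_def full_on_def)
    moreover have "load A M x \<le> load A M' x" for x using aug by (simp add: augments_def)
    ultimately show ?thesis unfolding full_on_def by (meson order_trans)
  qed
  \<comment> \<open>Only \<open>t\<close> can be newly in use, and it lies in \<open>Z'\<close> or
    in \<open>S\<close>.\<close>
  moreover have "x \<in> Z' \<union> S" if a: "a \<in> A" "M' a = Some x" for a x
  proof (rule ccontr)
    assume x: "x \<notin> Z' \<union> S"
    have "0 < load A M' x" using a by (auto simp: load_pos_iff[OF fin(1)])
    moreover have "x \<noteq> t" using x t by blast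
    moreover have "load A M' x = load A M x + of_bool (x = t)"
      using aug by (simp add: augments_def)
    ultimately have "0 < load A M x" by simp
    then obtain b where "b \<in> A" "M b = Some x" by (auto simp: load_pos_iff[OF fin(1)])
    then have "x \<in> Z \<union> S" using cert unfolding certificate_def by blast
    then show False using x by (auto simp: Z'_def split: if_splits)
  qed
  moreover have "\<forall>v\<in>U. Nb v \<subseteq> Z'" using cert by (auto simp: Z'_def certificate_def)
  ultimately have "certificate A Nb cap M' S U Z'" using finZ' by (simp add: certificate_def)
  then show ?thesis ..
qed

text \<open>After a failed search the reachable set is full inside and outside \<open>S\<close>, so
  it can be united with \<open>Z\<close> whatever \<open>S\<close> is.\<close>

lemma certificate_fail:
  assumes "finite R" and cert: "certificate A Nb cap M S U Z"
    and R: "Nb u \<subseteq> R" "closed_set A Nb M R" "full_on A cap M R"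
  shows "\<exists>Z. certificate A Nb cap M S (insert u U) Z"
proof (rule exI)
  show "certificate A Nb cap M S (insert u U) (Z \<union> R)"
    unfolding certificate_def
  proof (intro conjI)
    show "closed_set A Nb M (Z \<union> R)"
      using assms by (fastforce simp: certificate_def closed_set_def)
  qed (use assms in \<open>auto simp: certificate_def full_on_def\<close>)
qed

lemma partial_matching_augments:
  assumes "partial_matching A Nb cap M" "augments A Nb M u t M'" "load A M t < cap t"
  shows "partial_matching A Nb cap M'"
  using assms by (auto simp: partial_matching_def augments_def of_bool_def less_eq_Suc_le)

text \<open>\<open>Z\<close> is a Hall violator: \<open>u\<close> and all people matched into
  \<open>Z\<close> have their neighbours in \<open>Z\<close>, but the latter alone exhaust its
  capacity.\<close>

lemma certificate_infeasible:
  assumes fin: "finite A" and cert: "certificate A Nb cap M UNIV U Z"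
    and u: "u \<in> U" "u \<in> A" "M u = None" and N: "partial_matching A Nb cap N"
  shows "\<exists>a\<in>A. N a = None"
proof (rule ccontr)
  assume all: "\<not> ?thesis"
  have Z: "finite Z" "closed_set A Nb M Z" "full_on A cap M Z" "Nb u \<subseteq> Z"
    using cert u by (auto simp: certificate_def)
  have "insert u {a \<in> A. M a \<in> Some ` Z} \<subseteq> {a \<in> A. N a \<in> Some ` Z}"
  proof
    fix a assume "a \<in> insert u {a \<in> A. M a \<in> Some ` Z}"
    then have a: "a \<in> A" "Nb a \<subseteq> Z" using Z u by (auto simp: closed_set_def)
    then obtain x where "N a = Some x" using all by (cases "N a") auto
    then show "a \<in> {a \<in> A. N a \<in> Some ` Z}" using a N by (auto simp: partial_matching_def)
  qed
  then have "card (insert u {a \<in> A. M a \<in> Some ` Z}) \<le> card {a \<in> A. N a \<in> Some ` Z}"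
    using fin by (intro card_mono) auto
  then have "(\<Sum>x\<in>Z. load A M x) < (\<Sum>x\<in>Z. load A N x)"
    using fin Z u by (auto simp: card_matched_into[symmetric])
  moreover have "(\<Sum>x\<in>Z. load A N x) \<le> (\<Sum>x\<in>Z. load A M x)"
    using Z N by (intro sum_mono) (meson full_on_def partial_matching_def order_trans)
  ultimately show False by simp
qed

text \<open>Everybody whom \<open>M\<close> matches outside \<open>Z\<close> already uses
  \<open>S\<close>. The others have all neighbours in \<open>Z\<close>, so they can use
  \<open>S\<close> only within \<open>Z \<inter> S\<close>, which \<open>M\<close> fills to
  capacity.\<close>

lemma certificate_optimal:
  assumes fin: "finite A" and cert: "certificate A Nb cap M S U Z"
    and M: "partial_matching A Nb cap M" "\<forall>a\<in>A. M a \<noteq> None"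
    and N: "partial_matching A Nb cap N" "\<forall>a\<in>A. N a \<noteq> None"
  shows "card {a \<in> A. N a \<in> Some ` S} \<le> card {a \<in> A. M a \<in> Some ` S}"
proof -
  have Z: "finite Z" "closed_set A Nb M Z" "full_on A cap M (Z \<inter> S)"
    using cert by (auto simp: certificate_def)
  let ?P = "{a \<in> A. M a \<notin> Some ` Z}"
  have "{a \<in> A. N a \<in> Some ` S} \<subseteq> ?P \<union> {a \<in> A. N a \<in> Some ` (Z \<inter> S)}"
  proof
    fix a assume a: "a \<in> {a \<in> A. N a \<in> Some ` S}"
    then obtain x where x: "N a = Some x" "x \<in> S" by auto
    have "x \<in> Nb a" using a x N by (auto simp: partial_matching_def)
    then show "a \<in> ?P \<union> {a \<in> A. N a \<in> Some ` (Z \<inter> S)}"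
      using a x Z by (auto simp: closed_set_def)
  qed
  then have "card {a \<in> A. N a \<in> Some ` S} \<le> card (?P \<union> {a \<in> A. N a \<in> Some ` (Z \<inter> S)})"
    using fin by (intro card_mono) auto
  also have "\<dots> \<le> card ?P + card {a \<in> A. N a \<in> Some ` (Z \<inter> S)}" by (rule card_Un_le)
  also have "card {a \<in> A. N a \<in> Some ` (Z \<inter> S)} \<le> card {a \<in> A. M a \<in> Some ` (Z \<inter> S)}"
  proof -
    have "load A N x \<le> load A M x" if "x \<in> Z \<inter> S" for x
      using that Z N by (meson full_on_def partial_matching_def order_trans)
    then have "sum (load A N) (Z \<inter> S) \<le> sum (load A M) (Z \<inter> S)" by (rule sum_mono)
    then show ?thesis using fin Z by (simp add: card_matched_into)
  qed
  also have "card ?P + card {a \<in> A. M a \<in> Some ` (Z \<inter> S)} =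
      card (?P \<union> {a \<in> A. M a \<in> Some ` (Z \<inter> S)})"
    using fin by (intro card_Un_disjoint[symmetric]) auto
  also have "\<dots> \<le> card {a \<in> A. M a \<in> Some ` S}"
  proof (rule card_mono)
    show "?P \<union> {a \<in> A. M a \<in> Some ` (Z \<inter> S)} \<subseteq> {a \<in> A. M a \<in> Some ` S}"
    proof
      fix a assume "a \<in> ?P \<union> {a \<in> A. M a \<in> Some ` (Z \<inter> S)}"
      moreover have "M a \<in> Some ` Z \<or> M a \<in> Some ` S" if "a \<in> A"
        using that cert M(2) by (fastforce simp: certificate_def)
      ultimately show "a \<in> {a \<in> A. M a \<in> Some ` S}" by auto
    qed
  qed (use fin in auto)
  finally show ?thesis by simp
qed

text \<open>Stochastic dominance. The induction removes a maximum on either side; thresholds up to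
  the removed value of \<open>f\<close> are not affected, since the removed value of
  \<open>g\<close> is no smaller.\<close>

lemma sum_le_if_dominated:
  fixes f :: "'a \<Rightarrow> real" and g :: "'b \<Rightarrow> real"
  assumes "finite A" "finite B" "card A = card B"
    and "\<And>k. card {b \<in> B. g b < k} \<le> card {a \<in> A. f a < k}"
  shows "sum f A \<le> sum g B"
  using assms
proof (induction "card A" arbitrary: A B)
  case 0
  then show ?case by simp
next
  case (Suc n)
  have "A \<noteq> {}" "B \<noteq> {}" using Suc.hyps(2) Suc.prems(3) by auto
  then have "Max (f ` A) \<in> f ` A" "Max (g ` B) \<in> g ` B" using Suc.prems by simp_all
  then obtain a b where a: "a \<in> A" "f a = Max (f ` A)" and b: "b \<in> B" "g b = Max (g ` B)"
    by (metis imageE)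
  have amax: "f x \<le> f a" if "x \<in> A" for x using a that Suc.prems by auto
  have bmax: "g x \<le> g b" if "x \<in> B" for x using b that Suc.prems by auto
  \<comment> \<open>Otherwise the threshold \<open>f a\<close> would count all of \<open>B\<close>,
    but not \<open>a\<close> itself.\<close>
  have ab: "f a \<le> g b"
  proof (rule ccontr)
    assume "\<not> f a \<le> g b"
    then have "{x \<in> B. g x < f a} = B" using bmax by force
    then have "card A \<le> card {x \<in> A. f x < f a}" using Suc.prems by metis
    moreover have "card {x \<in> A. f x < f a} < card A"
      using a(1) Suc.prems(1) by (intro psubset_card_mono) auto
    ultimately show False by simp
  qed
  have "sum f (A - {a}) \<le> sum g (B - {b})"
  proof (rule Suc.hyps(1))
    show "n = card (A - {a})" "card (A - {a}) = card (B - {b})"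
      using Suc.hyps(2) Suc.prems a b by auto
    fix k
    show "card {x \<in> B - {b}. g x < k} \<le> card {x \<in> A - {a}. f x < k}"
    proof (cases "f a < k")
      case True
      then have "{x \<in> A - {a}. f x < k} = A - {a}" using amax by force
      moreover have "card {x \<in> B - {b}. g x < k} \<le> card (B - {b})"
        using Suc.prems by (intro card_mono) auto
      ultimately show ?thesis using Suc.prems a b by simp
    next
      case False
      then have "{x \<in> A - {a}. f x < k} = {x \<in> A. f x < k}"
        "{x \<in> B - {b}. g x < k} = {x \<in> B. g x < k}" using ab by auto
        then show ?thesis using Suc.prems by simp
    qed
  qed (use Suc.prems in auto)
  then show ?case using ab a b Suc.prems by (simp add: sum.remove)
qed

section \<open>Popular assignments\<close>

locale capacitated_preferences =
  fixes A :: "'p set" and N :: "'p \<Rightarrow> 'i set" and r :: "'p \<Rightarrow> 'i \<Rightarrow> nat"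
    and cap :: "'i \<Rightarrow> nat" and L :: 'i
  assumes fin: "finite A"
    and finN: "a \<in> A \<Longrightarrow> finite (N a)"
    and L: "a \<in> A \<Longrightarrow> L \<in> N a"
    and capL: "card A \<le> cap L"
    and cap_pos: "a \<in> A \<Longrightarrow> x \<in> N a \<Longrightarrow> 0 < cap x"
begin

definition top :: "'p \<Rightarrow> 'i set" where
  "top a = {x \<in> N a. \<forall>y\<in>N a. r a x \<le> r a y}"

definition best_outside :: "'i set \<Rightarrow> 'p \<Rightarrow> 'i set" where
  "best_outside D a = {x \<in> N a - D. \<forall>y\<in>N a - D. r a x \<le> r a y}"

definition allowed :: "'i set \<Rightarrow> 'p \<Rightarrow> 'i set" where
  "allowed D a = best_outside D a \<union> (if top a \<subseteq> D then top a else {})"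

definition assignment :: "('p \<Rightarrow> 'i) \<Rightarrow> bool" where
  "assignment f \<longleftrightarrow> (\<forall>a\<in>A. f a \<in> N a) \<and> (\<forall>x. load A (Some \<circ> f) x \<le> cap x)"

definition votes :: "('p \<Rightarrow> 'i) \<Rightarrow> ('p \<Rightarrow> 'i) \<Rightarrow> 'p set" where
  "votes f g = {a \<in> A. r a (f a) < r a (g a)}"

definition pop :: "('p \<Rightarrow> 'i) \<Rightarrow> bool" where
  "pop f \<longleftrightarrow> assignment f \<and> (\<forall>g. assignment g \<longrightarrow> card (votes g f) \<le> card (votes f g))"

text \<open>People who gain by leaving \<open>f\<close> for \<open>g\<close> must move into \<open>D\<close>; since \<open>D\<close> is full, at least
  as many people are displaced from \<open>D\<close>, and these are at their top choice in \<open>f\<close>.\<close>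

lemma pop_if_allowed:
  assumes D: "finite D" "full_on A cap (Some \<circ> f) D"
    and f: "\<forall>x. load A (Some \<circ> f) x \<le> cap x" "\<forall>a\<in>A. f a \<in> allowed D a"
  shows "pop f"
proof -
  have inN: "f a \<in> N a" if "a \<in> A" for a
    using f(2) that by (fastforce simp: allowed_def best_outside_def top_def split: if_splits)
  have inD: "f a \<in> top a \<and> top a \<subseteq> D" if "a \<in> A" "f a \<in> D" for a
    using f(2) that by (fastforce simp: allowed_def best_outside_def split: if_splits)
  have outD: "f a \<in> best_outside D a" if "a \<in> A" "f a \<notin> D" for a
    using f(2) that by (fastforce simp: allowed_def split: if_splits)
  have "card (votes g f) \<le> card (votes f g)" if g: "assignment g" for g
  proof -
    let ?in = "\<lambda>h. {a \<in> A. h a \<in> D}"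
    have fin': "finite (?in h)" for h using fin by simp
    have card_in: "card (?in h) = (\<Sum>x\<in>D. load A (Some \<circ> h) x)" for h
    proof -
      have "?in h = {a \<in> A. (Some \<circ> h) a \<in> Some ` D}" by auto
      then show ?thesis using card_matched_into[OF fin D(1)] by metis
    qed
    have "load A (Some \<circ> g) x \<le> load A (Some \<circ> f) x" if "x \<in> D" for x
      using g D that unfolding full_on_def assignment_def by (meson order_trans)
    then have le: "card (?in g) \<le> card (?in f)" unfolding card_in by (rule sum_mono)
    have "card (votes g f) \<le> card (?in g - ?in f)"
    proof (rule card_mono)
      show "votes g f \<subseteq> ?in g - ?in f"
      proof
        fix a assume a: "a \<in> votes g f"
        then have *: "a \<in> A" "r a (g a) < r a (f a)" "g a \<in> N a"
          using g by (auto simp: votes_def assignment_def)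
        have "f a \<notin> D" using inD[of a] * by (fastforce simp: top_def)
        moreover from this have "g a \<in> D"
          using outD[OF *(1)] * by (auto simp: best_outside_def not_le[symmetric])
        ultimately show "a \<in> ?in g - ?in f" using * by auto
      qed
    qed (use fin in auto)
    also have "\<dots> \<le> card (?in f - ?in g)"
    proof -
      have "card (?in g - ?in f) + card (?in g \<inter> ?in f) = card (?in g)"
        "card (?in f - ?in g) + card (?in g \<inter> ?in f) = card (?in f)"
        using card_Diff_subset_Int[of "?in g" "?in f"] card_Diff_subset_Int[of "?in f" "?in g"]
          card_mono[OF fin'[of g], of "?in g \<inter> ?in f"] card_mono[OF fin'[of f], of "?in g \<inter> ?in f"]
          fin by (auto simp: Int_commute)
      then show ?thesis using le by linarith
    qed
    also have "\<dots> \<le> card (votes f g)"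
    proof (rule card_mono)
      show "?in f - ?in g \<subseteq> votes f g"
      proof
        fix a assume "a \<in> ?in f - ?in g"
        then have *: "a \<in> A" "f a \<in> D" "g a \<notin> D" "g a \<in> N a"
          using g by (auto simp: assignment_def)
        have t: "f a \<in> top a" "top a \<subseteq> D" using inD * by auto
        then have "g a \<notin> top a" using * by auto
        then obtain y where "y \<in> N a" "r a y < r a (g a)"
          using * by (auto simp: top_def not_le)
        moreover from this have "r a (f a) \<le> r a y" using t by (auto simp: top_def)
        ultimately show "a \<in> votes f g" using * by (auto simp: votes_def)
      qed
    qed (use fin in \<open>auto simp: votes_def\<close>)
    finally show ?thesis .
  qed
  then show ?thesis using f inN by (auto simp: pop_def assignment_def)
qed

section \<open>Exchange walks and the set of tight items\<close>

fun walk :: "('p \<Rightarrow> 'i) \<Rightarrow> 'i \<Rightarrow> ('p \<times> 'i) list \<Rightarrow> 'i \<Rightarrow> bool" where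
  "walk f x [] y \<longleftrightarrow> x = y"
| "walk f x ((a, z) # ps) y \<longleftrightarrow> a \<in> A \<and> f a = x \<and> z \<in> N a \<and> walk f z ps y"

text \<open>Each pair \<open>(a, z)\<close> of a walk moves \<open>a\<close> from her item to
  \<open>z\<close>, which the next person leaves. Carrying out all moves therefore changes only the
  loads of the two end items, provided that no person moves twice; items may recur.\<close>

fun reassign :: "('p \<Rightarrow> 'i) \<Rightarrow> ('p \<times> 'i) list \<Rightarrow> ('p \<Rightarrow> 'i)" where
  "reassign f [] = f"
| "reassign f ((a, z) # ps) = reassign (f(a := z)) ps"

lemma walk_append: "walk f x (ps @ qs) y \<longleftrightarrow> (\<exists>z. walk f x ps z \<and> walk f z qs y)"
  by (induction ps arbitrary: x) auto

lemma walk_update: "a \<notin> fst ` set ps \<Longrightarrow> walk (f(a := z)) x ps y \<longleftrightarrow> walk f x ps y"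
  by (induction ps arbitrary: x) auto

lemma walk_edge: "walk f x ps y \<Longrightarrow> (a, z) \<in> set ps \<Longrightarrow> a \<in> A \<and> z \<in> N a"
  by (induction ps arbitrary: x) auto

lemma reassign_notin: "a \<notin> fst ` set ps \<Longrightarrow> reassign f ps a = f a"
  by (induction ps arbitrary: f) auto

lemma reassign_in: "distinct (map fst ps) \<Longrightarrow> (a, z) \<in> set ps \<Longrightarrow> reassign f ps a = z"
  by (induction ps arbitrary: f) (auto simp: reassign_notin)

lemma load_reassign:
  "walk f x ps y \<Longrightarrow> distinct (map fst ps) \<Longrightarrow>
   load A (Some \<circ> reassign f ps) w + of_bool (x = w) = load A (Some \<circ> f) w + of_bool (y = w)"
proof (induction ps arbitrary: f x)
  case Nil
  then show ?case by simp
next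
  case (Cons p ps)
  obtain a z where p: "p = (a, z)" by (cases p)
  have a: "a \<in> A" "f a = x" "a \<notin> fst ` set ps" "walk f z ps y"
    using Cons.prems p by auto
  have "load A (Some \<circ> reassign (f(a := z)) ps) w + of_bool (z = w)
      = load A (Some \<circ> f(a := z)) w + of_bool (y = w)"
  proof (rule Cons.IH)
    show "walk (f(a := z)) z ps y" using a(4) by (simp only: walk_update[OF a(3)])
    show "distinct (map fst ps)" using Cons.prems by simp
  qed
  moreover have "load A (Some \<circ> f(a := z)) w + of_bool (x = w) = load A (Some \<circ> f) w + of_bool (z = w)"
    using load_update[OF fin a(1), of "Some \<circ> f" "Some z" w] a(2) by (simp add: fun_upd_comp)
  ultimately have "load A (Some \<circ> reassign (f(a := z)) ps) w + of_bool (x = w)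
      = load A (Some \<circ> f) w + of_bool (y = w)" by linarith
  then show ?case by (simp only: p reassign.simps)
qed

definition gain :: "('p \<Rightarrow> 'i) \<Rightarrow> ('p \<times> 'i) list \<Rightarrow> 'p set" where
  "gain f ps = {a. \<exists>z. (a, z) \<in> set ps \<and> r a z < r a (f a)}"

definition lose :: "('p \<Rightarrow> 'i) \<Rightarrow> ('p \<times> 'i) list \<Rightarrow> 'p set" where
  "lose f ps = {a. \<exists>z. (a, z) \<in> set ps \<and> r a (f a) < r a z}"

text \<open>A cyclic walk changes no load, and an open one needs a free place only at its end. So
  the reassigned function is an assignment that may be compared with \<open>f\<close>.\<close>

lemma pop_walk:
  assumes pop: "pop f" and walk: "walk f x ps y" "distinct (map fst ps)"
    and y: "x = y \<or> load A (Some \<circ> f) y < cap y"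
  shows "card (gain f ps) \<le> card (lose f ps)"
proof -
  let ?g = "reassign f ps"
  have "assignment ?g"
    unfolding assignment_def
  proof (intro conjI ballI allI)
    fix a assume "a \<in> A"
    then show "?g a \<in> N a"
      using pop walk_edge[OF walk(1)] reassign_notin[of a ps f] reassign_in[OF walk(2)]
      by (cases "a \<in> fst ` set ps") (auto simp: pop_def assignment_def)
  next
    fix w
    have "load A (Some \<circ> f) w \<le> cap w" using pop by (auto simp: pop_def assignment_def)
    then show "load A (Some \<circ> ?g) w \<le> cap w"
      using load_reassign[OF walk, of w] y by (cases "y = w"; cases "x = w") auto
  qed
  moreover have "(a \<in> votes ?g f \<longleftrightarrow> a \<in> gain f ps) \<and> (a \<in> votes f ?g \<longleftrightarrow> a \<in> lose f ps)" for a
  proof (cases "a \<in> fst ` set ps")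
    case True
    then obtain z where z: "(a, z) \<in> set ps" by auto
    then have "(a, w) \<in> set ps \<longleftrightarrow> w = z" for w
      using eq_key_imp_eq_value[OF walk(2)] by auto
    then show ?thesis
      using walk_edge[OF walk(1) z] reassign_in[OF walk(2) z, of f]
      by (simp add: votes_def gain_def lose_def)
  next
    case False
    then have "(a, w) \<notin> set ps" for w by force
    then show ?thesis using reassign_notin[OF False, of f] by (simp add: votes_def gain_def lose_def)
  qed
  then have "votes ?g f = gain f ps" "votes f ?g = lose f ps" by auto
  ultimately show ?thesis using pop by (auto simp: pop_def)
qed

lemma pop_walk_no_loss:
  assumes "pop f" "walk f x ps y" "distinct (map fst ps)"
    and "x = y \<or> load A (Some \<circ> f) y < cap y" "lose f ps = {}"
  shows "gain f ps = {}"
proof -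
  have "gain f ps \<subseteq> A" using walk_edge[OF assms(2)] by (auto simp: gain_def)
  then have "finite (gain f ps)" using fin finite_subset by auto
  then show ?thesis using pop_walk[OF assms(1-4)] assms(5) by simp
qed

text \<open>The set on which the optimal dual variables of the popularity linear program are 1.\<close>

inductive_set tight :: "('p \<Rightarrow> 'i) \<Rightarrow> 'i set" for f where
  better: "a \<in> A \<Longrightarrow> z \<in> N a \<Longrightarrow> r a z < r a (f a) \<Longrightarrow> z \<in> tight f"
| tie: "a \<in> A \<Longrightarrow> f a \<in> tight f \<Longrightarrow> z \<in> N a \<Longrightarrow> r a z = r a (f a) \<Longrightarrow> z \<in> tight f"

lemma tight_subset: "tight f \<subseteq> (\<Union>a\<in>A. N a)"
  by (auto elim: tight.cases)

lemma finite_tight: "finite (tight f)"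
  using tight_subset fin finN by (meson finite_UN finite_subset)

text \<open>The people must be distinct for the moves to be carried out. If the new person already
  moves along a tie, the walk is cut at her move; if she is \<open>h\<close>, the walk is a cycle
  with a gain and no loss, against popularity.\<close>

lemma tight_walk:
  assumes pop: "pop f" and "y \<in> tight f"
  shows "\<exists>x h w ps. walk f x ((h, w) # ps) y \<and> distinct (map fst ((h, w) # ps)) \<and>
    r h w < r h (f h) \<and> (\<forall>(a, z)\<in>set ps. r a z = r a (f a))"
  using assms(2)
proof induction
  case (better a z)
  then have "walk f (f a) ((a, z) # []) z" by simp
  then show ?case using better by fastforce
next
  case (tie a z)
  then obtain x h w ps where W: "walk f x ((h, w) # ps) (f a)" "distinct (map fst ((h, w) # ps))"
      "r h w < r h (f h)" "\<forall>(b, v)\<in>set ps. r b v = r b (f b)" by blast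
  consider "a = h" | "a \<noteq> h" "a \<in> fst ` set ps" | "a \<noteq> h" "a \<notin> fst ` set ps" by blast
  then show ?case
  proof cases
    case 1
    have "lose f ((h, w) # ps) = {}" using W by (fastforce simp: lose_def)
    then have "gain f ((h, w) # ps) = {}"
      using pop_walk_no_loss[OF pop W(1,2)] W(1) 1 by auto
    then show ?thesis using W(3) by (auto simp: gain_def)
  next
    case 2
    then obtain v us vs where ps: "ps = us @ (a, v) # vs" by (auto dest!: split_list)
    have "walk f x ((h, w) # us @ [(a, z)]) z"
      using W(1) tie ps by (auto simp: walk_append)
    moreover have "distinct (map fst ((h, w) # us @ [(a, z)]))" using W(2) 2 ps by auto
    moreover have "\<forall>(b, v)\<in>set (us @ [(a, z)]). r b v = r b (f b)" using W(4) tie ps by auto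
    ultimately show ?thesis using W(3) by blast
  next
    case 3
    have "walk f x ((h, w) # ps @ [(a, z)]) z"
      using W(1) tie by (auto simp: walk_append)
    moreover have "distinct (map fst ((h, w) # ps @ [(a, z)]))" using W(2) 3 by auto
    moreover have "\<forall>(b, v)\<in>set (ps @ [(a, z)]). r b v = r b (f b)" using W(4) tie by auto
    ultimately show ?thesis using W(3) by blast
  qed
qed

text \<open>Otherwise the walk to the free place promotes its first person and harms nobody.\<close>

lemma tight_full:
  assumes "pop f" shows "full_on A cap (Some \<circ> f) (tight f)"
  unfolding full_on_def
proof (intro ballI leI notI)
  fix y assume y: "y \<in> tight f" "load A (Some \<circ> f) y < cap y"
  obtain x h w ps where W: "walk f x ((h, w) # ps) y" "distinct (map fst ((h, w) # ps))"
      "r h w < r h (f h)" "\<forall>(b, v)\<in>set ps. r b v = r b (f b)"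
    using tight_walk[OF assms y(1)] by blast
  have "lose f ((h, w) # ps) = {}" using W by (fastforce simp: lose_def)
  then have "gain f ((h, w) # ps) = {}"
    using pop_walk_no_loss[OF assms W(1,2)] y(2) by auto
  then show False using W(3) by (auto simp: gain_def)
qed

text \<open>Otherwise two people could be promoted at the expense of a single one, who is sent to \<open>L\<close>.\<close>

lemma tight_top:
  assumes pop: "pop f" and a: "a \<in> A" "f a \<in> tight f"
  shows "f a \<in> top a"
proof (rule ccontr)
  have fN: "f b \<in> N b" if "b \<in> A" for b using pop that by (auto simp: pop_def assignment_def)
  assume "f a \<notin> top a"
  then obtain c where c: "c \<in> N a" "r a c < r a (f a)"
    using fN[OF a(1)] by (auto simp: top_def not_le)
  obtain x h w ps where W: "walk f x ((h, w) # ps) (f a)" "distinct (map fst ((h, w) # ps))"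
      "r h w < r h (f h)" "\<forall>(b, v)\<in>set ps. r b v = r b (f b)"
    using tight_walk[OF pop a(2)] by blast
  have "a \<noteq> h"
  proof
    assume "a = h"
    moreover have "lose f ((h, w) # ps) = {}" using W by (fastforce simp: lose_def)
    ultimately have "gain f ((h, w) # ps) = {}"
      using pop_walk_no_loss[OF pop W(1,2)] W(1) by auto
    then show False using W(3) by (auto simp: gain_def)
  qed
  \<comment> \<open>If \<open>a\<close> moves on the walk already, the walk up to her move still
    ends at \<open>f a\<close>; she is then free to make the final move to \<open>c\<close>.\<close>
  obtain us where U: "walk f x ((h, w) # us) (f a)" "distinct (map fst ((h, w) # us))"
      "\<forall>(b, v)\<in>set us. r b v = r b (f b)" "a \<notin> fst ` set us"
  proof (cases "a \<in> fst ` set ps")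
    case True
    then obtain v us vs where ps: "ps = us @ (a, v) # vs" by (auto dest!: split_list)
    show ?thesis by (rule that[of us]) (use W ps in \<open>auto simp: walk_append\<close>)
  next
    case False
    then show ?thesis using W that by blast
  qed
  define Q where "Q = (h, w) # us @ [(a, c)]"
  have Q: "walk f x Q c" "distinct (map fst Q)"
    using U a c \<open>a \<noteq> h\<close> by (auto simp: Q_def walk_append)
  have lossQ: "lose f Q = {}" using U(3) c W(3) by (fastforce simp: lose_def Q_def)
  have gainQ: "{h, a} \<subseteq> gain f Q" using c W(3) by (auto simp: gain_def Q_def)
  have x: "f h = x" "h \<in> A" using U(1) by auto
  have "\<not> load A (Some \<circ> f) c < cap c"
    using pop_walk_no_loss[OF pop Q _ lossQ] gainQ by auto
  then have "0 < load A (Some \<circ> f) c" using cap_pos[OF a(1) c(1)] by linarith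
  then obtain p where p: "p \<in> A" "f p = c" by (auto simp: load_pos_iff[OF fin])
  show False
  \<comment> \<open>If \<open>p\<close> moves on \<open>Q\<close>, the part of \<open>Q\<close> from
    her move on is a cycle through \<open>c\<close> that ends with the gain of \<open>a\<close>.
    Otherwise she is sent to \<open>L\<close>: \<open>h\<close> and \<open>a\<close> gain, and only
    \<open>p\<close> can lose.\<close>
  proof (cases "p \<in> fst ` set Q")
    case True
    then obtain q us' vs where Q': "Q = us' @ (p, q) # vs" by (auto dest!: split_list)
    then have C: "walk f c ((p, q) # vs) c" "distinct (map fst ((p, q) # vs))"
      using Q p by (auto simp: walk_append)
    have "lose f ((p, q) # vs) = {}" using lossQ Q' by (auto simp: lose_def)
    then have "gain f ((p, q) # vs) = {}" using pop_walk_no_loss[OF pop C] by simp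
    moreover have "last ((p, q) # vs) = (a, c)"
    proof -
      have "last Q = (a, c)" by (simp add: Q_def)
      then show ?thesis using Q' by simp
    qed
    then have "(a, c) \<in> set ((p, q) # vs)" by (metis last_in_set list.distinct(1))
    ultimately show False using c by (auto simp: gain_def)
  next
    case False
    let ?Q = "Q @ [(p, L)]"
    have W': "walk f x ?Q L" "distinct (map fst ?Q)"
      using Q p L False by (auto simp: walk_append)
    \<comment> \<open>If \<open>L\<close> has no free place, its capacity forces everybody, in
      particular \<open>h\<close>, to be at \<open>L\<close>; then the walk is a cycle.\<close>
    have "x = L \<or> load A (Some \<circ> f) L < cap L"
    proof (rule disjCI)
      assume "\<not> load A (Some \<circ> f) L < cap L"
      then have "card A \<le> card {b \<in> A. f b = L}" using capL by (simp add: load_def)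
      then have "{b \<in> A. f b = L} = A" using fin by (intro card_seteq) auto
      then show "x = L" using x by auto
    qed
    then have "card (gain f ?Q) \<le> card (lose f ?Q)" using pop_walk[OF pop W'] by simp
    also have "\<dots> \<le> card {p}"
      using lossQ by (intro card_mono) (auto simp: lose_def)
    finally have "card (gain f ?Q) \<le> 1" by simp
    moreover have "gain f ?Q \<subseteq> A" using walk_edge[OF W'(1)] unfolding gain_def by blast
    then have "card {h, a} \<le> card (gain f ?Q)"
      using gainQ fin by (intro card_mono) (auto simp: gain_def finite_subset)
    ultimately show False using \<open>a \<noteq> h\<close> by simp
  qed
qed

lemma tight_closed:
  assumes pop: "pop f" and a: "a \<in> A" "f a \<in> tight f"
  shows "top a \<subseteq> tight f"
proof
  fix z assume z: "z \<in> top a"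
  then have "r a z = r a (f a)" using tight_top[OF assms] by (auto simp: top_def intro: antisym)
  then show "z \<in> tight f" using z a tight.tie by (auto simp: top_def)
qed

lemma outside_tight:
  assumes pop: "pop f" and a: "a \<in> A" "f a \<notin> tight f"
  shows "f a \<in> best_outside (tight f) a"
  using assms tight.better[OF a(1), of _ f]
  by (auto simp: best_outside_def pop_def assignment_def not_le[symmetric])

text \<open>Complementary slackness: \<open>D\<close> together with the people who have a top choice
  outside \<open>D\<close> is a vertex cover of the graph of top choices, in which the items have
  weight \<open>cap\<close>.\<close>

definition koenig :: "('p \<Rightarrow> 'i option) \<Rightarrow> 'i set \<Rightarrow> bool" where
  "koenig M D \<longleftrightarrow> full_on A cap M D \<and> closed_set A top M D \<and>
     (\<forall>a\<in>A. \<not> top a \<subseteq> D \<longrightarrow> M a \<noteq> None)"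

text \<open>Weak duality and its case of equality: at most \<open>sum cap D\<close> people are
  matched into \<open>D\<close>, and those matched elsewhere have a top choice outside
  \<open>D\<close>.\<close>

lemma koenig:
  assumes M: "partial_matching A top cap M" and D: "finite D"
  shows "card {a \<in> A. M a \<noteq> None} \<le> sum cap D + card {a \<in> A. \<not> top a \<subseteq> D}" (is ?le)
    and "koenig M D \<longleftrightarrow>
      sum cap D + card {a \<in> A. \<not> top a \<subseteq> D} \<le> card {a \<in> A. M a \<noteq> None}" (is ?iff)
proof -
  let ?P = "{a \<in> A. M a \<in> Some ` D}" and ?Q = "{a \<in> A. M a \<noteq> None \<and> M a \<notin> Some ` D}"
  let ?Y = "{a \<in> A. \<not> top a \<subseteq> D}"
  have "{a \<in> A. M a \<noteq> None} = ?P \<union> ?Q" by auto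
  then have split: "card {a \<in> A. M a \<noteq> None} = card ?P + card ?Q"
    using fin by (simp, subst card_Un_disjoint) auto
  have QY: "?Q \<subseteq> ?Y" using M by (fastforce simp: partial_matching_def)
  then have cQY: "card ?Q \<le> card ?Y" using fin by (intro card_mono) auto
  have le: "load A M x \<le> cap x" for x using M by (auto simp: partial_matching_def)
  have P: "card ?P = sum (load A M) D" using card_matched_into[OF fin D] by simp
  then have cP: "card ?P \<le> sum cap D" using le by (simp add: sum_mono)
  show ?le using split cQY cP by simp
  show ?iff
  proof
    assume k: "koenig M D"
    have "?Y \<subseteq> ?Q" using k by (auto simp: koenig_def closed_set_def)
    then have "card ?Y \<le> card ?Q" using fin by (intro card_mono) auto
    moreover have "sum cap D \<le> card ?P"
      using k P by (auto simp: koenig_def full_on_def intro: sum_mono)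
    ultimately show "sum cap D + card ?Y \<le> card {a \<in> A. M a \<noteq> None}" using split by simp
  next
    assume "sum cap D + card ?Y \<le> card {a \<in> A. M a \<noteq> None}"
    then have eq: "card ?P = sum cap D" "card ?Q = card ?Y" using split cP cQY by auto
    have "?Q = ?Y" using QY eq(2) fin by (intro card_subset_eq) auto
    moreover have "load A M x = cap x" if "x \<in> D" for x
      using sum_mono_inv[of "load A M" D cap x] eq P that D le by auto
    ultimately show "koenig M D"
      by (fastforce simp: koenig_def full_on_def closed_set_def)
  qed
qed

text \<open>The part \<open>f0\<close> of \<open>f\<close> that gives top choices has
  \<open>tight f\<close> as a Koenig set, while \<open>M\<close> has \<open>D\<close>. So both
  matchings are maximum, and by the case of equality each of the two sets fits both
  matchings.\<close>

lemma allowed_if_pop: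
  assumes pop: "pop f" and D: "finite D" and M: "partial_matching A top cap M" "koenig M D"
    and greatest: "\<And>Z. finite Z \<Longrightarrow> closed_set A top M Z \<Longrightarrow> full_on A cap M Z \<Longrightarrow>
      Z \<subseteq> (\<Union>a\<in>A. N a) \<Longrightarrow> Z \<subseteq> D"
  shows "full_on A cap (Some \<circ> f) D" and "a \<in> A \<Longrightarrow> f a \<in> allowed D a"
proof -
  let ?T = "tight f"
  define f0 where "f0 = (\<lambda>a. if f a \<in> top a then Some (f a) else None)"
  have le: "load A f0 x \<le> load A (Some \<circ> f) x" for x
    unfolding load_def f0_def using fin by (intro card_mono) auto
  have cap: "load A (Some \<circ> f) x \<le> cap x" for x
    using pop by (auto simp: pop_def assignment_def)
  have pm: "partial_matching A top cap f0"
    using le cap order_trans by (fastforce simp: partial_matching_def f0_def)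
  have "koenig f0 ?T"
    unfolding koenig_def
  proof (intro conjI ballI impI)
    have "{a \<in> A. f0 a = Some x} = {a \<in> A. (Some \<circ> f) a = Some x}" if "x \<in> ?T" for x
      using that tight_top[OF pop] by (auto simp: f0_def split: if_splits)
    then have "load A f0 x = load A (Some \<circ> f) x" if "x \<in> ?T" for x
      using that by (simp add: load_def)
    then show "full_on A cap f0 ?T" using tight_full[OF pop] by (simp add: full_on_def)
  next
    show "closed_set A top f0 ?T"
      using tight_closed[OF pop] by (auto simp: closed_set_def f0_def split: if_splits)
  next
    fix a assume a: "a \<in> A" "\<not> top a \<subseteq> ?T"
    then obtain z where z: "z \<in> top a" "z \<notin> ?T" by auto
    have "f a \<in> best_outside ?T a" using a tight_closed[OF pop] outside_tight[OF pop] by blast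
    then have "f a \<in> N a" "r a (f a) \<le> r a z" using z by (auto simp: best_outside_def top_def)
    then have "f a \<in> top a" using z(1) order_trans unfolding top_def by blast
    then show "f0 a \<noteq> None" by (simp add: f0_def)
  qed
  then have *: "sum cap ?T + card {a \<in> A. \<not> top a \<subseteq> ?T} \<le> card {a \<in> A. f0 a \<noteq> None}"
    by (simp only: koenig(2)[OF pm finite_tight])
  have **: "sum cap D + card {a \<in> A. \<not> top a \<subseteq> D} \<le> card {a \<in> A. M a \<noteq> None}"
    using M(2) by (simp only: koenig(2)[OF M(1) D])
  have kM: "koenig M ?T" and k0: "koenig f0 D"
    unfolding koenig(2)[OF M(1) finite_tight] koenig(2)[OF pm D]
    using * ** koenig(1)[OF pm D] koenig(1)[OF M(1) finite_tight, of f] by linarith+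
  have sub: "?T \<subseteq> D" using kM greatest finite_tight tight_subset by (auto simp: koenig_def)
  show "full_on A cap (Some \<circ> f) D"
    using k0 le order_trans unfolding koenig_def full_on_def by blast
  show "f a \<in> allowed D a" if a: "a \<in> A"
  proof (cases "f a \<in> D")
    \<comment> \<open>\<open>f0\<close> fills \<open>D\<close> to capacity, so \<open>f\<close> has
      nobody in \<open>D\<close> beyond those at a top choice.\<close>
    case True
    then have "card {b \<in> A. (Some \<circ> f) b = Some (f a)} \<le> card {b \<in> A. f0 b = Some (f a)}"
      using k0 order_trans[OF cap[of "f a"]] unfolding koenig_def full_on_def load_def by blast
    moreover have "{b \<in> A. f0 b = Some (f a)} \<subseteq> {b \<in> A. (Some \<circ> f) b = Some (f a)}"
      by (auto simp: f0_def split: if_splits)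
    ultimately have "{b \<in> A. f0 b = Some (f a)} = {b \<in> A. (Some \<circ> f) b = Some (f a)}"
      using fin by (intro card_seteq) auto
    then have "f0 a = Some (f a)" using a by auto
    then have "f a \<in> top a" "top a \<subseteq> D"
      using k0 True a by (auto simp: f0_def koenig_def closed_set_def split: if_splits)
    then show ?thesis by (simp add: allowed_def)
  next
    case False
    then have "f a \<in> best_outside ?T a" using outside_tight[OF pop a] sub by auto
    then show ?thesis using False sub by (auto simp: allowed_def best_outside_def)
  qed
qed

text \<open>A person whom \<open>M\<close> matches into \<open>D - Z\<close> has an allowed item
  outside the closed set \<open>Z\<close>, so \<open>M'\<close> does not match her into
  \<open>Z\<close>; by the certificate she is then in \<open>D - Z\<close>. Hence \<open>M'\<close>
  uses \<open>D - Z\<close> as much as \<open>M\<close> does, that is, fully. The rest of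
  \<open>D\<close> is full by the certificate.\<close>

lemma complete_fills:
  assumes D: "finite D" and M: "partial_matching A top cap M" "koenig M D"
    and M': "partial_matching A (allowed D) cap M'" "\<forall>a\<in>A. M' a \<noteq> None"
    and cert: "certificate A (allowed D) cap M' D U Z"
  shows "full_on A cap M' D"
proof -
  have cap: "load A M' x \<le> cap x" for x using M' by (auto simp: partial_matching_def)
  have fin': "finite (D - Z)" using D by simp
  have "{p \<in> A. M p \<in> Some ` (D - Z)} \<subseteq> {p \<in> A. M' p \<in> Some ` (D - Z)}"
  proof
    fix p assume "p \<in> {p \<in> A. M p \<in> Some ` (D - Z)}"
    then obtain x where p: "p \<in> A" "M p = Some x" "x \<in> D" "x \<notin> Z" by auto
    have "top p \<subseteq> D" using M(2) p by (auto simp: koenig_def closed_set_def)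
    moreover have "x \<in> top p" using M(1) p by (auto simp: partial_matching_def)
    ultimately have "x \<in> allowed D p" by (auto simp: allowed_def)
    then have "M' p \<notin> Some ` Z" using cert p by (auto simp: certificate_def closed_set_def)
    moreover obtain y where "M' p = Some y" using M'(2) p by auto
    ultimately show "p \<in> {p \<in> A. M' p \<in> Some ` (D - Z)}"
      using cert p by (auto simp: certificate_def)
  qed
  then have "sum (load A M) (D - Z) \<le> sum (load A M') (D - Z)"
    unfolding card_matched_into[OF fin fin', symmetric] using fin by (intro card_mono) auto
  moreover have "sum cap (D - Z) \<le> sum (load A M) (D - Z)"
    using M(2) by (intro sum_mono) (auto simp: koenig_def full_on_def)
  moreover have "sum (load A M') (D - Z) \<le> sum cap (D - Z)" using cap by (rule sum_mono)
  ultimately have eq: "sum (load A M') (D - Z) = sum cap (D - Z)" by simp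
  have "load A M' x = cap x" if "x \<in> D - Z" for x
    using sum_mono_inv[OF eq _ that fin'] cap by simp
  then show ?thesis using cert by (fastforce simp: full_on_def certificate_def)
qed

end

section \<open>Reasoning about programs\<close>

text \<open>Time is accounted for by credits: every step consumes one of the \<open>n\<close> credits, and the
  postcondition speaks about those left. Loop invariants can thus require credits to pay for
  the remaining work, which also yields termination.\<close>

definition wp :: "com \<Rightarrow> (state \<Rightarrow> int \<Rightarrow> bool) \<Rightarrow> state \<Rightarrow> int \<Rightarrow> bool" where
  "wp c Q s n \<longleftrightarrow> (\<exists>t s'. exec c s t s' \<and> Q s' (n - int t))"

definition runs :: "com \<Rightarrow> state \<Rightarrow> int \<Rightarrow> (state \<Rightarrow> bool) \<Rightarrow> bool" where
  "runs c s k R \<longleftrightarrow> (\<exists>t s'. exec c s t s' \<and> int t \<le> k \<and> R s')"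

inductive_cases Skip_E: "exec Skip s t s'"
inductive_cases Put_E: "exec (Put x i e) s t s'"
inductive_cases RPut_E: "exec (RPut x i e) s t s'"
inductive_cases Seq_E: "exec (Seq p q) s t s'"
inductive_cases If_E: "exec (If b p q) s t s'"

lemma wp_Skip [simp]: "wp Skip Q s n \<longleftrightarrow> Q s (n - 1)"
  unfolding wp_def by (force elim: Skip_E intro: exec.Skip)

lemma wp_Put [simp]: "wp (Put x i e) Q s n \<longleftrightarrow> Q (put x (nval i s) (nval e s) s) (n - 1)"
  unfolding wp_def by (force elim: Put_E intro: exec.Put)

lemma wp_RPut [simp]: "wp (RPut x i e) Q s n \<longleftrightarrow> Q (rput x (nval i s) (rval e s) s) (n - 1)"
  unfolding wp_def by (force elim: RPut_E intro: exec.RPut)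

lemma wp_Seq [simp]: "wp (Seq p q) Q s n \<longleftrightarrow> wp p (wp q Q) s n"
proof
  assume "wp (Seq p q) Q s n"
  then show "wp p (wp q Q) s n"
    unfolding wp_def by (force elim!: Seq_E simp: algebra_simps)
next
  assume "wp p (wp q Q) s n"
  then obtain t s' t' s'' where "exec p s t s'" "exec q s' t' s''" "Q s'' (n - int t - int t')"
    unfolding wp_def by blast
  then show "wp (Seq p q) Q s n"
    unfolding wp_def by (intro exI[of _ "t + t'"] exI[of _ s'']) (simp_all add: exec.Seq diff_diff_eq)
qed

lemma wp_If [simp]:
  "wp (If b p q) Q s n \<longleftrightarrow> (if bval b s then wp p Q s (n - 1) else wp q Q s (n - 1))"
proof
  assume "wp (If b p q) Q s n"
  then show "if bval b s then wp p Q s (n - 1) else wp q Q s (n - 1)"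
    unfolding wp_def by (force elim!: If_E simp: algebra_simps)
next
  assume *: "if bval b s then wp p Q s (n - 1) else wp q Q s (n - 1)"
  show "wp (If b p q) Q s n"
  proof (cases "bval b s")
    case True
    then obtain t s' where "exec p s t s'" "Q s' (n - 1 - int t)" using * by (auto simp: wp_def)
    then show ?thesis
      using exec.IfTrue[of b s p t s' q] True unfolding wp_def
      by (intro exI[of _ "t + 1"] exI[of _ s']) (simp add: diff_diff_eq)
  next
    case False
    then obtain t s' where "exec q s t s'" "Q s' (n - 1 - int t)" using * by (auto simp: wp_def)
    then show ?thesis
      using exec.IfFalse[of b s q t s' p] False unfolding wp_def
      by (intro exI[of _ "t + 1"] exI[of _ s']) (simp add: diff_diff_eq)
  qed
qed

lemma runs_wp: "runs c s k R \<longleftrightarrow> wp c (\<lambda>s' n. R s' \<and> 0 \<le> n) s k"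
  unfolding runs_def wp_def by auto

lemma runs_Seq_assoc: "runs (Seq (Seq p q) r) = runs (Seq p (Seq q r))"
proof -
  have "wp (Seq q r) Q = wp q (wp r Q)" for Q by (intro ext wp_Seq)
  then show ?thesis by (intro ext) (simp add: runs_wp)
qed

lemma wp_runs:
  assumes "runs c s k R" "\<And>s' m. R s' \<Longrightarrow> n - k \<le> m \<Longrightarrow> Q s' m"
  shows "wp c Q s n"
  using assms unfolding runs_def wp_def by fastforce

lemma runs_mono: "runs c s k R \<Longrightarrow> k \<le> k' \<Longrightarrow> (\<And>s'. R s' \<Longrightarrow> R' s') \<Longrightarrow> runs c s k' R'"
  unfolding runs_def by fastforce

primrec writes :: "com \<Rightarrow> string set" where
  "writes Skip = {}"
| "writes (Put x i e) = {x}"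
| "writes (RPut x i e) = {}"
| "writes (Seq p q) = writes p \<union> writes q"
| "writes (If b p q) = writes p \<union> writes q"
| "writes (While b p) = writes p"

primrec rwrites :: "com \<Rightarrow> string set" where
  "rwrites Skip = {}"
| "rwrites (Put x i e) = {}"
| "rwrites (RPut x i e) = {x}"
| "rwrites (Seq p q) = rwrites p \<union> rwrites q"
| "rwrites (If b p q) = rwrites p \<union> rwrites q"
| "rwrites (While b p) = rwrites p"

text \<open>The frame condition: it lets loop invariants mention only the arrays that a program
  writes.\<close>

definition unchanged :: "com \<Rightarrow> state \<Rightarrow> state \<Rightarrow> bool" where
  "unchanged c s s' \<longleftrightarrow> (\<forall>x. x \<notin> writes c \<longrightarrow> nats s' x = nats s x) \<and>
     (\<forall>x. x \<notin> rwrites c \<longrightarrow> reals s' x = reals s x)"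

lemma nats_put [simp]: "nats (put x i v s) y = (if y = x then (nats s x)(i := v) else nats s y)"
  and nats_rput [simp]: "nats (rput x i u s) = nats s"
  and reals_put [simp]: "reals (put x i v s) = reals s"
  and reals_rput [simp]: "reals (rput x i u s) y = (if y = x then (reals s x)(i := u) else reals s y)"
  by (auto simp: put_def rput_def)

lemma unchanged_refl [simp]: "unchanged c s s"
  by (simp add: unchanged_def)

lemma unchanged_trans: "unchanged c s s' \<Longrightarrow> unchanged c s' s'' \<Longrightarrow> unchanged c s s''"
  by (simp add: unchanged_def)

lemma unchanged_nats: "unchanged c s s' \<Longrightarrow> x \<notin> writes c \<Longrightarrow> nats s' x = nats s x"
  and unchanged_reals: "unchanged c s s' \<Longrightarrow> x \<notin> rwrites c \<Longrightarrow> reals s' x = reals s x"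
  by (simp_all add: unchanged_def)

lemma exec_unchanged: "exec c s t s' \<Longrightarrow> unchanged c s s'"
  by (induction rule: exec.induct) (auto simp: unchanged_def)

lemma runs_Seq:
  assumes "runs p s k P" "\<And>s'. P s' \<Longrightarrow> unchanged p s s' \<Longrightarrow> runs q s' l Q" "k + l \<le> m"
  shows "runs (Seq p q) s m Q"
proof -
  obtain t s' where t: "exec p s t s'" "int t \<le> k" "P s'" using assms(1) by (auto simp: runs_def)
  then obtain t' s'' where t': "exec q s' t' s''" "int t' \<le> l" "Q s''"
    using assms(2) exec_unchanged unfolding runs_def by blast
  then show ?thesis using exec.Seq[OF t(1) t'(1)] t assms(3) unfolding runs_def
    by (intro exI[of _ "t + t'"] exI[of _ s'']) simp
qed

lemma runs_unchanged: "runs c s k R \<Longrightarrow> runs c s k (\<lambda>s'. R s' \<and> unchanged c s s')"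
  unfolding runs_def using exec_unchanged by blast

text \<open>Induction on the credits: every round spends at least the one for its test, and the
  invariant keeps them nonnegative, so the loop ends.\<close>

lemma wp_While:
  assumes "I s n"
    and body: "\<And>s' n'. I s' n' \<Longrightarrow> unchanged p s s' \<Longrightarrow> bval b s' \<Longrightarrow> wp p I s' (n' - 1)"
    and exit: "\<And>s' n'. I s' n' \<Longrightarrow> unchanged p s s' \<Longrightarrow> \<not> bval b s' \<Longrightarrow> Q s' (n' - 1)"
    and nonneg: "\<And>s' n'. I s' n' \<Longrightarrow> 0 \<le> n'"
  shows "wp (While b p) Q s n"
proof -
  have "wp (While b p) Q s' n'" if "I s' n'" "unchanged p s s'" for s' n'
    using that
  proof (induction "nat n'" arbitrary: s' n' rule: less_induct)
    case less
    show ?case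
    proof (cases "bval b s'")
      case True
      then obtain t s1 where p: "exec p s' t s1" "I s1 (n' - 1 - int t)"
        using body less.prems unfolding wp_def by blast
      then have "wp (While b p) Q s1 (n' - 1 - int t)"
        using nonneg[OF p(2)] nonneg[OF less.prems(1)] less.prems(2)
        by (intro less.hyps) (auto intro: exec_unchanged unchanged_trans)
      then obtain t' s2 where "exec (While b p) s1 t' s2" "Q s2 (n' - 1 - int t - int t')"
        unfolding wp_def by blast
      then have "exec (While b p) s' (t + t' + 1) s2" "Q s2 (n' - int (t + t' + 1))"
        using WhileTrue[OF True p(1)] by (auto simp: algebra_simps)
      then show ?thesis unfolding wp_def by blast
    next
      case False
      then have "exec (While b p) s' 1 s'" by (rule WhileFalse)
      moreover have "Q s' (n' - 1)" using exit less.prems False by blast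
      ultimately show ?thesis unfolding wp_def by (metis of_nat_1)
    qed
  qed
  then show ?thesis using assms(1) by simp
qed

lemma wp_While_False: "\<not> bval b s \<Longrightarrow> Q s (n - 1) \<Longrightarrow> wp (While b p) Q s n"
  unfolding wp_def using WhileFalse by (metis of_nat_1)

abbreviation V :: "string \<Rightarrow> nexp" where
  "V x \<equiv> Get x (Lit 0)"

abbreviation Assign :: "string \<Rightarrow> nexp \<Rightarrow> com" (infix "::=" 61) where
  "x ::= e \<equiv> Put x (Lit 0) e"

notation Seq (infixr ";;" 60)

definition For :: "string \<Rightarrow> nexp \<Rightarrow> nexp \<Rightarrow> com \<Rightarrow> com" where
  "For i lo hi c = (i ::= lo;; While (Less (V i) hi) (c;; i ::= Inc (V i)))"

lemma writes_For [simp]: "writes (For i lo hi c) = insert i (writes c)"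
  and rwrites_For [simp]: "rwrites (For i lo hi c) = rwrites c"
  by (auto simp: For_def)

text \<open>Round \<open>k\<close> costs \<open>w k\<close> plus 2 for the increment and the test;
  the other 2 pay for the initialisation and the last test. The body has to establish the invariant
  for the state with the counter advanced.\<close>

lemma runs_For:
  assumes init: "nval lo s = M" "M \<le> N" "I M (put i 0 M s)"
    and hi: "\<And>s'. unchanged (For i lo hi c) s s' \<Longrightarrow> nval hi s' = N"
    and i: "i \<notin> writes c"
    and step: "\<And>k s'. M \<le> k \<Longrightarrow> k < N \<Longrightarrow> I k s' \<Longrightarrow> nats s' i 0 = k \<Longrightarrow>
      unchanged (For i lo hi c) s s' \<Longrightarrow>
      runs c s' (w k) (\<lambda>s''. I (Suc k) (put i 0 (Suc k) s''))"
    and w: "\<And>k. 0 \<le> w k"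
    and K: "2 + (\<Sum>k\<in>{M..<N}. w k + 2) \<le> K"
  shows "runs (For i lo hi c) s K (\<lambda>s'. I N s')"
proof -
  let ?s = "put i 0 M s"
  have unch: "unchanged (For i lo hi c) s s'"
    if "unchanged (c;; i ::= Inc (V i)) ?s s'" for s'
    using that by (auto simp: unchanged_def)
  define J where "J = (\<lambda>s' m. M \<le> nats s' i 0 \<and> nats s' i 0 \<le> N \<and> I (nats s' i 0) s' \<and>
    1 + (\<Sum>k\<in>{nats s' i 0..<N}. w k + 2) \<le> m)"
  have "wp (While (Less (V i) hi) (c;; i ::= Inc (V i))) (\<lambda>s' m. I N s' \<and> 0 \<le> m) ?s (K - 1)"
  proof (rule wp_While[where I = J])
    show "J ?s (K - 1)" using init K by (simp add: J_def)
  next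
    fix s' m assume J: "J s' m" and u: "unchanged (c;; i ::= Inc (V i)) ?s s'"
      and b: "bval (Less (V i) hi) s'"
    define k where "k = nats s' i 0"
    have k: "M \<le> k" "k < N" "I k s'" using J b hi[OF unch[OF u]] by (auto simp: J_def k_def)
    have m: "1 + (w k + 2) + (\<Sum>k\<in>{Suc k..<N}. w k + 2) \<le> m"
      using J k by (simp add: J_def k_def[symmetric] sum.atLeast_Suc_lessThan add.assoc)
    have "runs c s' (w k) (\<lambda>s''. I (Suc k) (put i 0 (Suc k) s''))"
      by (rule step[OF k _ unch[OF u]]) (simp add: k_def)
    then have "runs c s' (w k) (\<lambda>s''. I (Suc k) (put i 0 (Suc k) s'') \<and> unchanged c s' s'')"
      by (rule runs_unchanged)
    then have "wp c (wp (i ::= Inc (V i)) J) s' (m - 1)"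
    proof (rule wp_runs)
      fix s'' m' assume "I (Suc k) (put i 0 (Suc k) s'') \<and> unchanged c s' s''"
        and "m - 1 - w k \<le> m'"
      moreover from this have "nats s'' i 0 = k" using i unchanged_nats[of c s' s'' i] by (simp add: k_def)
      ultimately show "wp (i ::= Inc (V i)) J s'' m'" using k m by (simp add: J_def)
    qed
    then show "wp (c;; i ::= Inc (V i)) J s' (m - 1)" by simp
  next
    fix s' m assume J: "J s' m" and u: "unchanged (c;; i ::= Inc (V i)) ?s s'"
      and b: "\<not> bval (Less (V i) hi) s'"
    then have "nats s' i 0 = N" using hi[OF unch[OF u]] by (auto simp: J_def)
    then show "I N s' \<and> 0 \<le> m - 1" using J by (simp add: J_def)
  next
    fix s' m assume "J s' m"
    moreover have "0 \<le> (\<Sum>k\<in>{nats s' i 0..<N}. w k + 2)"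
      using w by (intro sum_nonneg) (simp add: add_nonneg_nonneg)
    ultimately show "0 \<le> m" by (simp add: J_def)
  qed
  then show ?thesis using init by (simp add: runs_wp For_def)
qed

section \<open>Searching for an augmenting path\<close>

text \<open>In the array \<open>mt\<close>, 0 stands for unmatched and \<open>x + 1\<close> for matched to \<open>x\<close>.\<close>

definition of_code :: "nat \<Rightarrow> nat option" where
  "of_code v = (if v = 0 then None else Some (v - 1))"

lemma of_code_simps [simp]:
  "of_code 0 = None" "of_code (Suc x) = Some x"
  "of_code v = None \<longleftrightarrow> v = 0" "of_code v = Some x \<longleftrightarrow> v = Suc x"
  by (auto simp: of_code_def)

locale graph =
  fixes n :: nat and st tg :: "nat \<Rightarrow> nat"
  assumes st_0: "st 0 = 0" and st_Suc: "a < n \<Longrightarrow> st a \<le> st (Suc a)"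
begin

definition A :: "nat set" where
  "A = {a. a < n \<and> st a < st (Suc a)}"

text \<open>The working arrays of the search are described on \<open>T\<close> only, since cells of
  items without edges are never reset.\<close>

definition T :: "nat set" where
  "T = tg ` {..<st n}"

definition nb :: "(nat \<Rightarrow> nat) \<Rightarrow> nat \<Rightarrow> nat set" where
  "nb act a = {tg e |e. st a \<le> e \<and> e < st (Suc a) \<and> 0 < act e}"

definition valid :: "(nat \<Rightarrow> nat) \<Rightarrow> bool" where
  "valid mt \<longleftrightarrow> (\<forall>a<n. 0 < mt a \<longrightarrow> a \<in> A \<and> mt a - 1 \<in> T)"

lemma st_mono: "a \<le> b \<Longrightarrow> b \<le> n \<Longrightarrow> st a \<le> st b"
proof (induction b rule: dec_induct)
  case (step b)
  then show ?case using st_Suc[of b] by simp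
qed simp

lemma edge_T: "a < n \<Longrightarrow> e < st (Suc a) \<Longrightarrow> tg e \<in> T"
  using st_mono[of "Suc a" n] by (auto simp: T_def)

lemma nb_T: "a < n \<Longrightarrow> nb act a \<subseteq> T"
  using edge_T by (auto simp: nb_def)

lemma nb_A: "a < n \<Longrightarrow> x \<in> nb act a \<Longrightarrow> a \<in> A"
  by (auto simp: nb_def A_def)

lemma finite_A: "finite A" and finite_T: "finite T"
  by (auto simp: A_def T_def)

lemma A_less: "a \<in> A \<Longrightarrow> a < n"
  by (simp add: A_def)

text \<open>The people assigned to \<open>x\<close> are linked in decreasing order, with entries shifted by 1:
  the list starting at \<open>p\<close> contains exactly the people \<open>a < p\<close> assigned to \<open>x\<close>.\<close>

definition linked :: "nat \<Rightarrow> (nat \<Rightarrow> nat) \<Rightarrow> (nat \<Rightarrow> nat) \<Rightarrow> (nat \<Rightarrow> nat) \<Rightarrow> (nat \<Rightarrow> nat) \<Rightarrow> bool" where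
  "linked k mt ld hp nx \<longleftrightarrow>
     (\<forall>x\<in>T. ld x = card {a. a < k \<and> mt a = Suc x} \<and> hp x \<le> k \<and>
        (0 < hp x \<longrightarrow> mt (hp x - 1) = Suc x) \<and> (\<forall>a. hp x \<le> a \<and> a < k \<longrightarrow> mt a \<noteq> Suc x)) \<and>
     (\<forall>a<k. 0 < mt a \<longrightarrow> nx a \<le> a \<and> (0 < nx a \<longrightarrow> mt (nx a - 1) = mt a) \<and>
        (\<forall>b. nx a \<le> b \<and> b < a \<longrightarrow> mt b \<noteq> mt a))"

lemma linked_skip:
  assumes "linked k mt ld hp nx" "mt k = 0"
  shows "linked (Suc k) mt ld hp nx"
proof -
  have "{a. a < Suc k \<and> mt a = Suc x} = {a. a < k \<and> mt a = Suc x}" for x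
    using assms(2) by (auto simp: less_Suc_eq)
  then show ?thesis using assms by (auto simp: linked_def less_Suc_eq)
qed

lemma linked_insert:
  assumes l: "linked k mt ld hp nx" and x: "mt k = Suc x" "x \<in> T"
  shows "linked (Suc k) mt (ld(x := Suc (ld x))) (hp(x := Suc k)) (nx(k := hp x))"
proof -
  have "{a. a < Suc k \<and> mt a = Suc x} = insert k {a. a < k \<and> mt a = Suc x}"
    using x by (auto simp: less_Suc_eq)
  then have *: "card {a. a < Suc k \<and> mt a = Suc x} = Suc (card {a. a < k \<and> mt a = Suc x})"
    by simp
  have "{a. a < Suc k \<and> mt a = Suc y} = {a. a < k \<and> mt a = Suc y}" if "y \<noteq> x" for y
    using x that by (auto simp: less_Suc_eq)
  then show ?thesis using l x * unfolding linked_def by (auto simp: less_Suc_eq)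
qed

lemma linked_load:
  assumes "linked n mt ld hp nx" "valid mt" "x \<in> T"
  shows "ld x = load A (of_code \<circ> mt) x"
proof -
  have "{a. a < n \<and> mt a = Suc x} = {a \<in> A. (of_code \<circ> mt) a = Some x}"
    using assms(2) by (auto simp: valid_def A_def)
  then show ?thesis using assms by (simp add: linked_def load_def)
qed

end

text \<open>Lexicographic comparison of flag and price. Equality of flags is expressed by failing
  comparisons, which is all that the tests of the machine offer.\<close>

definition cheaper :: "(nat \<Rightarrow> nat) \<Rightarrow> (nat \<Rightarrow> real) \<Rightarrow> nat \<Rightarrow> nat \<Rightarrow> bool" where
  "cheaper fl ck x y \<longleftrightarrow> fl x < fl y \<or> \<not> fl y < fl x \<and> ck x < ck y"

lemma not_cheaper_trans: "\<not> cheaper fl ck y t \<Longrightarrow> cheaper fl ck x t \<Longrightarrow> \<not> cheaper fl ck y x"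
  by (auto simp: cheaper_def)

lemma not_cheaper_refl: "\<not> cheaper fl ck x x"
  by (auto simp: cheaper_def)

locale search = graph +
  fixes act mt ld hp nx :: "nat \<Rightarrow> nat" and u :: nat
  assumes valid: "valid mt" and linked: "linked n mt ld hp nx" and u_A: "u \<in> A"
begin

lemma u: "u < n"
  using u_A by (rule A_less)

text \<open>Items beyond position \<open>qh\<close> of the queue wait with all their people; of the
  item being expanded, which has number \<open>qh\<close>, the people below \<open>p\<close> are
  left in its decreasing list.\<close>

definition pending :: "(nat \<Rightarrow> nat) \<Rightarrow> nat \<Rightarrow> nat \<Rightarrow> nat \<Rightarrow> bool" where
  "pending vis qh p a \<longleftrightarrow> 0 < mt a \<and>
     (qh < vis (mt a - 1) \<or> vis (mt a - 1) = qh \<and> a < p)"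

definition scanned :: "(nat \<Rightarrow> nat) \<Rightarrow> nat \<Rightarrow> nat \<Rightarrow> nat \<Rightarrow> bool" where
  "scanned vis cur e a \<longleftrightarrow>
     (\<forall>e'. st a \<le> e' \<and> e' < st (Suc a) \<and> 0 < act e' \<longrightarrow> 0 < vis (tg e') \<or> a = cur \<and> e \<le> e')"

definition reached :: "(nat \<Rightarrow> nat) \<Rightarrow> nat \<Rightarrow> bool" where
  "reached vis a \<longleftrightarrow> a = u \<or> 0 < mt a \<and> 0 < vis (mt a - 1)"

text \<open>\<open>q\<close> inverts \<open>vis\<close>, and \<open>par\<close> records the person
  through whom an item was found. Numbers decrease along parents: this grounds the induction in
  \<open>found_least\<close>, makes \<open>flip_path\<close> terminate and keeps its path
  simple.\<close>

definition found :: "(nat \<Rightarrow> nat) \<Rightarrow> (nat \<Rightarrow> nat) \<Rightarrow> (nat \<Rightarrow> nat) \<Rightarrow> nat \<Rightarrow> bool" where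
  "found vis par q qt \<longleftrightarrow>
     (\<forall>i<qt. q i \<in> T \<and> vis (q i) = Suc i) \<and>
     (\<forall>x\<in>T. 0 < vis x \<longrightarrow> vis x \<le> qt \<and> q (vis x - 1) = x \<and> par x < n \<and> x \<in> nb act (par x) \<and>
        (par x = u \<or> 0 < mt (par x) \<and> 0 < vis (mt (par x) - 1) \<and> vis (mt (par x) - 1) < vis x))"

text \<open>Items are numbered from 1 in the order of discovery (\<open>vis\<close>); the items in the queue before
  \<open>qh\<close> have been expanded, the last of these up to its list of people \<open>p\<close>, and the current
  person \<open>cur\<close> has been scanned up to edge \<open>e\<close>.\<close>

definition invar :: "(nat \<Rightarrow> nat) \<Rightarrow> (nat \<Rightarrow> nat) \<Rightarrow> (nat \<Rightarrow> nat) \<Rightarrow> nat \<Rightarrow> nat \<Rightarrow> nat \<Rightarrow> nat \<Rightarrow> nat \<Rightarrow> bool"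
  where
  "invar vis par q qt qh p cur e \<longleftrightarrow> found vis par q qt \<and> qh \<le> qt \<and>
     cur < n \<and> st cur \<le> e \<and> e \<le> st (Suc cur) \<and> reached vis cur \<and>
     p \<le> n \<and> (0 < p \<longrightarrow> 0 < qh \<and> mt (p - 1) = Suc (q (qh - 1))) \<and>
     (\<forall>a<n. reached vis a \<longrightarrow> pending vis qh p a \<or> scanned vis cur e a)"

lemma mt_T: "a < n \<Longrightarrow> 0 < mt a \<Longrightarrow> mt a - 1 \<in> T"
  using valid by (simp add: valid_def)

lemma invar_init: "\<forall>x\<in>T. vis x = 0 \<Longrightarrow> invar vis par q 0 0 0 u (st u)"
  using u st_Suc mt_T by (auto simp: invar_def found_def reached_def scanned_def dest!: mt_T)

lemma found_visit:
  assumes f: "found vis par q qt" and cur: "cur < n" "reached vis cur"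
    and x: "x \<in> nb act cur" "vis x = 0"
  shows "found (vis(x := Suc qt)) (par(x := cur)) (q(qt := x)) (Suc qt)"
proof -
  have xT: "x \<in> T" using x nb_T cur by blast
  have q: "q i \<in> T" "vis (q i) = Suc i" "q i \<noteq> x" if "i < qt" for i
    using f that x by (auto simp: found_def)
  have le: "vis y \<le> qt" if "y \<in> T" for y using f that by (cases "vis y") (auto simp: found_def)
  show ?thesis
    unfolding found_def
  proof (intro conjI allI impI ballI)
    fix i assume "i < Suc qt"
    then show "(q(qt := x)) i \<in> T" "(vis(x := Suc qt)) ((q(qt := x)) i) = Suc i"
      using q xT by (auto simp: less_Suc_eq)
  next
    fix y assume y: "y \<in> T" "0 < (vis(x := Suc qt)) y"
    show "(vis(x := Suc qt)) y \<le> Suc qt" using le[OF y(1)] by auto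
    show "(q(qt := x)) ((vis(x := Suc qt)) y - 1) = y"
    proof (cases "y = x")
      case False
      then have "0 < vis y" "vis y \<le> qt" "q (vis y - 1) = y" using f y by (auto simp: found_def)
      moreover from this have "vis y - 1 \<noteq> qt" by linarith
      ultimately show ?thesis using False by simp
    qed simp
    show "(par(x := cur)) y < n" "y \<in> nb act ((par(x := cur)) y)"
      using f x y cur by (auto simp: found_def)
    show "(par(x := cur)) y = u \<or> 0 < mt ((par(x := cur)) y) \<and>
        0 < (vis(x := Suc qt)) (mt ((par(x := cur)) y) - 1) \<and>
        (vis(x := Suc qt)) (mt ((par(x := cur)) y) - 1) < (vis(x := Suc qt)) y"
    proof (cases "y = x")
      case True
      then show ?thesis using cur x le[OF mt_T[OF cur(1)]] by (auto simp: reached_def)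
    next
      case False
      then have "par y = u \<or> 0 < mt (par y) \<and> 0 < vis (mt (par y) - 1) \<and> vis (mt (par y) - 1) < vis y"
        using f y by (auto simp: found_def)
      then show ?thesis using False x by auto
    qed
  qed
qed

lemma invar_visit:
  assumes i: "invar vis par q qt qh p cur e" and e: "e < st (Suc cur)" "0 < act e" "vis (tg e) = 0"
  shows "invar (vis(tg e := Suc qt)) (par(tg e := cur)) (q(qt := tg e)) (Suc qt) qh p cur (Suc e)"
proof -
  let ?x = "tg e" let ?vis = "vis(tg e := Suc qt)"
  have "?x \<in> nb act cur" using i e by (auto simp: invar_def nb_def)
  then have f: "found ?vis (par(?x := cur)) (q(qt := ?x)) (Suc qt)"
    using i e by (intro found_visit) (auto simp: invar_def)
  have mono: "pending ?vis qh p a" if "pending vis qh p a" for a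
    using that i e by (auto simp: pending_def invar_def)
  have new: "pending ?vis qh p a" if "0 < mt a" "mt a - 1 = ?x" for a
    using that i by (auto simp: pending_def invar_def)
  have "pending ?vis qh p a \<or> scanned ?vis cur (Suc e) a" if a: "a < n" "reached ?vis a" for a
  proof (cases "0 < mt a \<and> mt a - 1 = ?x")
    case True
    then show ?thesis using new by blast
  next
    case False
    then have "reached vis a" using a by (auto simp: reached_def split: if_splits)
    then have "pending vis qh p a \<or> scanned vis cur e a" using i a(1) by (auto simp: invar_def)
    then show ?thesis
    proof
      assume *: "scanned vis cur e a"
      have "0 < ?vis (tg e') \<or> a = cur \<and> Suc e \<le> e'"
        if "st a \<le> e' \<and> e' < st (Suc a) \<and> 0 < act e'" for e'
        using * that by (cases "e' = e") (auto simp: scanned_def Suc_le_eq le_less)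
      then show ?thesis by (simp add: scanned_def)
    qed (use mono in blast)
  qed
  moreover have "0 < p \<longrightarrow> 0 < qh \<and> mt (p - 1) = Suc ((q(qt := ?x)) (qh - 1))"
    using i by (auto simp: invar_def)
  moreover have "reached ?vis cur" using i by (auto simp: invar_def reached_def)
  ultimately show ?thesis using i e f by (simp add: invar_def)
qed

lemma invar_skip:
  assumes i: "invar vis par q qt qh p cur e" and e: "e < st (Suc cur)" "act e = 0 \<or> 0 < vis (tg e)"
  shows "invar vis par q qt qh p cur (Suc e)"
proof -
  have "0 < vis (tg e') \<or> a = cur \<and> Suc e \<le> e'"
    if "0 < act e'" "0 < vis (tg e') \<or> a = cur \<and> e \<le> e'" for a e'
    using that e by (cases "e' = e") (auto simp: Suc_le_eq le_less)
  then have "scanned vis cur e a \<Longrightarrow> scanned vis cur (Suc e) a" for a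
    unfolding scanned_def by blast
  then show ?thesis using i e by (auto simp: invar_def)
qed

text \<open>Only \<open>p - 1\<close> stops being pending, because those between
  \<open>nx (p - 1)\<close> and \<open>p - 1\<close> are assigned to other items. She becomes the
  current person, and the former one has been scanned completely.\<close>

lemma invar_next_person:
  assumes i: "invar vis par q qt qh p cur e" and e: "\<not> e < st (Suc cur)" and p: "0 < p"
  shows "invar vis par q qt qh (nx (p - 1)) (p - 1) (st (p - 1))"
proof -
  let ?c = "p - 1"
  have c: "?c < n" "0 < qh" "qh \<le> qt" "mt ?c = Suc (q (qh - 1))" using i p by (auto simp: invar_def)
  have f: "found vis par q qt" using i by (simp add: invar_def)
  have vis: "vis (mt ?c - 1) = qh" using f c by (auto simp: found_def)
  have nx: "nx ?c \<le> ?c" "0 < nx ?c \<longrightarrow> mt (nx ?c - 1) = mt ?c"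
    "\<And>b. nx ?c \<le> b \<Longrightarrow> b < ?c \<Longrightarrow> mt b \<noteq> mt ?c"
    using linked c(1,4) by (auto simp: linked_def)
  have step: "pending vis qh (nx ?c) a \<or> a = ?c" if a: "a < n" "pending vis qh p a" for a
  proof -
    consider "qh < vis (mt a - 1)" | "vis (mt a - 1) = qh" "a < p" "0 < mt a"
      using a by (auto simp: pending_def)
    then show ?thesis
    proof cases
      case 2
      then have "q (qh - 1) = mt a - 1" using f mt_T[OF a(1)] c(2) by (auto simp: found_def)
      then have "mt a = mt ?c" using c(4) 2 by simp
      then show ?thesis using 2 nx(3)[of a] by (force simp: pending_def)
    qed (use a in \<open>auto simp: pending_def\<close>)
  qed
  have "scanned vis cur e a \<Longrightarrow> scanned vis ?c (st ?c) a" for a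
    using e by (fastforce simp: scanned_def)
  moreover have "scanned vis ?c (st ?c) ?c" by (simp add: scanned_def)
  ultimately have "pending vis qh (nx ?c) a \<or> scanned vis ?c (st ?c) a"
    if "a < n" "reached vis a" for a
    using i that step[OF that(1)] unfolding invar_def by blast
  moreover have "reached vis ?c" using c vis by (simp add: reached_def)
  ultimately show ?thesis using c nx vis f st_Suc[OF c(1)] by (simp add: invar_def)
qed

lemma invar_next_item:
  assumes i: "invar vis par q qt qh p cur e" and "\<not> e < st (Suc cur)" "p = 0" "qh < qt"
  shows "invar vis par q qt (Suc qh) (hp (q qh)) cur e"
proof -
  have f: "found vis par q qt" using i by (simp add: invar_def)
  have q: "q qh \<in> T" "vis (q qh) = Suc qh" using f assms(4) by (auto simp: found_def)
  have hp: "hp (q qh) \<le> n" "0 < hp (q qh) \<longrightarrow> mt (hp (q qh) - 1) = Suc (q qh)"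
    "\<And>a. hp (q qh) \<le> a \<Longrightarrow> a < n \<Longrightarrow> mt a \<noteq> Suc (q qh)"
    using linked q(1) by (auto simp: linked_def)
  have "pending vis (Suc qh) (hp (q qh)) a" if a: "a < n" "pending vis qh p a" for a
  proof -
    have *: "0 < mt a" "qh < vis (mt a - 1)" using a assms(3) by (auto simp: pending_def)
    show ?thesis
    proof (cases "vis (mt a - 1) = Suc qh")
      case True
      then have "q qh = mt a - 1" using f mt_T[OF a(1) *(1)] by (auto simp: found_def)
      then have "mt a = Suc (q qh)" using * by simp
      then show ?thesis using hp(3)[of a] a True by (force simp: pending_def)
    qed (use * in \<open>auto simp: pending_def\<close>)
  qed
  then show ?thesis using i assms hp by (auto simp: invar_def)
qed

lemma invar_closed:
  assumes i: "invar vis par q qt qh p cur e" and "\<not> e < st (Suc cur)" "p = 0" "\<not> qh < qt"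
    and a: "a < n" "reached vis a"
  shows "nb act a \<subseteq> {x \<in> T. 0 < vis x}"
proof -
  have "\<not> pending vis qh p a"
  proof
    assume "pending vis qh p a"
    then have "0 < mt a" "qh < vis (mt a - 1)" using assms by (auto simp: pending_def)
    moreover have "vis (mt a - 1) \<le> qt"
      using i mt_T[OF a(1)] calculation by (auto simp: invar_def found_def)
    ultimately show False using assms(4) by simp
  qed
  then have "scanned vis cur e a" using i a by (auto simp: invar_def)
  then have "\<forall>e'. st a \<le> e' \<and> e' < st (Suc a) \<and> 0 < act e' \<longrightarrow> 0 < vis (tg e')"
    using assms(2) by (fastforce simp: scanned_def)
  then show ?thesis using nb_T[OF a(1)] by (auto simp: nb_def)
qed

text \<open>By induction on the discovery number. Together with closedness this identifies the
  visited items with the least closed set around the neighbours of \<open>u\<close>.\<close>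

lemma found_least:
  assumes f: "found vis par q qt" and Z: "nb act u \<subseteq> Z" "closed_set A (nb act) (of_code \<circ> mt) Z"
  shows "{x \<in> T. 0 < vis x} \<subseteq> Z"
proof -
  have "x \<in> Z" if "x \<in> T" "0 < vis x" for x
    using that
  proof (induction "vis x" arbitrary: x rule: less_induct)
    case less
    have x: "par x < n" "x \<in> nb act (par x)" and
      "par x = u \<or> 0 < mt (par x) \<and> 0 < vis (mt (par x) - 1) \<and> vis (mt (par x) - 1) < vis x"
      using f less.prems by (auto simp: found_def)
    then consider "par x = u" | "0 < mt (par x)" "mt (par x) - 1 \<in> Z"
      using less.hyps[of "mt (par x) - 1"] mt_T[OF x(1)] by auto
    then show ?case
    proof cases
      case 2
      then have "(of_code \<circ> mt) (par x) \<in> Some ` Z" by (simp add: of_code_def)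
      then show ?thesis using Z(2) x nb_A unfolding closed_set_def by blast
    qed (use x Z in auto)
  qed
  then show ?thesis by blast
qed

lemma queue_bound: "found vis par q qt \<Longrightarrow> qt \<le> st n"
proof -
  assume f: "found vis par q qt"
  have "inj_on q {..<qt}"
    by (rule inj_on_inverseI[where g = "\<lambda>x. vis x - 1"]) (use f in \<open>simp add: found_def\<close>)
  then have "card {..<qt} \<le> card T"
    using f finite_T by (intro card_inj_on_le[of q]) (auto simp: found_def)
  also have "\<dots> \<le> st n" unfolding T_def using card_image_le[of "{..<st n}" tg] by simp
  finally show ?thesis by simp
qed

text \<open>People whose scan may still come; the sum over this set in the potential pays for their
  lists.\<close>

definition todo :: "(nat \<Rightarrow> nat) \<Rightarrow> nat \<Rightarrow> nat \<Rightarrow> nat set" where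
  "todo vis qh p = {a. a < n \<and> 0 < mt a \<and> (vis (mt a - 1) = 0 \<or> pending vis qh p a)}"

lemma finite_todo: "finite (todo vis qh p)"
  by (simp add: todo_def)

lemma todo_visit:
  assumes "invar vis par q qt qh p cur e" "vis x = 0"
  shows "todo (vis(x := Suc qt)) qh p \<subseteq> todo vis qh p"
  using assms by (auto simp: todo_def pending_def invar_def split: if_splits)

lemma todo_next_person:
  assumes i: "invar vis par q qt qh p cur e" and p: "0 < p"
  shows "p - 1 \<in> todo vis qh p" "todo vis qh (nx (p - 1)) \<subseteq> todo vis qh p - {p - 1}"
proof -
  let ?c = "p - 1"
  have c: "?c < n" "0 < qh" "qh \<le> qt" "mt ?c = Suc (q (qh - 1))" using i p by (auto simp: invar_def)
  have f: "found vis par q qt" using i by (simp add: invar_def)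
  have vis: "vis (mt ?c - 1) = qh" using f c by (auto simp: found_def)
  have nx: "nx ?c \<le> ?c" using linked c(1,4) by (auto simp: linked_def)
  show "?c \<in> todo vis qh p" using c vis p by (simp add: todo_def pending_def)
  show "todo vis qh (nx ?c) \<subseteq> todo vis qh p - {?c}"
  proof
    fix a assume a: "a \<in> todo vis qh (nx ?c)"
    then have "pending vis qh p a" if "0 < vis (mt a - 1)"
      using that nx p by (auto simp: todo_def pending_def)
    moreover have "a \<noteq> ?c" using a nx vis c by (auto simp: todo_def pending_def)
    ultimately show "a \<in> todo vis qh p - {?c}" using a by (auto simp: todo_def)
  qed
qed

lemma todo_next_item:
  "p = 0 \<Longrightarrow> todo vis (Suc qh) p' \<subseteq> todo vis qh p"
  by (auto simp: todo_def pending_def)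

end

section \<open>The best item reached and the flipping of the path to it\<close>

context search
begin

definition best_ok ::
  "(nat \<Rightarrow> nat) \<Rightarrow> (nat \<Rightarrow> nat) \<Rightarrow> (nat \<Rightarrow> real) \<Rightarrow> (nat \<Rightarrow> nat) \<Rightarrow> nat \<Rightarrow> bool" where
  "best_ok cap fl ck vis b \<longleftrightarrow>
     (if b = 0 then \<forall>x\<in>T. 0 < vis x \<longrightarrow> cap x \<le> ld x
      else b - 1 \<in> T \<and> 0 < vis (b - 1) \<and> ld (b - 1) < cap (b - 1) \<and>
        (\<forall>x\<in>T. 0 < vis x \<and> ld x < cap x \<longrightarrow> \<not> cheaper fl ck x (b - 1)))"

lemma best_ok_init: "\<forall>x\<in>T. vis x = 0 \<Longrightarrow> best_ok cap fl ck vis 0"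
  by (auto simp: best_ok_def)

lemma best_ok_visit:
  assumes b: "best_ok cap fl ck vis b" and x: "x \<in> T" "vis x = 0"
  shows "best_ok cap fl ck (vis(x := Suc k))
    (if ld x < cap x \<and> (0 < b \<longrightarrow> cheaper fl ck x (b - 1)) then Suc x else b)"
proof (cases "ld x < cap x \<and> (0 < b \<longrightarrow> cheaper fl ck x (b - 1))")
  case True
  have "\<not> cheaper fl ck y x" if "y \<in> T" "0 < vis y" "ld y < cap y" for y
  proof (cases "b = 0")
    case True
    then show ?thesis using b that by (fastforce simp: best_ok_def)
  next
    case False
    then have "\<not> cheaper fl ck y (b - 1)" using b that by (auto simp: best_ok_def)
    then show ?thesis using False True not_cheaper_trans by blast
  qed
  then show ?thesis using True x not_cheaper_refl by (auto simp: best_ok_def)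
next
  case False
  then show ?thesis using b by (cases "b = 0") (auto simp: best_ok_def not_less)
qed

text \<open>While the path is flipped from its end, \<open>x\<close> codes the item that has received an
  additional person; all people moved so far have left items discovered no earlier than \<open>x\<close>.\<close>

definition flipping :: "(nat \<Rightarrow> nat) \<Rightarrow> nat \<Rightarrow> (nat \<Rightarrow> nat) \<Rightarrow> nat \<Rightarrow> bool" where
  "flipping vis b mt' x \<longleftrightarrow>
     (\<forall>z. load A (of_code \<circ> mt') z + of_bool (x = Suc z) =
        load A (of_code \<circ> mt) z + of_bool (b = Suc z)) \<and>
     (\<forall>a<n. mt' a \<noteq> mt a \<longrightarrow> 0 < mt' a \<and> mt' a - 1 \<in> nb act a \<and>
        (0 < mt a \<and> (0 < x \<longrightarrow> vis (x - 1) \<le> vis (mt a - 1)) \<or> x = 0 \<and> a = u)) \<and>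
     (0 < x \<longrightarrow> x - 1 \<in> T \<and> 0 < vis (x - 1)) \<and> (x = 0 \<longrightarrow> 0 < mt' u)"

lemma flipping_init:
  "0 < b \<Longrightarrow> best_ok cap fl ck vis b \<Longrightarrow> flipping vis b mt b"
  by (auto simp: flipping_def best_ok_def)

text \<open>The parent \<open>c\<close> of the current item has not been moved yet: the people moved
  so far left items discovered no earlier than \<open>x - 1\<close>, whereas \<open>c\<close> is
  \<open>u\<close> or her item was discovered strictly earlier. So \<open>mt' c\<close> is still her
  old entry, which is the next one on the path, or 0 at \<open>u\<close>.\<close>

lemma flipping_step:
  assumes f: "found vis par q qt" and i: "flipping vis b mt' x" and x: "0 < x" and mtu: "mt u = 0"
  defines "c \<equiv> par (x - 1)"
  shows "flipping vis b (mt'(c := x)) (mt' c)" "0 < mt' c \<Longrightarrow> vis (mt' c - 1) < vis (x - 1)"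
proof -
  have xT: "x - 1 \<in> T" "0 < vis (x - 1)" using i x by (auto simp: flipping_def)
  then have c: "c < n" "x - 1 \<in> nb act c"
    and c': "c = u \<or> 0 < mt c \<and> 0 < vis (mt c - 1) \<and> vis (mt c - 1) < vis (x - 1)"
    using f by (auto simp: found_def c_def)
  have same: "mt' c = mt c"
  proof (rule ccontr)
    assume "mt' c \<noteq> mt c"
    then have "0 < mt c" "vis (x - 1) \<le> vis (mt c - 1)" using i c(1) x by (auto simp: flipping_def)
    then show False using c' mtu by auto
  qed
  show "0 < mt' c \<Longrightarrow> vis (mt' c - 1) < vis (x - 1)" using c' same mtu by auto
  have cA: "c \<in> A" using nb_A[OF c] .
  have load: "load A (of_code \<circ> mt'(c := x)) z + of_bool (mt' c = Suc z) =
      load A (of_code \<circ> mt) z + of_bool (b = Suc z)" for z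
  proof -
    have "load A ((of_code \<circ> mt')(c := of_code x)) z + of_bool ((of_code \<circ> mt') c = Some z)
        = load A (of_code \<circ> mt') z + of_bool (of_code x = Some z)"
      by (rule load_update[OF finite_A cA])
    moreover have "load A (of_code \<circ> mt') z + of_bool (x = Suc z) =
        load A (of_code \<circ> mt) z + of_bool (b = Suc z)"
      using i by (simp add: flipping_def)
    ultimately show ?thesis by (simp add: fun_upd_comp)
  qed
  show "flipping vis b (mt'(c := x)) (mt' c)"
    unfolding flipping_def
  proof (intro conjI allI impI)
    fix a assume a: "a < n" "(mt'(c := x)) a \<noteq> mt a"
    show "0 < (mt'(c := x)) a" "(mt'(c := x)) a - 1 \<in> nb act a"
      using a i c x by (auto simp: flipping_def)
    show "0 < mt a \<and> (0 < mt' c \<longrightarrow> vis (mt' c - 1) \<le> vis (mt a - 1)) \<or> mt' c = 0 \<and> a = u"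
    proof (cases "a = c")
      case True
      then show ?thesis using c' same mtu by auto
    next
      case False
      then have "0 < mt a" "vis (x - 1) \<le> vis (mt a - 1)" using a i x by (auto simp: flipping_def)
      then show ?thesis using c' same mtu by auto
    qed
  next
    show "0 < mt' c \<Longrightarrow> mt' c - 1 \<in> T" using same mt_T[OF c(1)] by simp
    show "0 < mt' c \<Longrightarrow> 0 < vis (mt' c - 1)" using same c' mtu by auto
    show "mt' c = 0 \<Longrightarrow> 0 < (mt'(c := x)) u" using same c' x by auto
  qed (use load in simp)
qed

lemma flipping_augments:
  assumes i: "flipping vis (Suc t) mt' 0" and mtu: "mt u = 0"
    and mt: "\<forall>a<n. 0 < mt a \<longrightarrow> mt a - 1 \<in> nb act a"
  shows "augments A (nb act) (of_code \<circ> mt) u t (of_code \<circ> mt')"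
  unfolding augments_def
proof (intro conjI ballI allI impI)
  show "u \<in> A" "(of_code \<circ> mt) u = None" using u_A mtu by simp_all
next
  fix a assume a: "a \<in> A"
  have "0 < mt' u" using i by (simp add: flipping_def)
  moreover have "0 < mt' a \<and> (0 < mt a \<or> a = u)" if "mt' a \<noteq> mt a"
    using i that A_less[OF a] by (auto simp: flipping_def)
  ultimately show "(of_code \<circ> mt') a = None \<longleftrightarrow> (of_code \<circ> mt) a = None \<and> a \<noteq> u"
    using mtu by (cases "mt' a = mt a") auto
  fix x assume "(of_code \<circ> mt') a = Some x"
  then have *: "mt' a = Suc x" by simp
  show "x \<in> nb act a"
  proof (cases "mt' a = mt a")
    case True
    then have "mt a = Suc x" using * by simp
    then show ?thesis using mt A_less[OF a] by fastforce
  next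
    case False
    then have "mt' a - 1 \<in> nb act a" using i a A_less by (simp add: flipping_def)
    then show ?thesis using * by simp
  qed
next
  fix x
  show "load A (of_code \<circ> mt') x = load A (of_code \<circ> mt) x + of_bool (x = t)"
    using i by (simp add: flipping_def eq_commute[of t])
qed

definition explored :: "(nat \<Rightarrow> nat) \<Rightarrow> bool" where
  "explored vis \<longleftrightarrow> (\<forall>a<n. reached vis a \<longrightarrow> nb act a \<subseteq> {x \<in> T. 0 < vis x})"

lemma explored_closed:
  assumes "explored vis"
  shows "nb act u \<subseteq> {x \<in> T. 0 < vis x}"
    and "closed_set A (nb act) (of_code \<circ> mt) {x \<in> T. 0 < vis x}"
  using assms u unfolding explored_def closed_set_def reached_def by (auto simp: A_def)

end

text \<open>Initial segments of the preorder of flags and prices, closed under ties. The greedy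
  choice of an item serves all of them at once.\<close>

definition downward :: "(nat \<Rightarrow> nat) \<Rightarrow> (nat \<Rightarrow> real) \<Rightarrow> nat set \<Rightarrow> bool" where
  "downward fl ck S \<longleftrightarrow> (\<forall>x y. y \<in> S \<and> \<not> cheaper fl ck y x \<longrightarrow> x \<in> S)"

context graph
begin

text \<open>The people below \<open>k\<close> have been handled. Those left unmatched are kept in
  every certificate, so their failure persists through later augmentations.\<close>

definition progress ::
  "(nat \<Rightarrow> nat) \<Rightarrow> (nat \<Rightarrow> nat) \<Rightarrow> (nat \<Rightarrow> nat) \<Rightarrow> (nat \<Rightarrow> real) \<Rightarrow> nat \<Rightarrow> (nat \<Rightarrow> nat) \<Rightarrow> bool" where
  "progress act cap fl ck k mt \<longleftrightarrow>
     (\<forall>a<n. 0 < mt a \<longrightarrow> a < k \<and> mt a - 1 \<in> nb act a) \<and>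
     (\<forall>x. load A (of_code \<circ> mt) x \<le> cap x) \<and>
     (\<forall>S. downward fl ck S \<longrightarrow>
        (\<exists>Z. certificate A (nb act) cap (of_code \<circ> mt) S {a \<in> A. a < k \<and> mt a = 0} Z))"

lemma progress_partial_matching:
  assumes "progress act cap fl ck k mt"
  shows "partial_matching A (nb act) cap (of_code \<circ> mt)"
  using assms A_less by (fastforce simp: progress_def partial_matching_def)

lemma progress_valid: "progress act cap fl ck k mt \<Longrightarrow> valid mt"
  using nb_T nb_A unfolding progress_def valid_def by blast

lemma progress_init: "\<forall>a<n. mt a = 0 \<Longrightarrow> progress act cap fl ck 0 mt"
proof -
  assume *: "\<forall>a<n. mt a = 0"
  have "load A (of_code \<circ> mt) x = 0" for x
    using * load_pos_iff[OF finite_A, of "of_code \<circ> mt" x] by (auto simp: A_def)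
  moreover have "certificate A (nb act) cap (of_code \<circ> mt) S {} {}" for S
    using * by (auto simp: certificate_def closed_set_def full_on_def A_def)
  ultimately show ?thesis using * by (auto simp: progress_def)
qed

lemma progress_skip:
  assumes "progress act cap fl ck k mt" "k \<notin> A"
  shows "progress act cap fl ck (Suc k) mt"
proof -
  have "{a \<in> A. a < Suc k \<and> mt a = 0} = {a \<in> A. a < k \<and> mt a = 0}"
    using assms by (auto simp: less_Suc_eq)
  then show ?thesis using assms by (auto simp: progress_def)
qed

end

context search
begin

lemma progress_augment:
  assumes p: "progress act cap fl ck u mt" and f: "found vis par q qt" and e: "explored vis"
    and b: "best_ok cap fl ck vis (Suc t)" and flip: "flipping vis (Suc t) mt' 0"
  shows "progress act cap fl ck (Suc u) mt'"
proof -
  let ?R = "{x \<in> T. 0 < vis x}" let ?M = "of_code \<circ> mt" let ?M' = "of_code \<circ> mt'"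
  have mtu: "mt u = 0" using p u by (auto simp: progress_def)
  have nbs: "\<forall>a<n. 0 < mt a \<longrightarrow> mt a - 1 \<in> nb act a" using p by (auto simp: progress_def)
  note aug = flipping_augments[OF flip mtu nbs]
  have t: "t \<in> ?R" "ld t < cap t" using b by (auto simp: best_ok_def)
  then have free: "load A ?M t < cap t" using linked_load[OF linked valid] by simp
  have "partial_matching A (nb act) cap ?M'"
    by (rule partial_matching_augments[OF progress_partial_matching[OF p] aug free])
  moreover have "\<exists>Z. certificate A (nb act) cap ?M' S {a \<in> A. a < Suc u \<and> mt' a = 0} Z"
    if S: "downward fl ck S" for S
  proof -
    obtain Z where Z: "certificate A (nb act) cap ?M S {a \<in> A. a < u \<and> mt a = 0} Z"
      using p S by (auto simp: progress_def)
    \<comment> \<open>A free reachable item of \<open>S\<close> would not be cheaper than the chosen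
      \<open>t\<close>, and this would put \<open>t\<close> into the initial segment
      \<open>S\<close>.\<close>
    have "full_on A cap ?M (?R \<inter> S)" if "t \<notin> S"
      unfolding full_on_def
    proof
      fix x assume x: "x \<in> ?R \<inter> S"
      then have "\<not> (ld x < cap x)" using b S that by (auto simp: best_ok_def downward_def)
      then show "cap x \<le> load A ?M x" using x linked_load[OF linked valid] by simp
    qed
    note full = this
    have ex: "\<exists>Z. certificate A (nb act) cap ?M' S {a \<in> A. a < u \<and> mt a = 0} Z"
      by (rule certificate_augments[OF finite_A _ aug Z explored_closed[OF e] t(1) free full])
        (simp_all add: finite_T)
    have "mt' a = 0 \<longleftrightarrow> mt a = 0 \<and> a \<noteq> u" if "a \<in> A" for a
      using aug that by (auto simp: augments_def)
    then have "{a \<in> A. a < Suc u \<and> mt' a = 0} = {a \<in> A. a < u \<and> mt a = 0}"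
      by (auto simp: less_Suc_eq)
    then show ?thesis using ex by simp
  qed
  moreover have "a < Suc u \<and> mt' a - 1 \<in> nb act a" if a: "a < n" "0 < mt' a" for a
  proof -
    have "0 < mt b \<Longrightarrow> b < u \<and> mt b - 1 \<in> nb act b" if "b < n" for b
      using p that by (simp add: progress_def)
    moreover have "mt' a \<noteq> mt a \<Longrightarrow> mt' a - 1 \<in> nb act a \<and> (0 < mt a \<or> a = u)"
      using flip a by (auto simp: flipping_def)
    ultimately show ?thesis using a by (metis less_Suc_eq)
  qed
  ultimately show ?thesis by (auto simp: progress_def partial_matching_def)
qed

lemma progress_fail:
  assumes p: "progress act cap fl ck u mt" and f: "found vis par q qt" and e: "explored vis"
    and b: "best_ok cap fl ck vis 0"
  shows "progress act cap fl ck (Suc u) mt"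
proof -
  let ?R = "{x \<in> T. 0 < vis x}" let ?M = "of_code \<circ> mt"
  have mtu: "mt u = 0" using p u by (auto simp: progress_def)
  have "full_on A cap ?M ?R"
    using b linked_load[OF linked valid] by (auto simp: best_ok_def full_on_def)
  then have "\<exists>Z. certificate A (nb act) cap ?M S (insert u {a \<in> A. a < u \<and> mt a = 0}) Z"
    if "downward fl ck S" for S
    using p that finite_T certificate_fail[OF _ _ explored_closed[OF e]]
    by (fastforce simp: progress_def)
  moreover have "{a \<in> A. a < Suc u \<and> mt a = 0} = insert u {a \<in> A. a < u \<and> mt a = 0}"
    using u_A mtu by (auto simp: less_Suc_eq)
  ultimately show ?thesis using p by (auto simp: progress_def)
qed

end

section \<open>The search program\<close>

text \<open>The edges of person \<open>a\<close> have the indices \<open>st[a], \<dots>, st[a + 1] - 1\<close>; edge \<open>e\<close> leads to item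
  \<open>tg[e]\<close> of rank \<open>rk[e]\<close> and may be used if \<open>act[e] > 0\<close>. Item \<open>x\<close> has capacity \<open>cp[x]\<close>, price
  \<open>ck[x]\<close>, load \<open>ld[x]\<close> and list of people \<open>hp[x]\<close>; items with \<open>fl[x] = 0\<close> take precedence over
  all prices, and \<open>ev[x]\<close> marks the items found to be alive (see below). The search starts at
  person \<open>a[0]\<close> and leaves the best item, shifted by 1, in \<open>b[0]\<close>, or 0 if there is none.\<close>

definition reset_search :: com where
  "reset_search =
    (For ''e'' (Lit 0) (Get ''st'' (V ''people''))
      (Put ''vis'' (Get ''tg'' (V ''e'')) (Lit 0);;
       Put ''ld'' (Get ''tg'' (V ''e'')) (Lit 0);;
       Put ''hp'' (Get ''tg'' (V ''e'')) (Lit 0));;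
     For ''p'' (Lit 0) (V ''people'')
      (If (Less (Lit 0) (Get ''mt'' (V ''p'')))
        (''x'' ::= Dec (Get ''mt'' (V ''p''));;
         Put ''ld'' (V ''x'') (Inc (Get ''ld'' (V ''x'')));;
         Put ''nx'' (V ''p'') (Get ''hp'' (V ''x''));;
         Put ''hp'' (V ''x'') (Inc (V ''p'')))
        Skip))"

definition cheaper_exp :: "nexp \<Rightarrow> nexp \<Rightarrow> bexp" where
  "cheaper_exp x y =
    Not (And (Not (Less (Get ''fl'' x) (Get ''fl'' y)))
      (Not (And (Not (Less (Get ''fl'' y) (Get ''fl'' x))) (RLess (RGet ''ck'' x) (RGet ''ck'' y)))))"

lemma bval_cheaper_exp [simp]:
  "bval (cheaper_exp x y) s \<longleftrightarrow> cheaper (nats s ''fl'') (reals s ''ck'') (nval x s) (nval y s)"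
  by (auto simp: cheaper_exp_def cheaper_def)

definition scan_edge :: com where
  "scan_edge =
    (''x'' ::= Get ''tg'' (V ''e'');;
     If (And (Less (Lit 0) (Get ''act'' (V ''e''))) (Not (Less (Lit 0) (Get ''vis'' (V ''x'')))))
       (Put ''q'' (V ''t'') (V ''x'');;
        ''t'' ::= Inc (V ''t'');;
        Put ''vis'' (V ''x'') (V ''t'');;
        Put ''par'' (V ''x'') (V ''c'');;
        If (And (Less (Get ''ld'' (V ''x'')) (Get ''cp'' (V ''x'')))
             (Not (And (Less (Lit 0) (V ''b'')) (Not (cheaper_exp (V ''x'') (Dec (V ''b'')))))))
          (''b'' ::= Inc (V ''x'')) Skip)
       Skip;;
     ''e'' ::= Inc (V ''e''))"

definition search_step :: com where
  "search_step =
    If (Less (V ''e'') (Get ''st'' (Inc (V ''c'')))) scan_edge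
      (If (Less (Lit 0) (V ''p''))
        (''c'' ::= Dec (V ''p'');; ''e'' ::= Get ''st'' (V ''c'');; ''p'' ::= Get ''nx'' (V ''c''))
        (''p'' ::= Get ''hp'' (Get ''q'' (V ''h''));; ''h'' ::= Inc (V ''h'')))"

definition run_search :: com where
  "run_search =
    (''c'' ::= V ''a'';; ''e'' ::= Get ''st'' (V ''a'');; ''p'' ::= Lit 0;; ''b'' ::= Lit 0;;
     ''h'' ::= Lit 0;; ''t'' ::= Lit 0;;
     While (Not (And (Not (Less (V ''e'') (Get ''st'' (Inc (V ''c'')))))
         (And (Not (Less (Lit 0) (V ''p''))) (Not (Less (V ''h'') (V ''t''))))))
       search_step)"

definition flip_path :: com where
  "flip_path =
    (''x'' ::= V ''b'';;
     While (Less (Lit 0) (V ''x''))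
       (''c'' ::= Get ''par'' (Dec (V ''x''));; ''y'' ::= Get ''mt'' (V ''c'');;
        Put ''mt'' (V ''c'') (V ''x'');; ''x'' ::= V ''y''))"

context graph
begin

definition env :: "state \<Rightarrow> bool" where
  "env s \<longleftrightarrow> nats s ''people'' 0 = n \<and> nats s ''st'' = st \<and> nats s ''tg'' = tg"

lemma env_unchanged:
  "env s \<Longrightarrow> unchanged c s s' \<Longrightarrow> ''people'' \<notin> writes c \<Longrightarrow> ''st'' \<notin> writes c \<Longrightarrow>
   ''tg'' \<notin> writes c \<Longrightarrow> env s'"
  by (simp add: env_def unchanged_nats)

lemma runs_reset_search:
  assumes s: "env s" and mt: "nats s ''mt'' = mt" "valid mt"
  shows "runs reset_search s (4 + 5 * int (st n) + 7 * int n)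
    (\<lambda>s'. linked n mt (nats s' ''ld'') (nats s' ''hp'') (nats s' ''nx'') \<and> (\<forall>x\<in>T. nats s' ''vis'' x = 0))"
    (is "runs _ _ _ ?Q")
proof -
  let ?c1 = "Put ''vis'' (Get ''tg'' (V ''e'')) (Lit 0);; Put ''ld'' (Get ''tg'' (V ''e'')) (Lit 0);;
    Put ''hp'' (Get ''tg'' (V ''e'')) (Lit 0)"
  let ?I1 = "\<lambda>k s'. \<forall>e<k. nats s' ''vis'' (tg e) = 0 \<and> nats s' ''ld'' (tg e) = 0 \<and> nats s' ''hp'' (tg e) = 0"
  let ?c2 = "If (Less (Lit 0) (Get ''mt'' (V ''p'')))
        (''x'' ::= Dec (Get ''mt'' (V ''p''));; Put ''ld'' (V ''x'') (Inc (Get ''ld'' (V ''x'')));;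
         Put ''nx'' (V ''p'') (Get ''hp'' (V ''x''));; Put ''hp'' (V ''x'') (Inc (V ''p''))) Skip"
  let ?l1 = "For ''e'' (Lit 0) (Get ''st'' (V ''people'')) ?c1"
  let ?I2 = "\<lambda>k s'. linked k mt (nats s' ''ld'') (nats s' ''hp'') (nats s' ''nx'') \<and>
    (\<forall>x\<in>T. nats s' ''vis'' x = 0)"
  have 1: "runs ?l1 s (2 + 5 * int (st n)) (\<lambda>s'. ?I1 (st n) s')"
  proof (rule runs_For[where M = 0 and N = "st n" and I = ?I1 and w = "\<lambda>_. 3"])
    fix s' assume "unchanged ?l1 s s'"
    then show "nval (Get ''st'' (V ''people'')) s' = st n"
      using s env_unchanged[OF s, of ?l1 s'] by (simp add: env_def)
  next
    fix k s' assume "?I1 k s'" "nats s' ''e'' 0 = k" "unchanged ?l1 s s'"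
    moreover have "nats s' ''tg'' = tg"
      using calculation s env_unchanged[OF s, of ?l1 s'] by (simp add: env_def)
    ultimately show "runs ?c1 s' 3 (\<lambda>s''. ?I1 (Suc k) (put ''e'' 0 (Suc k) s''))"
      by (auto simp: runs_wp less_Suc_eq)
  qed auto
  show ?thesis
    unfolding reset_search_def runs_wp wp_Seq
  proof (rule wp_runs[OF runs_unchanged[OF 1]])
    fix s1 m assume s1: "?I1 (st n) s1 \<and> unchanged ?l1 s s1"
      and m: "4 + 5 * int (st n) + 7 * int n - (2 + 5 * int (st n)) \<le> m"
    have env1: "env s1" using s1 env_unchanged[OF s, of ?l1 s1] by simp
    have mt1: "nats s1 ''mt'' = mt" using s1 mt unchanged_nats[of ?l1 s s1 "''mt''"] by simp
    have T1: "\<forall>x\<in>T. nats s1 ''vis'' x = 0 \<and> nats s1 ''ld'' x = 0 \<and> nats s1 ''hp'' x = 0"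
      using s1 by (auto simp: T_def)
    let ?l2 = "For ''p'' (Lit 0) (V ''people'') ?c2"
    have 2: "runs ?l2 s1 (2 + 7 * int n) (\<lambda>s'. ?I2 n s')"
    proof (rule runs_For[where M = 0 and N = n and I = ?I2 and w = "\<lambda>_. 5"])
      fix s' assume "unchanged ?l2 s1 s'"
      then show "nval (V ''people'') s' = n"
        using env_unchanged[OF env1, of ?l2 s'] by (simp add: env_def)
    next
      fix k s' assume k: "k < n" and I: "?I2 k s'" and p: "nats s' ''p'' 0 = k" and u: "unchanged ?l2 s1 s'"
      have mt': "nats s' ''mt'' = mt" using u mt1 unchanged_nats[of ?l2 s1 s' "''mt''"] by simp
      show "runs ?c2 s' 5 (\<lambda>s''. ?I2 (Suc k) (put ''p'' 0 (Suc k) s''))"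
      proof (cases "mt k = 0")
        case True
        then show ?thesis using I p mt' linked_skip by (simp add: runs_wp)
      next
        case False
        then obtain x where x: "mt k = Suc x" "x \<in> T" using mt(2) k by (auto simp: valid_def gr0_conv_Suc)
        then show ?thesis using I p mt' linked_insert[OF conjunct1[OF I] x] by (simp add: runs_wp)
      qed
    qed (use T1 in \<open>auto simp: linked_def\<close>)
    show "wp ?l2 (\<lambda>s' m. ?Q s' \<and> 0 \<le> m) s1 m"
      by (rule wp_runs[OF 2]) (use m in auto)
  qed
qed

end

lemma (in graph) sum_degrees: "(\<Sum>a<n. int (st (Suc a)) - int (st a)) = int (st n)"
  using sum_lessThan_telescope[of "\<lambda>a. int (st a)" n] by (simp add: st_0)

context search
begin

text \<open>The visit of a newly discovered item is paid for by the edge that leads to it.\<close>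

definition pot :: "(nat \<Rightarrow> nat) \<Rightarrow> nat \<Rightarrow> nat \<Rightarrow> nat \<Rightarrow> nat \<Rightarrow> nat \<Rightarrow> int" where
  "pot vis t h p c e = 1 + 30 * (int (st (Suc c)) - int e) + 10 * (int t - int h) +
     (\<Sum>a\<in>todo vis h p. 10 + 30 * (int (st (Suc a)) - int (st a)))"

lemma weight_nonneg: "a \<in> todo vis h p \<Longrightarrow> 0 \<le> 10 + 30 * (int (st (Suc a)) - int (st a))"
  using st_Suc[of a] by (simp add: todo_def)

lemma pot_pos:
  assumes "invar vis par q t h p c e"
  shows "1 \<le> pot vis t h p c e"
proof -
  have "0 \<le> (\<Sum>a\<in>todo vis h p. 10 + 30 * (int (st (Suc a)) - int (st a)))"
    by (rule sum_nonneg) (rule weight_nonneg)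
  then show ?thesis using assms by (simp add: pot_def invar_def)
qed

text \<open>The edge releases 30 credits and the queue entry takes 10; the remaining 20 exceed the
  cost of a round.\<close>

lemma pot_visit:
  assumes "invar vis par q t h p c e" "vis x = 0"
  shows "pot (vis(x := Suc t)) (Suc t) h p c (Suc e) + 20 \<le> pot vis t h p c e"
proof -
  have "(\<Sum>a\<in>todo (vis(x := Suc t)) h p. 10 + 30 * (int (st (Suc a)) - int (st a)))
      \<le> (\<Sum>a\<in>todo vis h p. 10 + 30 * (int (st (Suc a)) - int (st a)))"
    using todo_visit[OF assms] finite_todo weight_nonneg by (intro sum_mono2) auto
  then show ?thesis by (simp add: pot_def)
qed

lemma pot_skip: "pot vis t h p c (Suc e) + 30 = pot vis t h p c e"
  by (simp add: pot_def)

lemma pot_next_person: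
  assumes i: "invar vis par q t h p c e" and "\<not> e < st (Suc c)" "0 < p"
  shows "pot vis t h (nx (p - 1)) (p - 1) (st (p - 1)) + 10 \<le> pot vis t h p c e"
proof -
  let ?w = "\<lambda>a. 10 + 30 * (int (st (Suc a)) - int (st a))"
  have "sum ?w (todo vis h (nx (p - 1))) \<le> sum ?w (todo vis h p - {p - 1})"
    using todo_next_person[OF i assms(3)] finite_todo weight_nonneg by (intro sum_mono2) auto
  also have "\<dots> = sum ?w (todo vis h p) - ?w (p - 1)"
    using todo_next_person(1)[OF i assms(3)] finite_todo by (simp add: sum_diff1)
  finally show ?thesis using i assms(2) by (simp add: pot_def invar_def)
qed

lemma pot_next_item:
  assumes "p = 0"
  shows "pot vis t (Suc h) p' c e + 10 \<le> pot vis t h p c e"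
proof -
  have "(\<Sum>a\<in>todo vis (Suc h) p'. 10 + 30 * (int (st (Suc a)) - int (st a)))
      \<le> (\<Sum>a\<in>todo vis h p. 10 + 30 * (int (st (Suc a)) - int (st a)))"
    using todo_next_item[OF assms] finite_todo weight_nonneg by (intro sum_mono2) auto
  then show ?thesis by (simp add: pot_def)
qed

text \<open>The list of \<open>u\<close> and the lists of all people are bounded separately by
  \<open>30 * st n\<close>: a person \<open>u\<close> who is matched may be scanned once more when
  her own item is expanded.\<close>

lemma pot_init: "pot vis 0 0 0 u (st u) \<le> 1 + 10 * int n + 60 * int (st n)"
proof -
  let ?w = "\<lambda>a. 10 + 30 * (int (st (Suc a)) - int (st a))"
  have "sum ?w (todo vis 0 0) \<le> sum ?w {..<n}"
    using st_Suc by (intro sum_mono2) (auto simp: todo_def)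
  also have "\<dots> = 10 * int n + 30 * (\<Sum>a<n. int (st (Suc a)) - int (st a))"
    by (simp add: sum.distrib sum_distrib_left)
  finally have "sum ?w (todo vis 0 0) \<le> 10 * int n + 30 * int (st n)" by (simp only: sum_degrees)
  moreover have "st (Suc u) \<le> st n" using st_mono[of "Suc u" n] u by simp
  ultimately show ?thesis by (simp add: pot_def)
qed

lemma runs_run_search:
  assumes s: "env s" "nats s ''a'' 0 = u" and arrays: "nats s ''act'' = act" "nats s ''mt'' = mt"
      "nats s ''ld'' = ld" "nats s ''hp'' = hp" "nats s ''nx'' = nx" "nats s ''cp'' = cap"
      "nats s ''fl'' = fl" "reals s ''ck'' = ck"
    and vis: "\<forall>x\<in>T. nats s ''vis'' x = 0"
  shows "runs run_search s (20 + 10 * int n + 60 * int (st n))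
    (\<lambda>s'. found (nats s' ''vis'') (nats s' ''par'') (nats s' ''q'') (nats s' ''t'' 0) \<and>
       explored (nats s' ''vis'') \<and> best_ok cap fl ck (nats s' ''vis'') (nats s' ''b'' 0))"
    (is "runs _ _ _ ?Q")
proof -
  let ?b = "Not (And (Not (Less (V ''e'') (Get ''st'' (Inc (V ''c'')))))
         (And (Not (Less (Lit 0) (V ''p''))) (Not (Less (V ''h'') (V ''t'')))))"
  define I where "I = (\<lambda>(s' :: state) (m :: int).
    invar (nats s' ''vis'') (nats s' ''par'') (nats s' ''q'') (nats s' ''t'' 0) (nats s' ''h'' 0)
      (nats s' ''p'' 0) (nats s' ''c'' 0) (nats s' ''e'' 0) \<and>
    best_ok cap fl ck (nats s' ''vis'') (nats s' ''b'' 0) \<and>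
    pot (nats s' ''vis'') (nats s' ''t'' 0) (nats s' ''h'' 0) (nats s' ''p'' 0) (nats s' ''c'' 0)
      (nats s' ''e'' 0) \<le> m)"
  define s0 where "s0 = put ''t'' 0 0 (put ''h'' 0 0 (put ''b'' 0 0 (put ''p'' 0 0
    (put ''e'' 0 (st u) (put ''c'' 0 u s)))))"
  have writes: "writes search_step = {''x'', ''q'', ''t'', ''vis'', ''par'', ''b'', ''e'', ''c'', ''p'', ''h''}"
    "rwrites search_step = {}"
    by (auto simp: search_step_def scan_edge_def)
  have fixed: "nats s' ''st'' = st" "nats s' ''tg'' = tg" "nats s' ''act'' = act" "nats s' ''mt'' = mt"
      "nats s' ''ld'' = ld" "nats s' ''hp'' = hp" "nats s' ''nx'' = nx" "nats s' ''cp'' = cap"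
      "nats s' ''fl'' = fl" "reals s' ''ck'' = ck" if "unchanged search_step s0 s'" for s'
    using that s arrays unfolding s0_def env_def
    by (simp_all add: unchanged_nats[OF that] unchanged_reals[OF that] writes s0_def)
  have "wp (While ?b search_step) (\<lambda>s' m. ?Q s' \<and> 0 \<le> m) s0 (14 + 10 * int n + 60 * int (st n))"
  proof (rule wp_While[where I = I])
    show "I s0 (14 + 10 * int n + 60 * int (st n))"
      using invar_init best_ok_init vis pot_init[of "nats s ''vis''"] by (simp add: I_def s0_def)
  next
    fix s' m assume I: "I s' m" and un: "unchanged search_step s0 s'" and b: "bval ?b s'"
    define vis' where "vis' = nats s' ''vis''"
    define par' where "par' = nats s' ''par''"
    define q' where "q' = nats s' ''q''"
    define t' where "t' = nats s' ''t'' 0"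
    define h' where "h' = nats s' ''h'' 0"
    define p' where "p' = nats s' ''p'' 0"
    define c' where "c' = nats s' ''c'' 0"
    define e' where "e' = nats s' ''e'' 0"
    define b' where "b' = nats s' ''b'' 0"
    note folds = vis'_def[symmetric] par'_def[symmetric] q'_def[symmetric] t'_def[symmetric]
      h'_def[symmetric] p'_def[symmetric] c'_def[symmetric] e'_def[symmetric] b'_def[symmetric]
    have inv: "invar vis' par' q' t' h' p' c' e'" and best: "best_ok cap fl ck vis' b'"
      and m: "pot vis' t' h' p' c' e' \<le> m"
      using I by (simp_all add: I_def folds)
    note fix' = fixed[OF un]
    consider (visit) "e' < st (Suc c')" "0 < act e'" "vis' (tg e') = 0"
      | (skip) "e' < st (Suc c')" "act e' = 0 \<or> 0 < vis' (tg e')"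
      | (person) "\<not> e' < st (Suc c')" "0 < p'"
      | (item) "\<not> e' < st (Suc c')" "p' = 0" "h' < t'"
      using b by (auto simp: folds fix')
    then show "wp search_step I s' (m - 1)"
    proof cases
      case visit
      have "c' < n" using inv by (simp add: invar_def)
      then have "tg e' \<in> T" using edge_T visit by blast
      then show ?thesis
        using visit m invar_visit[OF inv visit] pot_visit[OF inv visit(3)]
          best_ok_visit[OF best _ visit(3), of t']
        by (auto simp: search_step_def scan_edge_def fix' folds I_def split: if_splits)
    next
      case skip
      then show ?thesis
        using m best invar_skip[OF inv skip] pot_skip[of vis' t' h' p' c' e']
        by (auto simp: search_step_def scan_edge_def fix' folds I_def)
    next
      case person
      then show ?thesis
        using m best invar_next_person[OF inv person] pot_next_person[OF inv person]
        by (simp add: search_step_def fix' folds I_def)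
    next
      case item
      then show ?thesis
        using m best invar_next_item[OF inv item] pot_next_item[OF item(2), of vis' t' h' "hp (q' h')" c' e']
        by (simp add: search_step_def fix' folds I_def)
    qed
  next
    fix s' m assume I: "I s' m" and un: "unchanged search_step s0 s'" and b: "\<not> bval ?b s'"
    note fix' = fixed[OF un]
    have inv: "invar (nats s' ''vis'') (nats s' ''par'') (nats s' ''q'') (nats s' ''t'' 0) (nats s' ''h'' 0)
      (nats s' ''p'' 0) (nats s' ''c'' 0) (nats s' ''e'' 0)" using I by (simp add: I_def)
    have "explored (nats s' ''vis'')"
      using invar_closed[OF inv] b by (simp add: explored_def fix')
    then show "?Q s' \<and> 0 \<le> m - 1"
      using I pot_pos[OF inv] inv by (simp add: I_def) (simp add: invar_def)
  next
    fix s' m assume "I s' m"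
    then show "0 \<le> m" using pot_pos by (fastforce simp: I_def)
  qed
  then show ?thesis
    using s by (simp add: runs_wp run_search_def s0_def env_def add.assoc)
qed

text \<open>The discovery number of the current item drops in every round and is at most
  \<open>st n\<close> at the start; a round takes four assignments and a test.\<close>

lemma runs_flip_path:
  assumes arrays: "nats s ''mt'' = mt" "nats s ''par'' = par" "nats s ''b'' 0 = b"
    and f: "found vis par q t" and b: "best_ok cap fl ck vis b" and mtu: "mt u = 0"
  shows "runs flip_path s (3 + 5 * int (st n))
    (\<lambda>s'. if b = 0 then nats s' ''mt'' = mt else flipping vis b (nats s' ''mt'') 0)"
    (is "runs _ _ _ ?Q")
proof -
  let ?c = "''c'' ::= Get ''par'' (Dec (V ''x''));; ''y'' ::= Get ''mt'' (V ''c'');;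
        Put ''mt'' (V ''c'') (V ''x'');; ''x'' ::= V ''y''"
  let ?s = "put ''x'' 0 b s"
  show ?thesis
  proof (cases "b = 0")
    case True
    have "wp (While (Less (Lit 0) (V ''x'')) ?c) (\<lambda>s' m. ?Q s' \<and> 0 \<le> m) ?s (2 + 5 * int (st n))"
      by (rule wp_While_False) (use True arrays in auto)
    then show ?thesis using arrays by (simp add: runs_wp flip_path_def)
  next
    case False
    define I where "I = (\<lambda>(s' :: state) (m :: int). flipping vis b (nats s' ''mt'') (nats s' ''x'' 0) \<and>
      1 + 5 * int (if nats s' ''x'' 0 = 0 then 0 else vis (nats s' ''x'' 0 - 1)) \<le> m)"
    have "wp (While (Less (Lit 0) (V ''x'')) ?c) (\<lambda>s' m. ?Q s' \<and> 0 \<le> m) ?s (2 + 5 * int (st n))"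
    proof (rule wp_While[where I = I])
      have "vis (b - 1) \<le> t" using f b False by (auto simp: found_def best_ok_def)
      then have "vis (b - 1) \<le> st n" using queue_bound[OF f] by simp
      then show "I ?s (2 + 5 * int (st n))"
        using False flipping_init[OF _ b] arrays by (simp add: I_def)
    next
      fix s' m assume I: "I s' m" and un: "unchanged ?c ?s s'" and x: "bval (Less (Lit 0) (V ''x'')) s'"
      have par: "nats s' ''par'' = par" using unchanged_nats[OF un, of "''par''"] arrays by simp
      define x where "x = nats s' ''x'' 0"
      have x0: "0 < x" using x by (simp add: x_def)
      have fl: "flipping vis b (nats s' ''mt'') x" and m: "1 + 5 * int (vis (x - 1)) \<le> m"
        using I x0 by (simp_all add: I_def x_def[symmetric])
      have "0 < vis (x - 1)" using fl x0 by (simp add: flipping_def)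
      then show "wp ?c I s' (m - 1)"
        using flipping_step[OF f fl x0 mtu] m by (auto simp: I_def par x_def[symmetric])
    next
      fix s' m assume "I s' m" "\<not> bval (Less (Lit 0) (V ''x'')) s'"
      then show "?Q s' \<and> 0 \<le> m - 1" using False by (simp add: I_def)
    next
      fix s' m assume "I s' m"
      then show "0 \<le> m" by (simp add: I_def)
    qed
    then show ?thesis using arrays by (simp add: runs_wp flip_path_def)
  qed
qed

end

section \<open>Correctness of the two phases\<close>

lemma closed_set_cong:
  "(\<And>a. a \<in> A \<Longrightarrow> Nb a = Nb' a) \<Longrightarrow> closed_set A Nb M Z = closed_set A Nb' M Z"
  by (auto simp: closed_set_def)

lemma certificate_cong:
  "(\<And>a. a \<in> A \<Longrightarrow> Nb a = Nb' a) \<Longrightarrow> U \<subseteq> A \<Longrightarrow>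
   certificate A Nb cap M S U Z = certificate A Nb' cap M S U Z"
  unfolding certificate_def using closed_set_cong[of A Nb Nb' M Z] by (auto simp: subset_iff)

lemma downward_UNIV: "downward fl ck UNIV"
  by (simp add: downward_def)

lemma downward_flagged: "downward fl ck {x. fl x = 0}"
  unfolding downward_def cheaper_def by (metis mem_Collect_eq neq0_conv)

text \<open>Flag 0 takes precedence over every price, so all items with flag 0 have to be in the
  segment; the remaining items all have flag 1 and are ordered by price alone.\<close>

lemma downward_price:
  assumes "\<And>x. fl x \<le> 1"
  shows "downward fl ck ({x. fl x = 0} \<union> {x. ck x < k})"
  unfolding downward_def
proof (intro allI impI)
  fix x y assume *: "y \<in> {x. fl x = 0} \<union> {x. ck x < k} \<and> \<not> cheaper fl ck y x"
  have "fl x = 0 \<or> fl x = 1" "fl y = 0 \<or> fl y = 1" using assms[of x] assms[of y] by linarith+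
  then show "x \<in> {x. fl x = 0} \<union> {x. ck x < k}" using * by (auto simp: cheaper_def)
qed

context graph
begin

text \<open>The least closed set around the neighbours of \<open>a\<close>. Unlike the set of
  visited items it does not refer to a run of the program.\<close>

definition reach :: "(nat \<Rightarrow> nat) \<Rightarrow> (nat \<Rightarrow> nat) \<Rightarrow> nat \<Rightarrow> nat set" where
  "reach act mt a = \<Inter> {Z. nb act a \<subseteq> Z \<and> closed_set A (nb act) (of_code \<circ> mt) Z}"

text \<open>An item is alive if some maximum matching leaves spare capacity at it.\<close>

definition alive :: "(nat \<Rightarrow> nat) \<Rightarrow> (nat \<Rightarrow> nat) \<Rightarrow> (nat \<Rightarrow> nat) \<Rightarrow> nat \<Rightarrow> bool" where
  "alive act mt cap x \<longleftrightarrow> (\<exists>a<n. mt a = Suc x \<and>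
     (\<exists>y\<in>reach act mt a. load A (of_code \<circ> mt) y < cap y))"

text \<open>This is the set \<open>D\<close> of the popularity criterion; \<open>full_dead\<close>,
  \<open>closed_dead\<close> and \<open>dead_greatest\<close> characterise it as the largest full
  and closed subset of \<open>T\<close>.\<close>

definition dead :: "(nat \<Rightarrow> nat) \<Rightarrow> (nat \<Rightarrow> nat) \<Rightarrow> (nat \<Rightarrow> nat) \<Rightarrow> nat set" where
  "dead act mt cap = {x \<in> T. cap x \<le> load A (of_code \<circ> mt) x \<and> \<not> alive act mt cap x}"

lemma progress_certificate:
  "progress act cap fl ck k mt \<Longrightarrow> downward fl ck S \<Longrightarrow>
   \<exists>Z. certificate A (nb act) cap (of_code \<circ> mt) S {a \<in> A. a < k \<and> mt a = 0} Z"
  by (simp add: progress_def)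

lemma nb_reach: "nb act a \<subseteq> reach act mt a"
  by (auto simp: reach_def)

lemma reach_subset:
  "nb act a \<subseteq> Z \<Longrightarrow> closed_set A (nb act) (of_code \<circ> mt) Z \<Longrightarrow> reach act mt a \<subseteq> Z"
  by (auto simp: reach_def)

lemma reach_trans:
  assumes "b \<in> A" "mt b = Suc x" "x \<in> reach act mt a"
  shows "reach act mt b \<subseteq> reach act mt a"
proof
  fix y assume y: "y \<in> reach act mt b"
  show "y \<in> reach act mt a"
    unfolding reach_def
  proof (intro InterI, elim CollectE conjE)
    fix Z assume Z: "nb act a \<subseteq> Z" "closed_set A (nb act) (of_code \<circ> mt) Z"
    then have "x \<in> Z" using assms(3) by (auto simp: reach_def)
    then have "nb act b \<subseteq> Z" using Z(2) assms(1,2) by (auto simp: closed_set_def)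
    then show "y \<in> Z" using y Z(2) reach_subset by blast
  qed
qed

lemma full_dead: "full_on A cap (of_code \<circ> mt) (dead act mt cap)"
  by (auto simp: full_on_def dead_def)

text \<open>From a person at a dead item only full items are reachable. Whatever is reachable from
  the people at one of her neighbours is reachable from her, so her neighbours are dead as
  well.\<close>

lemma closed_dead:
  assumes "valid mt"
  shows "closed_set A (nb act) (of_code \<circ> mt) (dead act mt cap)"
  unfolding closed_set_def
proof (intro ballI impI subsetI)
  fix a x assume a: "a \<in> A" "(of_code \<circ> mt) a \<in> Some ` dead act mt cap" and x: "x \<in> nb act a"
  then obtain d where d: "mt a = Suc d" "d \<in> dead act mt cap" by auto
  have full: "cap y \<le> load A (of_code \<circ> mt) y" if "y \<in> reach act mt a" for y
    using that d A_less[OF a(1)] by (fastforce simp: dead_def alive_def)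
  have xr: "x \<in> reach act mt a" using x nb_reach by blast
  have "\<not> alive act mt cap x"
  proof
    assume "alive act mt cap x"
    then obtain b y where b: "b < n" "mt b = Suc x" "y \<in> reach act mt b"
      "load A (of_code \<circ> mt) y < cap y" by (auto simp: alive_def)
    moreover have "b \<in> A" using assms b by (auto simp: valid_def)
    ultimately have "y \<in> reach act mt a" using reach_trans xr by blast
    then show False using full[of y] b(4) by simp
  qed
  moreover have "x \<in> T" using x nb_T A_less[OF a(1)] by blast
  ultimately show "x \<in> dead act mt cap" using full[OF xr] by (simp add: dead_def)
qed

text \<open>Nothing outside a closed set is reachable from the people matched into it, and inside
  there is no spare capacity.\<close>

lemma dead_greatest:
  assumes "valid mt" and Z: "closed_set A (nb act) (of_code \<circ> mt) Z"
    "full_on A cap (of_code \<circ> mt) Z" "Z \<subseteq> T"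
  shows "Z \<subseteq> dead act mt cap"
proof
  fix x assume x: "x \<in> Z"
  have "\<not> alive act mt cap x"
  proof
    assume "alive act mt cap x"
    then obtain b y where b: "b < n" "mt b = Suc x" "y \<in> reach act mt b"
      "load A (of_code \<circ> mt) y < cap y" by (auto simp: alive_def)
    then have "b \<in> A" using assms(1) by (auto simp: valid_def)
    then have "nb act b \<subseteq> Z" using Z(1) b x by (auto simp: closed_set_def)
    then have "y \<in> Z" using reach_subset[OF _ Z(1)] b by blast
    then show False using Z(2) b by (auto simp: full_on_def)
  qed
  then show "x \<in> dead act mt cap" using x Z by (auto simp: dead_def full_on_def)
qed

end

text \<open>\<open>last_edge\<close>, \<open>last_worse\<close> and \<open>cap_0\<close> describe
  the last resort, item 0; being strictly worse than the first entry of a list, it is never a top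
  choice.\<close>

locale ranked_graph = graph +
  fixes rk cap :: "nat \<Rightarrow> nat" and ck :: "nat \<Rightarrow> real"
  assumes inj_tg: "a < n \<Longrightarrow> inj_on tg {st a..<st (Suc a)}"
    and rk_sorted: "a < n \<Longrightarrow> st a \<le> e \<Longrightarrow> e \<le> e' \<Longrightarrow> e' < st (Suc a) \<Longrightarrow> rk e \<le> rk e'"
    and last_edge: "a \<in> A \<Longrightarrow> tg (st (Suc a) - 1) = 0"
    and last_worse: "a \<in> A \<Longrightarrow> rk (st a) < rk (st (Suc a) - 1)"
    and cap_pos: "x \<in> T \<Longrightarrow> 0 < cap x"
    and cap_0: "n \<le> cap 0"
begin

definition N :: "nat \<Rightarrow> nat set" where
  "N a = tg ` {st a..<st (Suc a)}"

definition r :: "nat \<Rightarrow> nat \<Rightarrow> nat" where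
  "r a x = rk (the_inv_into {st a..<st (Suc a)} tg x)"

lemma r_tg: "a < n \<Longrightarrow> st a \<le> e \<Longrightarrow> e < st (Suc a) \<Longrightarrow> r a (tg e) = rk e"
  unfolding r_def using the_inv_into_f_f[OF inj_tg] by simp

sublocale P: capacitated_preferences A N r cap 0
proof
  show "finite A" by (rule finite_A)
  show "finite (N a)" for a by (simp add: N_def)
  show "0 \<in> N a" if "a \<in> A" for a
  proof -
    have "st (Suc a) - 1 \<in> {st a..<st (Suc a)}" using that by (auto simp: A_def)
    then show ?thesis unfolding N_def using last_edge[OF that] by (metis imageI)
  qed
  have "card A \<le> card {..<n}" by (intro card_mono) (auto simp: A_def)
  then show "card A \<le> cap 0" using cap_0 by simp
  show "0 < cap x" if "a \<in> A" "x \<in> N a" for a x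
    using that edge_T[OF A_less[OF that(1)]] by (intro cap_pos) (auto simp: N_def)
qed

lemma N_T: "a \<in> A \<Longrightarrow> N a \<subseteq> T"
  using edge_T[OF A_less] by (auto simp: N_def)

lemma top_eq: "a \<in> A \<Longrightarrow> P.top a = {tg e |e. st a \<le> e \<and> e < st (Suc a) \<and> rk e = rk (st a)}"
proof -
  assume a: "a \<in> A"
  then have an: "a < n" and ne: "st a < st (Suc a)" by (auto simp: A_def)
  have "P.top a = {tg e |e. st a \<le> e \<and> e < st (Suc a) \<and> (\<forall>e'. st a \<le> e' \<and> e' < st (Suc a) \<longrightarrow> rk e \<le> rk e')}"
    unfolding P.top_def N_def using r_tg[OF an] by auto
  also have "\<dots> = {tg e |e. st a \<le> e \<and> e < st (Suc a) \<and> rk e = rk (st a)}"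
    using rk_sorted[OF an] ne by (metis (lifting) dual_order.refl le_antisym)
  finally show ?thesis .
qed

text \<open>Lists are sorted, so the first edge \<open>e0\<close> that leaves \<open>D\<close> has
  the best rank outside \<open>D\<close>, and all top choices are in \<open>D\<close> iff
  \<open>rk (st a) < rk e0\<close>. For an edge of top rank this reads \<open>rk e < rk e0\<close>,
  which gives a test of constant cost per edge.\<close>

lemma allowed_iff:
  assumes a: "a \<in> A" and e0: "st a \<le> e0" "e0 < st (Suc a)" "tg e0 \<notin> D"
    and before: "\<And>e. st a \<le> e \<Longrightarrow> e < e0 \<Longrightarrow> tg e \<in> D"
    and e: "st a \<le> e" "e < st (Suc a)"
  shows "tg e \<in> P.allowed D a \<longleftrightarrow>
    tg e \<notin> D \<and> rk e \<le> rk e0 \<or> tg e \<in> D \<and> rk e \<le> rk (st a) \<and> rk e < rk e0"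
proof -
  have an: "a < n" using a A_less by blast
  have out: "e0 \<le> e'" if "st a \<le> e'" "tg e' \<notin> D" for e'
    using before that by (meson not_le)
  have top: "tg e \<in> P.top a \<longleftrightarrow> rk e \<le> rk (st a)"
  proof
    assume "tg e \<in> P.top a"
    then have "r a (tg e) \<le> r a (tg (st a))"
      using e unfolding P.top_def N_def by (auto simp del: r_def)
    then show "rk e \<le> rk (st a)" using r_tg[OF an] e by simp
  next
    assume "rk e \<le> rk (st a)"
    then have "rk e = rk (st a)" using rk_sorted[OF an _ e(1) e(2)] by simp
    then show "tg e \<in> P.top a" unfolding top_eq[OF a] using e by blast
  qed
  have sub: "P.top a \<subseteq> D \<longleftrightarrow> rk (st a) < rk e0"
  proof
    assume *: "P.top a \<subseteq> D"
    have "rk e0 \<noteq> rk (st a)" using * e0 by (auto simp: top_eq[OF a])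
    then show "rk (st a) < rk e0" using rk_sorted[OF an _ e0(1) e0(2)] by simp
  next
    assume *: "rk (st a) < rk e0"
    show "P.top a \<subseteq> D"
    proof
      fix x assume "x \<in> P.top a"
      then obtain e' where e': "x = tg e'" "st a \<le> e'" "e' < st (Suc a)" "rk e' = rk (st a)"
        by (auto simp: top_eq[OF a])
      then have "\<not> e0 \<le> e'" using rk_sorted[OF an e0(1), of e'] * by auto
      then show "x \<in> D" using before e' by simp
    qed
  qed
  have "tg e \<in> P.best_outside D a \<longleftrightarrow> tg e \<notin> D \<and> rk e \<le> rk e0"
  proof
    assume "tg e \<in> P.best_outside D a"
    then have "tg e \<notin> D" "r a (tg e) \<le> r a (tg e0)" using e0 by (auto simp: P.best_outside_def N_def)
    then show "tg e \<notin> D \<and> rk e \<le> rk e0" using r_tg[OF an] e e0 by simp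
  next
    assume *: "tg e \<notin> D \<and> rk e \<le> rk e0"
    have "r a (tg e) \<le> r a y" if y: "y \<in> N a - D" for y
    proof -
      obtain e' where e': "y = tg e'" "st a \<le> e'" "e' < st (Suc a)" "tg e' \<notin> D"
        using y by (auto simp: N_def)
      then have "rk e0 \<le> rk e'" using out rk_sorted[OF an e0(1)] by simp
      then show ?thesis using * e' r_tg[OF an] e by simp
    qed
    then show "tg e \<in> P.best_outside D a" using * e by (auto simp: P.best_outside_def N_def)
  qed
  moreover have "rk (st a) \<le> rk e" using rk_sorted[OF an _ e(1) e(2)] by simp
  ultimately show ?thesis using top sub by (auto simp: P.allowed_def)
qed

lemma allowed_N: "P.allowed D a \<subseteq> N a"
  by (auto simp: P.allowed_def P.best_outside_def P.top_def)

lemma allowed_empty: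
  assumes "a \<in> A"
  shows "P.allowed {} a = P.top a"
proof -
  have "P.best_outside {} a = P.top a" by (auto simp: P.best_outside_def P.top_def)
  then show ?thesis by (auto simp: P.allowed_def)
qed

context
  fixes act fl mt :: "nat \<Rightarrow> nat"
  assumes first_phase: "progress act cap fl ck n mt"
    and act_top: "\<And>a. a \<in> A \<Longrightarrow> nb act a = P.top a"
begin

private abbreviation (input) D :: "nat set" where
  "D \<equiv> dead act mt cap"

lemma finite_dead: "finite D"
  using finite_T by (auto simp: dead_def)

lemma top_matching: "partial_matching A P.top cap (of_code \<circ> mt)"
  using progress_partial_matching[OF first_phase] act_top by (simp add: partial_matching_def)

text \<open>The essential point is that an unmatched person has all her top choices in the dead set:
  the set \<open>Z\<close> that certifies her failed search is full and closed, so its part in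
  \<open>T\<close> is dead.\<close>

lemma koenig_dead: "P.koenig (of_code \<circ> mt) D"
  unfolding P.koenig_def
proof (intro conjI ballI impI)
  note valid = progress_valid[OF first_phase]
  show "full_on A cap (of_code \<circ> mt) D" by (rule full_dead)
  show "closed_set A P.top (of_code \<circ> mt) D"
    using closed_dead[OF valid, of act cap] act_top by (simp add: closed_set_def)
  fix a assume a: "a \<in> A" "\<not> P.top a \<subseteq> D"
  show "(of_code \<circ> mt) a \<noteq> None"
  proof
    assume "(of_code \<circ> mt) a = None"
    then have mt: "mt a = 0" by simp
    obtain Z where Z: "certificate A (nb act) cap (of_code \<circ> mt) UNIV {a \<in> A. a < n \<and> mt a = 0} Z"
      by (rule exE[OF progress_certificate[OF first_phase downward_UNIV]])
    have "Z \<inter> T \<subseteq> dead act mt cap"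
    proof (rule dead_greatest[OF valid])
      show "closed_set A (nb act) (of_code \<circ> mt) (Z \<inter> T)"
        unfolding closed_set_def
      proof (intro ballI impI)
        fix b assume b: "b \<in> A" "(of_code \<circ> mt) b \<in> Some ` (Z \<inter> T)"
        then have "nb act b \<subseteq> Z" using Z by (auto simp: certificate_def closed_set_def)
        then show "nb act b \<subseteq> Z \<inter> T" using nb_T[OF A_less[OF b(1)]] by blast
      qed
    qed (use Z in \<open>auto simp: certificate_def full_on_def\<close>)
    moreover have "nb act a \<subseteq> Z" using Z a mt A_less[OF a(1)] by (auto simp: certificate_def)
    ultimately have "nb act a \<subseteq> D" using nb_T[OF A_less[OF a(1)]] by blast
    then show False using a act_top by simp
  qed
qed

lemma pop_allowed:
  assumes "P.pop g"
  shows "full_on A cap (Some \<circ> g) D" and "a \<in> A \<Longrightarrow> g a \<in> P.allowed D a"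
proof -
  have greatest: "Z \<subseteq> D" if "closed_set A P.top (of_code \<circ> mt) Z" "full_on A cap (of_code \<circ> mt) Z"
      "Z \<subseteq> (\<Union>a\<in>A. N a)" for Z
  proof (rule dead_greatest[OF progress_valid[OF first_phase] _ that(2)])
    show "closed_set A (nb act) (of_code \<circ> mt) Z" using that(1) act_top by (simp add: closed_set_def)
    show "Z \<subseteq> T" using that(3) N_T by blast
  qed
  show "full_on A cap (Some \<circ> g) D" "a \<in> A \<Longrightarrow> g a \<in> P.allowed D a"
    by (rule P.allowed_if_pop[OF assms finite_dead top_matching koenig_dead greatest]; assumption)+
qed

lemma pop_matching:
  assumes "P.pop g"
  shows "partial_matching A (P.allowed D) cap (Some \<circ> g)"
  using assms pop_allowed(2)[OF assms] by (auto simp: partial_matching_def P.pop_def P.assignment_def)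

lemma pop_load_dead:
  assumes "P.pop g" "x \<in> D"
  shows "load A (Some \<circ> g) x = cap x"
proof (rule antisym)
  show "load A (Some \<circ> g) x \<le> cap x"
    using assms(1) unfolding P.pop_def P.assignment_def by blast
  show "cap x \<le> load A (Some \<circ> g) x"
    using pop_allowed(1)[OF assms(1)] assms(2) unfolding full_on_def by blast
qed

lemma pop_card_dead:
  assumes g: "P.pop g"
  shows "card {a \<in> A. g a \<in> D} = sum cap D"
proof -
  have "{a \<in> A. g a \<in> D} = {a \<in> A. (Some \<circ> g) a \<in> Some ` D}" by auto
  then have "card {a \<in> A. g a \<in> D} = sum (load A (Some \<circ> g)) D"
    by (simp only: card_matched_into[OF finite_A finite_dead])
  also have "\<dots> = sum cap D" by (rule sum.cong[OF refl]) (rule pop_load_dead[OF g])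
  finally show ?thesis .
qed

lemma pop_price_dead:
  assumes g: "P.pop g"
  shows "(\<Sum>a | a \<in> A \<and> g a \<in> D. ck (g a)) = (\<Sum>x\<in>D. real (cap x) * ck x)"
proof -
  let ?I = "{a \<in> A. g a \<in> D}"
  have "(\<Sum>a\<in>?I. ck (g a)) = (\<Sum>x\<in>D. \<Sum>a | a \<in> ?I \<and> g a = x. ck (g a))"
    using finite_A finite_dead by (intro sum.group[symmetric]) auto
  also have "\<dots> = (\<Sum>x\<in>D. real (cap x) * ck x)"
  proof (rule sum.cong[OF refl])
    fix x assume x: "x \<in> D"
    then have "{a. a \<in> ?I \<and> g a = x} = {a \<in> A. (Some \<circ> g) a = Some x}" by auto
    then show "(\<Sum>a | a \<in> ?I \<and> g a = x. ck (g a)) = real (cap x) * ck x"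
      using pop_load_dead[OF g x] by (simp add: load_def)
  qed
  finally show ?thesis .
qed

text \<open>In the second phase \<open>fl\<close> is 0 on the dead items, which are to be used first.\<close>

context
  fixes act2 fl2 mt2 :: "nat \<Rightarrow> nat"
  assumes second_phase: "progress act2 cap fl2 ck n mt2"
    and act_allowed: "\<And>a. a \<in> A \<Longrightarrow> nb act2 a = P.allowed D a"
    and fl2: "\<And>x. fl2 x \<le> 1" "\<And>x. x \<in> T \<Longrightarrow> fl2 x = 0 \<longleftrightarrow> x \<in> D"
begin

lemma allowed_matching: "partial_matching A (P.allowed D) cap (of_code \<circ> mt2)"
  using progress_partial_matching[OF second_phase] act_allowed by (simp add: partial_matching_def)

lemma allowed_certificate:
  assumes "downward fl2 ck S"
  shows "\<exists>Z. certificate A (P.allowed D) cap (of_code \<circ> mt2) S {a \<in> A. mt2 a = 0} Z"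
proof -
  have "{a \<in> A. a < n \<and> mt2 a = 0} = {a \<in> A. mt2 a = 0}" using A_less by auto
  then obtain Z where Z: "certificate A (nb act2) cap (of_code \<circ> mt2) S {a \<in> A. mt2 a = 0} Z"
    using progress_certificate[OF second_phase assms] by auto
  have "certificate A (P.allowed D) cap (of_code \<circ> mt2) S {a \<in> A. mt2 a = 0} Z"
    by (rule certificate_cong[THEN iffD1, OF _ _ Z]) (auto simp: act_allowed)
  then show ?thesis ..
qed

lemma no_pop_if_unmatched:
  assumes "a \<in> A" "mt2 a = 0"
  shows "\<not> P.pop g"
proof
  assume "P.pop g"
  note g = pop_matching[OF this]
  obtain Z where "certificate A (P.allowed D) cap (of_code \<circ> mt2) UNIV {a \<in> A. mt2 a = 0} Z"
    by (rule exE[OF allowed_certificate[OF downward_UNIV]])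
  from certificate_infeasible[OF finite_A this _ _ _ g] show False using assms by auto
qed

context
  assumes complete: "\<And>a. a \<in> A \<Longrightarrow> mt2 a \<noteq> 0"
begin

definition result :: "nat \<Rightarrow> nat" where
  "result a = mt2 a - 1"

lemma result_code: "a \<in> A \<Longrightarrow> (of_code \<circ> mt2) a = (Some \<circ> result) a"
  using complete[of a] by (simp add: result_def of_code_def)

lemma load_result: "load A (Some \<circ> result) x = load A (of_code \<circ> mt2) x"
  by (rule load_cong) (simp only: result_code)

lemma result_allowed: "a \<in> A \<Longrightarrow> result a \<in> P.allowed D a"
proof -
  assume a: "a \<in> A"
  then have "(of_code \<circ> mt2) a = Some (result a)" using result_code by simp
  then show ?thesis using a allowed_matching unfolding partial_matching_def by blast
qed

lemma full_result: "full_on A cap (Some \<circ> result) D"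
proof -
  obtain Z where Z: "certificate A (P.allowed D) cap (of_code \<circ> mt2) {x. fl2 x = 0} {a \<in> A. mt2 a = 0} Z"
    by (rule exE[OF allowed_certificate[OF downward_flagged]])
  \<comment> \<open>Outside \<open>T\<close> the flags say nothing about \<open>D\<close>, but only
    items of \<open>T\<close> are in use.\<close>
  have "x \<in> T" if "a \<in> A" "(of_code \<circ> mt2) a = Some x" for a x
  proof -
    have "x = result a" using that by (simp add: result_def)
    then show ?thesis using result_allowed[OF that(1)] allowed_N N_T[OF that(1)] by blast
  qed
  then have "(\<forall>a\<in>A. \<forall>x. (of_code \<circ> mt2) a = Some x \<longrightarrow> x \<in> Z \<union> D)"
    using Z fl2(2) unfolding certificate_def by blast
  moreover have "fl2 x = 0" if "x \<in> D" for x
  proof -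
    have "x \<in> T" using that by (simp add: dead_def)
    then show ?thesis using that fl2(2) by blast
  qed
  ultimately have "certificate A (P.allowed D) cap (of_code \<circ> mt2) D {a \<in> A. mt2 a = 0} Z"
    using Z unfolding certificate_def full_on_def by blast
  then have "full_on A cap (of_code \<circ> mt2) D"
    using complete
    by (intro P.complete_fills[OF finite_dead top_matching koenig_dead allowed_matching]) auto
  then show ?thesis by (simp add: full_on_def load_result)
qed

lemma pop_result: "P.pop result"
proof (rule P.pop_if_allowed[OF finite_dead full_result])
  show "\<forall>x. load A (Some \<circ> result) x \<le> cap x"
    using allowed_matching unfolding partial_matching_def load_result by blast
  show "\<forall>a\<in>A. result a \<in> P.allowed D a" using result_allowed by blast
qed

text \<open>The people assigned to dead items pay the same in all popular assignments; the rest of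
  \<open>g\<close> is dominated by \<open>result\<close> at every price level.\<close>

lemma result_cheapest:
  assumes g: "P.pop g"
  shows "(\<Sum>a\<in>A. ck (result a)) \<le> (\<Sum>a\<in>A. ck (g a))"
proof -
  let ?I = "\<lambda>h. {a \<in> A. h a \<in> D}" and ?O = "\<lambda>h. {a \<in> A. h a \<notin> D}"
  have part: "A = ?I h \<union> ?O h" "?I h \<inter> ?O h = {}" "finite (?I h)" "finite (?O h)" for h
    using finite_A by auto
  have cardO: "card A = card (?I h) + card (?O h)" for h
  proof -
    have "card (?I h \<union> ?O h) = card (?I h) + card (?O h)" by (rule card_Un_disjoint[OF part(3,4,2)])
    then show ?thesis by (simp only: part(1)[of h, symmetric])
  qed
  have splitA: "(\<Sum>a\<in>A. ck (h a)) = (\<Sum>a\<in>?I h. ck (h a)) + (\<Sum>a\<in>?O h. ck (h a))" for h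
  proof -
    have "(\<Sum>a\<in>?I h \<union> ?O h. ck (h a)) = (\<Sum>a\<in>?I h. ck (h a)) + (\<Sum>a\<in>?O h. ck (h a))"
      by (rule sum.union_disjoint[OF part(3,4,2)])
    then show ?thesis by (simp only: part(1)[of h, symmetric])
  qed
  have "(\<Sum>a\<in>?O result. ck (result a)) \<le> (\<Sum>a\<in>?O g. ck (g a))"
  proof (rule sum_le_if_dominated)
    show "finite (?O result)" "finite (?O g)" using finite_A by auto
    show "card (?O result) = card (?O g)" 
      using cardO[of result] cardO[of g] pop_card_dead[OF g] pop_card_dead[OF pop_result] by simp
    fix k
    \<comment> \<open>The dead items must be included for \<open>?S\<close> to be an initial
      segment. The number of people assigned to them is the same on both sides and cancels.\<close>
    let ?S = "{x. fl2 x = 0} \<union> {x. ck x < k}"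
    obtain Z where Z: "certificate A (P.allowed D) cap (of_code \<circ> mt2) ?S {a \<in> A. mt2 a = 0} Z"
      by (rule exE[OF allowed_certificate[OF downward_price[OF fl2(1)]]])
    have "card {a \<in> A. (Some \<circ> g) a \<in> Some ` ?S} \<le> card {a \<in> A. (of_code \<circ> mt2) a \<in> Some ` ?S}"
      using complete
      by (intro certificate_optimal[OF finite_A Z allowed_matching _ pop_matching[OF g]]) auto
    also have "{a \<in> A. (of_code \<circ> mt2) a \<in> Some ` ?S} = {a \<in> A. (Some \<circ> result) a \<in> Some ` ?S}"
      using result_code by auto
    finally have le: "card {a \<in> A. g a \<in> ?S} \<le> card {a \<in> A. result a \<in> ?S}" by (simp add: image_iff)
    have count: "card {a \<in> A. h a \<in> ?S} = sum cap D + card {a \<in> ?O h. ck (h a) < k}" if h: "P.pop h" for h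
    proof -
      have "h a \<in> T" if "a \<in> A" for a using that h N_T by (auto simp: P.pop_def P.assignment_def)
      then have "{a \<in> A. h a \<in> ?S} = ?I h \<union> {a \<in> ?O h. ck (h a) < k}"
        using fl2(2) by (auto simp: dead_def)
      moreover have "?I h \<inter> {a \<in> ?O h. ck (h a) < k} = {}" by auto
      ultimately have "card {a \<in> A. h a \<in> ?S} = card (?I h) + card {a \<in> ?O h. ck (h a) < k}"
        using finite_A card_Un_disjoint[of "?I h" "{a \<in> ?O h. ck (h a) < k}"] by simp
      then show ?thesis using pop_card_dead[OF h] by simp
    qed
    show "card {a \<in> ?O g. ck (g a) < k} \<le> card {a \<in> ?O result. ck (result a) < k}"
      using le count[OF g] count[OF pop_result] by simp
  qed
  then show ?thesis
    using splitA[of result] splitA[of g] pop_price_dead[OF g] pop_price_dead[OF pop_result] by simp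
qed

end

end

end

end

section \<open>The algorithm\<close>

definition match_all :: com where
  "match_all =
    For ''a'' (Lit 0) (V ''people'')
      (If (Less (Get ''st'' (V ''a'')) (Get ''st'' (Inc (V ''a''))))
        (reset_search;; run_search;; flip_path) Skip)"

definition mark_alive :: com where
  "mark_alive =
    For ''a'' (Lit 0) (V ''people'')
      (If (Less (Lit 0) (Get ''mt'' (V ''a'')))
        (reset_search;; run_search;;
         If (Less (Lit 0) (V ''b'')) (Put ''ev'' (Dec (Get ''mt'' (V ''a''))) (Lit 1)) Skip)
        Skip)"

text \<open>\<open>reset_search\<close> is run for the loads that it computes. Flag 0 marks the dead
  items.\<close>

definition flag_items :: com where
  "flag_items =
    (reset_search;;
     For ''e'' (Lit 0) (Get ''st'' (V ''people''))
      (''x'' ::= Get ''tg'' (V ''e'');;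
       If (And (Not (Less (Get ''ld'' (V ''x'')) (Get ''cp'' (V ''x''))))
            (Not (Less (Lit 0) (Get ''ev'' (V ''x'')))))
         (Put ''fl'' (V ''x'') (Lit 0)) (Put ''fl'' (V ''x'') (Lit 1))))"

definition or_exp :: "bexp \<Rightarrow> bexp \<Rightarrow> bexp" where
  "or_exp b c = Not (And (Not b) (Not c))"

definition activate_edge :: com where
  "activate_edge =
    If (or_exp
          (And (Less (Lit 0) (Get ''fl'' (Get ''tg'' (V ''e''))))
            (Not (Less (V ''r'') (Get ''rk'' (V ''e'')))))
          (And (Not (Less (Lit 0) (Get ''fl'' (Get ''tg'' (V ''e'')))))
            (And (Not (Less (Get ''rk'' (Get ''st'' (V ''a''))) (Get ''rk'' (V ''e''))))
              (Less (Get ''rk'' (V ''e'')) (V ''r'')))))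
      (Put ''act'' (V ''e'') (Lit 1)) (Put ''act'' (V ''e'') (Lit 0))"

text \<open>The first loop looks for the first edge that leaves the dead set; the last resort at the
  end of the list stops it. With all flags 1 it stops at once, and exactly the top choices get
  activated, so both phases share this program.\<close>

definition activate_edges :: com where
  "activate_edges =
    (''e'' ::= Get ''st'' (V ''a'');;
     While (Not (Less (Lit 0) (Get ''fl'' (Get ''tg'' (V ''e''))))) (''e'' ::= Inc (V ''e''));;
     ''r'' ::= Get ''rk'' (V ''e'');;
     For ''e'' (Get ''st'' (V ''a'')) (Get ''st'' (Inc (V ''a''))) activate_edge)"

definition set_active :: com where
  "set_active =
    For ''a'' (Lit 0) (V ''people'')
      (If (Less (Get ''st'' (V ''a'')) (Get ''st'' (Inc (V ''a'')))) activate_edges Skip)"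

definition unmatch_all :: com where
  "unmatch_all = For ''a'' (Lit 0) (V ''people'') (Put ''mt'' (V ''a'') (Lit 0))"

text \<open>In the graph item \<open>b\<close> has number \<open>b + 1\<close> and the last resort
  has number 0, and \<open>mt\<close> adds 1 once more. Subtracting 1 yields the required code, with
  0 for the last resort; people without edges also get 0, by truncated subtraction.\<close>

definition answer :: com where
  "answer =
    (''popular'' ::= Lit 1;;
     For ''a'' (Lit 0) (V ''people'')
      (If (And (Less (Get ''st'' (V ''a'')) (Get ''st'' (Inc (V ''a''))))
            (Not (Less (Lit 0) (Get ''mt'' (V ''a'')))))
        (''popular'' ::= Lit 0) Skip;;
       Put ''match'' (V ''a'') (Dec (Get ''mt'' (V ''a'')))))"

definition solve :: com where
  "solve = (set_active;; match_all;; mark_alive;; flag_items;; unmatch_all;; set_active;; match_all;; answer)"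

lemma bval_or_exp [simp]: "bval (or_exp b c) s \<longleftrightarrow> bval b s \<or> bval c s"
  by (simp add: or_exp_def)

lemma writes_activate [simp]:
  "writes activate_edge = {''act''}" "rwrites activate_edge = {}"
  "writes activate_edges = {''e'', ''r'', ''act''}" "rwrites activate_edges = {}"
  by (auto simp: activate_edge_def activate_edges_def)

lemma writes_search [simp]:
  "writes reset_search = {''e'', ''vis'', ''ld'', ''hp'', ''p'', ''x'', ''nx''}"
  "writes run_search = {''c'', ''e'', ''p'', ''b'', ''h'', ''t'', ''x'', ''q'', ''vis'', ''par''}"
  "writes flip_path = {''x'', ''c'', ''y'', ''mt''}"
  "rwrites reset_search = {}" "rwrites run_search = {}" "rwrites flip_path = {}"
  by (auto simp: reset_search_def run_search_def search_step_def scan_edge_def flip_path_def)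

context graph
begin

definition K :: int where
  "K = int (st n)"

text \<open>The bounds for \<open>reset_search\<close>, \<open>run_search\<close> and
  \<open>flip_path\<close> added up, plus 3.\<close>

definition W :: int where
  "W = 30 + 17 * int n + 70 * K"

lemma W_nonneg: "0 \<le> W"
  by (simp add: K_def W_def)

lemma runs_augment_person:
  assumes s: "env s" "nats s ''a'' 0 = u" and u: "u \<in> A"
    and p: "progress act cap fl ck u mt"
    and arrays: "nats s ''mt'' = mt" "nats s ''act'' = act" "nats s ''cp'' = cap"
      "nats s ''fl'' = fl" "reals s ''ck'' = ck"
  shows "runs (reset_search;; run_search;; flip_path) s (W - 2)
    (\<lambda>s'. progress act cap fl ck (Suc u) (nats s' ''mt''))"
proof (rule runs_Seq)
  note valid = progress_valid[OF p]
  show "runs reset_search s (4 + 5 * int (st n) + 7 * int n)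
    (\<lambda>s'. linked n mt (nats s' ''ld'') (nats s' ''hp'') (nats s' ''nx'') \<and> (\<forall>x\<in>T. nats s' ''vis'' x = 0))"
    by (rule runs_reset_search[OF s(1) arrays(1) valid])
  fix s1 assume s1: "linked n mt (nats s1 ''ld'') (nats s1 ''hp'') (nats s1 ''nx'') \<and>
      (\<forall>x\<in>T. nats s1 ''vis'' x = 0)" and un: "unchanged reset_search s s1"
  interpret S: search n st tg act mt "nats s1 ''ld''" "nats s1 ''hp''" "nats s1 ''nx''" u
    using valid s1 u by unfold_locales auto
  have env1: "env s1" using env_unchanged[OF s(1) un] by simp
  have arrays1: "nats s1 ''a'' 0 = u" "nats s1 ''mt'' = mt" "nats s1 ''act'' = act"
      "nats s1 ''cp'' = cap" "nats s1 ''fl'' = fl" "reals s1 ''ck'' = ck"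
    using arrays s by (simp_all add: unchanged_nats[OF un] unchanged_reals[OF un])
  show "runs (run_search;; flip_path) s1 (24 + 10 * int n + 65 * int (st n))
    (\<lambda>s'. progress act cap fl ck (Suc u) (nats s' ''mt''))"
  proof (rule runs_Seq[OF S.runs_run_search])
    fix s2 assume s2: "S.found (nats s2 ''vis'') (nats s2 ''par'') (nats s2 ''q'') (nats s2 ''t'' 0) \<and>
       S.explored (nats s2 ''vis'') \<and> S.best_ok cap fl ck (nats s2 ''vis'') (nats s2 ''b'' 0)"
      and un2: "unchanged run_search s1 s2"
    have mt2: "nats s2 ''mt'' = mt" using arrays1 by (simp add: unchanged_nats[OF un2])
    have mtu: "mt u = 0" using p A_less[OF u] by (auto simp: progress_def)
    let ?b = "nats s2 ''b'' 0"
    show "runs flip_path s2 (3 + 5 * int (st n)) (\<lambda>s'. progress act cap fl ck (Suc u) (nats s' ''mt''))"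
    proof (rule runs_mono[OF S.runs_flip_path[OF mt2 refl refl]])
      show "S.found (nats s2 ''vis'') (nats s2 ''par'') (nats s2 ''q'') (nats s2 ''t'' 0)"
        "S.best_ok cap fl ck (nats s2 ''vis'') ?b" "mt u = 0" using s2 mtu by auto
      fix s' assume s': "if ?b = 0 then nats s' ''mt'' = mt
        else S.flipping (nats s2 ''vis'') ?b (nats s' ''mt'') 0"
      show "progress act cap fl ck (Suc u) (nats s' ''mt'')"
      proof (cases ?b)
        case 0
        then show ?thesis using S.progress_fail[OF p] s2 s' by auto
      next
        case (Suc t)
        then show ?thesis using S.progress_augment[OF p] s2 s' by auto
      qed
    qed simp
  qed (use env1 arrays1 s1 in \<open>simp_all\<close>)
qed (simp add: W_def K_def)

text \<open>The visited items are exactly \<open>reach act mt u\<close>: \<open>found_least\<close>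
  gives one inclusion and \<open>explored_closed\<close> the other.\<close>

lemma runs_find:
  assumes s: "env s" "nats s ''a'' 0 = u" and u: "u \<in> A" and valid: "valid mt"
    and arrays: "nats s ''mt'' = mt" "nats s ''act'' = act" "nats s ''cp'' = cap"
  shows "runs (reset_search;; run_search) s (W - 5)
    (\<lambda>s'. 0 < nats s' ''b'' 0 \<longleftrightarrow> (\<exists>y\<in>reach act mt u. load A (of_code \<circ> mt) y < cap y))"
proof (rule runs_Seq)
  show "runs reset_search s (4 + 5 * int (st n) + 7 * int n)
    (\<lambda>s'. linked n mt (nats s' ''ld'') (nats s' ''hp'') (nats s' ''nx'') \<and> (\<forall>x\<in>T. nats s' ''vis'' x = 0))"
    by (rule runs_reset_search[OF s(1) arrays(1) valid])
  fix s1 assume s1: "linked n mt (nats s1 ''ld'') (nats s1 ''hp'') (nats s1 ''nx'') \<and>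
      (\<forall>x\<in>T. nats s1 ''vis'' x = 0)" and un: "unchanged reset_search s s1"
  interpret S: search n st tg act mt "nats s1 ''ld''" "nats s1 ''hp''" "nats s1 ''nx''" u
    using valid s1 u by unfold_locales auto
  have env1: "env s1" using env_unchanged[OF s(1) un] by simp
  have arrays1: "nats s1 ''a'' 0 = u" "nats s1 ''mt'' = mt" "nats s1 ''act'' = act" "nats s1 ''cp'' = cap"
    using arrays s by (simp_all add: unchanged_nats[OF un] unchanged_reals[OF un])
  show "runs run_search s1 (20 + 10 * int n + 60 * int (st n))
    (\<lambda>s'. 0 < nats s' ''b'' 0 \<longleftrightarrow> (\<exists>y\<in>reach act mt u. load A (of_code \<circ> mt) y < cap y))"
  proof (rule runs_mono[OF S.runs_run_search])
    fix s2 assume s2: "S.found (nats s2 ''vis'') (nats s2 ''par'') (nats s2 ''q'') (nats s2 ''t'' 0) \<and>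
       S.explored (nats s2 ''vis'') \<and>
       S.best_ok cap (nats s1 ''fl'') (reals s1 ''ck'') (nats s2 ''vis'') (nats s2 ''b'' 0)"
    let ?R = "{x \<in> T. 0 < nats s2 ''vis'' x}"
    have "?R \<subseteq> Z" if "nb act u \<subseteq> Z" "closed_set A (nb act) (of_code \<circ> mt) Z" for Z
      using S.found_least that s2 by blast
    then have "?R \<subseteq> reach act mt u" unfolding reach_def by blast
    moreover have "reach act mt u \<subseteq> ?R" using S.explored_closed reach_subset s2 by blast
    ultimately have R: "reach act mt u = ?R" by blast
    have ld: "nats s1 ''ld'' x = load A (of_code \<circ> mt) x" if "x \<in> T" for x
      using linked_load[OF S.linked valid that] .
    show "0 < nats s2 ''b'' 0 \<longleftrightarrow> (\<exists>y\<in>reach act mt u. load A (of_code \<circ> mt) y < cap y)"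
    proof (cases "nats s2 ''b'' 0 = 0")
      case True
      then show ?thesis using s2 ld unfolding R S.best_ok_def by fastforce
    next
      case False
      then show ?thesis using s2 ld unfolding R S.best_ok_def by auto
    qed
  qed (use env1 arrays1 s1 in \<open>simp_all\<close>)
qed (simp add: W_def K_def)

lemma sum_people: "(\<Sum>a\<in>{0..<n}. 2 + (if a \<in> A then W else 0) + 2) = 4 * int n + int (card A) * W"
proof -
  have "{0..<n} \<inter> A = A" by (auto simp: A_def)
  then show ?thesis by (simp add: sum.distrib sum.If_cases Int_def)
qed

lemma runs_match_all:
  assumes s: "env s" and arrays: "nats s ''act'' = act" "nats s ''cp'' = cap"
      "nats s ''fl'' = fl" "reals s ''ck'' = ck" and mt: "\<forall>a<n. nats s ''mt'' a = 0"
  shows "runs match_all s (2 + 4 * int n + int (card A) * W)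
    (\<lambda>s'. progress act cap fl ck n (nats s' ''mt''))"
  unfolding match_all_def
proof (rule runs_For[where M = 0 and N = n and I = "\<lambda>k s'. progress act cap fl ck k (nats s' ''mt'')"
      and w = "\<lambda>a. 2 + (if a \<in> A then W else 0)"])
  let ?c = "If (Less (Get ''st'' (V ''a'')) (Get ''st'' (Inc (V ''a''))))
        (reset_search;; run_search;; flip_path) Skip"
  let ?l = "For ''a'' (Lit 0) (V ''people'') ?c"
  show "nval (V ''people'') s' = n" if "unchanged ?l s s'" for s'
    using s by (simp add: unchanged_nats[OF that] env_def)
  fix k s' assume k: "k < n" "progress act cap fl ck k (nats s' ''mt'')" "nats s' ''a'' 0 = k"
    and un: "unchanged ?l s s'"
  have env': "env s'" using env_unchanged[OF s un] by simp
  have arrays': "nats s' ''act'' = act" "nats s' ''cp'' = cap" "nats s' ''fl'' = fl" "reals s' ''ck'' = ck"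
    using arrays by (simp_all add: unchanged_nats[OF un] unchanged_reals[OF un])
  show "runs ?c s' (2 + (if k \<in> A then W else 0))
      (\<lambda>s''. progress act cap fl ck (Suc k) (nats (put ''a'' 0 (Suc k) s'') ''mt''))"
  proof (cases "k \<in> A")
    case True
    then have "bval (Less (Get ''st'' (V ''a'')) (Get ''st'' (Inc (V ''a'')))) s'"
      using env' k by (simp add: env_def A_def)
    moreover have "runs (reset_search;; run_search;; flip_path) s' (1 + W)
        (\<lambda>s''. progress act cap fl ck (Suc k) (nats s'' ''mt''))"
      by (rule runs_mono[OF runs_augment_person[OF env' k(3) True k(2) refl arrays']]) simp_all
    ultimately show ?thesis using True by (simp add: runs_wp del: wp_Seq bval.simps)
  next
    case False
    then have "\<not> bval (Less (Get ''st'' (V ''a'')) (Get ''st'' (Inc (V ''a'')))) s'"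
      using env' k by (simp add: env_def A_def)
    then show ?thesis using False progress_skip[OF k(2)] by (simp add: runs_wp del: bval.simps)
  qed
qed (use mt progress_init W_nonneg sum_people in \<open>auto\<close>)

lemma runs_mark_alive:
  assumes s: "env s" and arrays: "nats s ''mt'' = mt" "nats s ''act'' = act" "nats s ''cp'' = cap"
    and valid: "valid mt" and ev: "\<forall>x. nats s ''ev'' x = 0"
  shows "runs mark_alive s (2 + 4 * int n + int (card A) * W)
    (\<lambda>s'. \<forall>x. 0 < nats s' ''ev'' x \<longleftrightarrow> alive act mt cap x)"
proof -
  let ?f = "\<lambda>a. \<exists>y\<in>reach act mt a. load A (of_code \<circ> mt) y < cap y"
  let ?I = "\<lambda>k s'. \<forall>x. 0 < nats s' ''ev'' x \<longleftrightarrow> (\<exists>a<k. mt a = Suc x \<and> ?f a)"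
  let ?i = "If (Less (Lit 0) (V ''b'')) (Put ''ev'' (Dec (Get ''mt'' (V ''a''))) (Lit 1)) Skip"
  let ?c = "If (Less (Lit 0) (Get ''mt'' (V ''a''))) (reset_search;; run_search;; ?i) Skip"
  let ?l = "For ''a'' (Lit 0) (V ''people'') ?c"
  have "runs ?l s (2 + 4 * int n + int (card A) * W) (\<lambda>s'. ?I n s')"
  proof (rule runs_For[where M = 0 and N = n and I = ?I and w = "\<lambda>a. 2 + (if a \<in> A then W else 0)"])
    show "nval (V ''people'') s' = n" if "unchanged ?l s s'" for s'
      using s by (simp add: unchanged_nats[OF that] env_def)
    fix k s' assume k: "k < n" "?I k s'" "nats s' ''a'' 0 = k" and un: "unchanged ?l s s'"
    have env': "env s'" using env_unchanged[OF s un] by simp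
    have arrays': "nats s' ''mt'' = mt" "nats s' ''act'' = act" "nats s' ''cp'' = cap"
      using arrays by (simp_all add: unchanged_nats[OF un])
    show "runs ?c s' (2 + (if k \<in> A then W else 0)) (\<lambda>s''. ?I (Suc k) (put ''a'' 0 (Suc k) s''))"
    proof (cases "mt k = 0")
      case True
      then have "?I (Suc k) s'" using k(2) by (auto simp: less_Suc_eq)
      then show ?thesis using True k(3) arrays' W_nonneg by (simp add: runs_wp)
    next
      case False
      then have kA: "k \<in> A" using valid k by (auto simp: valid_def)
      \<comment> \<open>Regrouped so that \<open>runs_find\<close> covers the first two
        programs.\<close>
      have find: "runs ((reset_search;; run_search);; ?i) s' (W - 3)
        (\<lambda>s''. ?I (Suc k) (put ''a'' 0 (Suc k) s''))"
      proof (rule runs_Seq[OF runs_find[OF env' k(3) kA valid arrays']])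
        fix s1 assume b: "0 < nats s1 ''b'' 0 \<longleftrightarrow> ?f k"
          and un1: "unchanged (reset_search;; run_search) s' s1"
        have s1: "nats s1 ''ev'' = nats s' ''ev''" "nats s1 ''mt'' = mt" "nats s1 ''a'' 0 = k"
          using arrays' k(3) by (simp_all add: unchanged_nats[OF un1])
        show "runs ?i s1 2 (\<lambda>s''. ?I (Suc k) (put ''a'' 0 (Suc k) s''))"
        proof (cases "?f k")
          case True
          then show ?thesis using b s1 k(2) False by (auto simp: runs_wp less_Suc_eq)
        next
          case F: False
          have "?I (Suc k) s'" using k(2) F by (auto simp: less_Suc_eq)
          then show ?thesis using F b s1 by (simp add: runs_wp)
        qed
      qed simp
      then have "runs (reset_search;; run_search;; ?i) s' (W - 3)
        (\<lambda>s''. ?I (Suc k) (put ''a'' 0 (Suc k) s''))" by (simp only: runs_Seq_assoc)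
      then have "runs (reset_search;; run_search;; ?i) s' (1 + W)
        (\<lambda>s''. ?I (Suc k) (put ''a'' 0 (Suc k) s''))" by (rule runs_mono) simp_all
      moreover have "bval (Less (Lit 0) (Get ''mt'' (V ''a''))) s'" using False arrays' k(3) by simp
      ultimately show ?thesis using kA unfolding runs_wp wp_If by simp
    qed
  qed (use ev W_nonneg sum_people in \<open>auto\<close>)
  then show ?thesis by (simp add: mark_alive_def alive_def)
qed

lemma runs_flag_items:
  assumes s: "env s" and arrays: "nats s ''mt'' = mt" "nats s ''cp'' = cap" and valid: "valid mt"
    and ev: "\<forall>x. 0 < nats s ''ev'' x \<longleftrightarrow> alive act mt cap x" and fl: "\<forall>x. nats s ''fl'' x \<le> 1"
  shows "runs flag_items s (6 + 10 * K + 7 * int n)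
    (\<lambda>s'. (\<forall>x. nats s' ''fl'' x \<le> 1) \<and> (\<forall>x\<in>T. nats s' ''fl'' x = 0 \<longleftrightarrow> x \<in> dead act mt cap))"
  unfolding flag_items_def
proof (rule runs_Seq[OF runs_reset_search[OF s arrays(1) valid]])
  fix s1 assume s1: "linked n mt (nats s1 ''ld'') (nats s1 ''hp'') (nats s1 ''nx'') \<and>
      (\<forall>x\<in>T. nats s1 ''vis'' x = 0)" and un: "unchanged reset_search s s1"
  have env1: "env s1" using env_unchanged[OF s un] by simp
  have arrays1: "nats s1 ''cp'' = cap" "nats s1 ''ev'' = nats s ''ev''" "nats s1 ''fl'' = nats s ''fl''"
    using arrays by (simp_all add: unchanged_nats[OF un])
  let ?c = "''x'' ::= Get ''tg'' (V ''e'');;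
       If (And (Not (Less (Get ''ld'' (V ''x'')) (Get ''cp'' (V ''x''))))
            (Not (Less (Lit 0) (Get ''ev'' (V ''x'')))))
         (Put ''fl'' (V ''x'') (Lit 0)) (Put ''fl'' (V ''x'') (Lit 1))"
  let ?l = "For ''e'' (Lit 0) (Get ''st'' (V ''people'')) ?c"
  let ?I = "\<lambda>k s'. (\<forall>x. nats s' ''fl'' x \<le> 1) \<and> (\<forall>e<k. nats s' ''fl'' (tg e) = 0 \<longleftrightarrow> tg e \<in> dead act mt cap)"
  have "runs ?l s1 (2 + 5 * K) (\<lambda>s'. ?I (st n) s')"
  proof (rule runs_For[where M = 0 and N = "st n" and I = ?I and w = "\<lambda>_. 3"])
    show "nval (Get ''st'' (V ''people'')) s' = st n" if "unchanged ?l s1 s'" for s'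
      using env_unchanged[OF env1 that] by (simp add: env_def)
    fix k s' assume k: "k < st n" "?I k s'" "nats s' ''e'' 0 = k" and un': "unchanged ?l s1 s'"
    have tg: "nats s' ''tg'' = tg" using env_unchanged[OF env1 un'] by (simp add: env_def)
    have arrays': "nats s' ''cp'' = cap" "nats s' ''ev'' = nats s ''ev''" "nats s' ''ld'' = nats s1 ''ld''"
      using arrays1 by (simp_all add: unchanged_nats[OF un'])
    have "tg k \<in> T" using k(1) by (simp add: T_def)
    moreover from this have "nats s1 ''ld'' (tg k) = load A (of_code \<circ> mt) (tg k)"
      using s1 linked_load valid by blast
    ultimately have d: "tg k \<in> dead act mt cap \<longleftrightarrow>
        \<not> nats s1 ''ld'' (tg k) < cap (tg k) \<and> \<not> 0 < nats s ''ev'' (tg k)"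
      using ev by (auto simp: dead_def)
    show "runs ?c s' 3 (\<lambda>s''. ?I (Suc k) (put ''e'' 0 (Suc k) s''))"
      using k(2,3) tg arrays' d by (auto simp: runs_wp less_Suc_eq)
  qed (use fl arrays1 in \<open>auto simp: K_def\<close>)
  then show "runs ?l s1 (2 + 5 * K)
    (\<lambda>s'. (\<forall>x. nats s' ''fl'' x \<le> 1) \<and> (\<forall>x\<in>T. nats s' ''fl'' x = 0 \<longleftrightarrow> x \<in> dead act mt cap))"
    by (rule runs_mono) (auto simp: T_def)
qed (simp add: K_def)

lemma runs_unmatch_all:
  assumes s: "env s"
  shows "runs unmatch_all s (2 + 3 * int n) (\<lambda>s'. \<forall>a<n. nats s' ''mt'' a = 0)"
  unfolding unmatch_all_def
proof (rule runs_For[where M = 0 and N = n and I = "\<lambda>k s'. \<forall>a<k. nats s' ''mt'' a = 0" and w = "\<lambda>_. 1"])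
  show "nval (V ''people'') s' = n"
    if "unchanged (For ''a'' (Lit 0) (V ''people'') (Put ''mt'' (V ''a'') (Lit 0))) s s'" for s'
    using s by (simp add: unchanged_nats[OF that] env_def)
qed (auto simp: runs_wp less_Suc_eq)

lemma runs_answer:
  assumes s: "env s" and mt: "nats s ''mt'' = mt"
  shows "runs answer s (3 + 5 * int n) (\<lambda>s'.
    nats s' ''popular'' 0 = (if \<exists>a\<in>A. mt a = 0 then 0 else 1) \<and> (\<forall>a<n. nats s' ''match'' a = mt a - 1))"
proof -
  let ?c = "If (And (Less (Get ''st'' (V ''a'')) (Get ''st'' (Inc (V ''a''))))
            (Not (Less (Lit 0) (Get ''mt'' (V ''a'')))))
        (''popular'' ::= Lit 0) Skip;;
       Put ''match'' (V ''a'') (Dec (Get ''mt'' (V ''a'')))"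
  let ?l = "For ''a'' (Lit 0) (V ''people'') ?c"
  let ?I = "\<lambda>k s'. nats s' ''popular'' 0 = (if \<exists>a<k. st a < st (Suc a) \<and> mt a = 0 then 0 else 1) \<and>
    (\<forall>a<k. nats s' ''match'' a = mt a - 1)"
  let ?s = "put ''popular'' 0 1 s"
  have "runs ?l ?s (2 + 5 * int n) (\<lambda>s'. ?I n s')"
  proof (rule runs_For[where M = 0 and N = n and I = ?I and w = "\<lambda>_. 3"])
    show "nval (V ''people'') s' = n" if "unchanged ?l ?s s'" for s'
      using s by (simp add: unchanged_nats[OF that] env_def)
    fix k s' assume k: "?I k s'" "nats s' ''a'' 0 = k" and un: "unchanged ?l ?s s'"
    have "nats s' ''st'' = st" "nats s' ''mt'' = mt"
      using s mt by (simp_all add: unchanged_nats[OF un] env_def)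
    then show "runs ?c s' 3 (\<lambda>s''. ?I (Suc k) (put ''a'' 0 (Suc k) s''))"
      using k by (auto simp: runs_wp less_Suc_eq)
  qed auto
  then have "runs ?l ?s (2 + 5 * int n) (\<lambda>s'.
    nats s' ''popular'' 0 = (if \<exists>a\<in>A. mt a = 0 then 0 else 1) \<and> (\<forall>a<n. nats s' ''match'' a = mt a - 1))"
    by (rule runs_mono) (auto simp: A_def)
  then show ?thesis by (simp add: answer_def runs_wp)
qed

end

context ranked_graph
begin

lemma runs_activate_edges:
  assumes s: "env s" and arrays: "nats s ''rk'' = rk" "nats s ''fl'' = fl"
    and D: "\<forall>x\<in>T. fl x = 0 \<longleftrightarrow> x \<in> D" "0 \<notin> D" and k: "nats s ''a'' 0 = k" "k \<in> A"
  shows "runs activate_edges s (5 + 6 * (int (st (Suc k)) - int (st k)))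
    (\<lambda>s'. \<forall>e. (st k \<le> e \<and> e < st (Suc k) \<longrightarrow> (0 < nats s' ''act'' e \<longleftrightarrow> tg e \<in> P.allowed D k)) \<and>
      (e < st k \<longrightarrow> nats s' ''act'' e = nats s ''act'' e))"
    (is "runs _ _ _ ?Q")
proof -
  define l where "l = st k"
  define h where "h = st (Suc k)"
  have kn: "k < n" and lh: "l < h" using k by (auto simp: A_def l_def h_def)
  have flag: "fl (tg e) = 0 \<longleftrightarrow> tg e \<in> D" if "e < h" for e
    using D(1) edge_T[OF kn] that by (simp add: h_def)
  \<comment> \<open>The sentinel: as the last resort is not in \<open>D\<close>, the search for an
    edge that leaves \<open>D\<close> stays within the list.\<close>
  have last: "tg (h - 1) \<notin> D" using last_edge[OF k(2)] D(2) by (simp add: h_def)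
  let ?s = "put ''e'' 0 l s"
  let ?w = "While (Not (Less (Lit 0) (Get ''fl'' (Get ''tg'' (V ''e''))))) (''e'' ::= Inc (V ''e''))"
  define R where "R = (\<lambda>s' :: state. let e0 = nats s' ''e'' 0 in
    l \<le> e0 \<and> e0 < h \<and> tg e0 \<notin> D \<and> (\<forall>e. l \<le> e \<and> e < e0 \<longrightarrow> tg e \<in> D))"
  have 1: "runs ?w ?s (1 + 2 * (int h - int l)) R"
    unfolding runs_wp
  proof (rule wp_While[where I = "\<lambda>s' m. let e = nats s' ''e'' 0 in
      l \<le> e \<and> e < h \<and> (\<forall>e'. l \<le> e' \<and> e' < e \<longrightarrow> tg e' \<in> D) \<and> 1 + 2 * (int h - int e) \<le> m"])
    fix s' m
    assume I: "let e = nats s' ''e'' 0 in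
      l \<le> e \<and> e < h \<and> (\<forall>e'. l \<le> e' \<and> e' < e \<longrightarrow> tg e' \<in> D) \<and> 1 + 2 * (int h - int e) \<le> m"
      and un: "unchanged (''e'' ::= Inc (V ''e'')) ?s s'"
    have fixed: "nats s' ''fl'' = fl" "nats s' ''tg'' = tg"
      using arrays s by (simp_all add: unchanged_nats[OF un] env_def)
    define e where "e = nats s' ''e'' 0"
    have e: "l \<le> e" "e < h" "\<forall>e'. l \<le> e' \<and> e' < e \<longrightarrow> tg e' \<in> D" "1 + 2 * (int h - int e) \<le> m"
      using I by (simp_all add: e_def Let_def)
    {
      assume "bval (Not (Less (Lit 0) (Get ''fl'' (Get ''tg'' (V ''e''))))) s'"
      then have "fl (tg e) = 0" using fixed by (simp add: e_def)
      then have eD: "tg e \<in> D" using flag[OF e(2)] by blast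
      then have "e \<noteq> h - 1" using last by blast
      then have "Suc e < h" using e(2) by simp
      then show "wp (''e'' ::= Inc (V ''e'')) (\<lambda>s' m. let e = nats s' ''e'' 0 in
        l \<le> e \<and> e < h \<and> (\<forall>e'. l \<le> e' \<and> e' < e \<longrightarrow> tg e' \<in> D) \<and> 1 + 2 * (int h - int e) \<le> m) s' (m - 1)"
        using e eD by (auto simp: e_def[symmetric] less_Suc_eq)
    next
      assume "\<not> bval (Not (Less (Lit 0) (Get ''fl'' (Get ''tg'' (V ''e''))))) s'"
      then have "fl (tg e) \<noteq> 0" using fixed by (simp add: e_def)
      then have "tg e \<notin> D" using flag[OF e(2)] by simp
      then show "R s' \<and> 0 \<le> m - 1" using e by (simp add: R_def e_def[symmetric])
    }
  qed (use lh in \<open>auto simp: Let_def\<close>)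
  let ?loop = "For ''e'' (Get ''st'' (V ''a'')) (Get ''st'' (Inc (V ''a''))) activate_edge"
  have 2: "runs (''r'' ::= Get ''rk'' (V ''e'');; ?loop) s1 (3 + 4 * (int h - int l)) ?Q"
    if R: "R s1" and un: "unchanged ?w ?s s1" for s1
  proof -
    define e0 where "e0 = nats s1 ''e'' 0"
    have e0: "st k \<le> e0" "e0 < st (Suc k)" "tg e0 \<notin> D" "\<And>e. st k \<le> e \<Longrightarrow> e < e0 \<Longrightarrow> tg e \<in> D"
      using R by (auto simp: R_def e0_def Let_def l_def h_def)
    note allowed = allowed_iff[OF k(2) e0]
    let ?s2 = "put ''r'' 0 (rk e0) s1"
    have fixed: "nats s1 ''fl'' = fl" "nats s1 ''tg'' = tg" "nats s1 ''st'' = st" "nats s1 ''rk'' = rk"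
        "nats s1 ''a'' 0 = k" "nats s1 ''act'' = nats s ''act''"
      using arrays s k by (simp_all add: unchanged_nats[OF un] env_def)
    let ?I = "\<lambda>j (s' :: state). \<forall>e. (l \<le> e \<and> e < j \<longrightarrow> (0 < nats s' ''act'' e \<longleftrightarrow> tg e \<in> P.allowed D k)) \<and>
      (e < l \<longrightarrow> nats s' ''act'' e = nats s ''act'' e)"
    have "runs ?loop ?s2 (2 + 4 * (int h - int l)) (\<lambda>s'. ?I h s')"
    proof (rule runs_For[where M = l and N = h and I = ?I and w = "\<lambda>_. 2"])
      fix s' assume un': "unchanged ?loop ?s2 s'"
      have fixed': "nats s' ''fl'' = fl" "nats s' ''tg'' = tg" "nats s' ''st'' = st" "nats s' ''rk'' = rk"
          "nats s' ''a'' 0 = k" "nats s' ''r'' 0 = rk e0"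
        using fixed by (simp_all add: unchanged_nats[OF un'])
      show "nval (Get ''st'' (Inc (V ''a''))) s' = h" using fixed' by (simp add: h_def)
      fix j assume j: "l \<le> j" "j < h" "?I j s'" "nats s' ''e'' 0 = j"
      have "tg j \<in> P.allowed D k \<longleftrightarrow>
          0 < fl (tg j) \<and> \<not> rk e0 < rk j \<or> \<not> 0 < fl (tg j) \<and> \<not> rk l < rk j \<and> rk j < rk e0"
        using allowed[of j] flag[OF j(2)] j(1,2) by (auto simp: l_def h_def not_less)
      then show "runs activate_edge s' 2
          (\<lambda>s''. ?I (Suc j) (put ''e'' 0 (Suc j) s''))"
        using j(3) fixed' j(1,4) by (auto simp: activate_edge_def runs_wp less_Suc_eq l_def[symmetric])
    qed (use fixed lh in \<open>auto simp: l_def[symmetric] of_nat_diff\<close>)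
    then show ?thesis
      using fixed by (simp add: runs_wp e0_def l_def h_def algebra_simps)
  qed
  have "runs (?w;; ''r'' ::= Get ''rk'' (V ''e'');; ?loop) ?s (4 + 6 * (int h - int l)) ?Q"
    by (rule runs_Seq[OF 1 2]) simp_all
  then show ?thesis
    using s k unfolding activate_edges_def runs_wp wp_Seq[of "''e'' ::= Get ''st'' (V ''a'')"] wp_Put
    by (simp add: env_def l_def h_def del: wp_Seq)
qed

lemma runs_set_active:
  assumes s: "env s" and arrays: "nats s ''rk'' = rk" "nats s ''fl'' = fl"
    and D: "\<forall>x\<in>T. fl x = 0 \<longleftrightarrow> x \<in> D" "0 \<notin> D"
  shows "runs set_active s (2 + 8 * int n + 6 * K)
    (\<lambda>s'. \<forall>a\<in>A. nb (nats s' ''act'') a = P.allowed D a)"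
proof -
  let ?c = "If (Less (Get ''st'' (V ''a'')) (Get ''st'' (Inc (V ''a'')))) activate_edges Skip"
  let ?l = "For ''a'' (Lit 0) (V ''people'') ?c"
  let ?I = "\<lambda>k (s' :: state). \<forall>a<k. \<forall>e. st a \<le> e \<and> e < st (Suc a) \<longrightarrow>
    (0 < nats s' ''act'' e \<longleftrightarrow> tg e \<in> P.allowed D a)"
  have "runs ?l s (2 + 8 * int n + 6 * K) (\<lambda>s'. ?I n s')"
  proof (rule runs_For[where M = 0 and N = n and I = ?I
        and w = "\<lambda>a. 6 + 6 * int (st (Suc a) - st a)"])
    show "nval (V ''people'') s' = n" if "unchanged ?l s s'" for s'
      using s by (simp add: unchanged_nats[OF that] env_def)
    fix k s' assume k: "k < n" "?I k s'" "nats s' ''a'' 0 = k" and un: "unchanged ?l s s'"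
    have env': "env s'" using env_unchanged[OF s un] by simp
    have arrays': "nats s' ''rk'' = rk" "nats s' ''fl'' = fl"
      using arrays by (simp_all add: unchanged_nats[OF un])
    have b: "bval (Less (Get ''st'' (V ''a'')) (Get ''st'' (Inc (V ''a'')))) s' \<longleftrightarrow> k \<in> A"
      using env' k by (simp add: env_def A_def)
    show "runs ?c s' (6 + 6 * int (st (Suc k) - st k)) (\<lambda>s''. ?I (Suc k) (put ''a'' 0 (Suc k) s''))"
    proof (cases "k \<in> A")
      case True
      have "runs activate_edges s' (5 + 6 * (int (st (Suc k)) - int (st k)))
        (\<lambda>s''. ?I (Suc k) (put ''a'' 0 (Suc k) s''))"
      proof (rule runs_mono[OF runs_activate_edges[OF env' arrays' D k(3) True]])
        fix s'' :: state assume s'': "\<forall>e. (st k \<le> e \<and> e < st (Suc k) \<longrightarrow>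
            (0 < nats s'' ''act'' e \<longleftrightarrow> tg e \<in> P.allowed D k)) \<and>
            (e < st k \<longrightarrow> nats s'' ''act'' e = nats s' ''act'' e)"
        have "e < st k" if "a < k" "e < st (Suc a)" for a e
          using that st_mono[of "Suc a" k] k(1) by simp
        then have "?I (Suc k) s''" using k(2) s'' by (auto simp: less_Suc_eq)
        then show "?I (Suc k) (put ''a'' 0 (Suc k) s'')" by simp
      qed simp
      then show ?thesis
        using True b st_Suc[OF k(1)] unfolding runs_wp wp_If by (simp add: of_nat_diff)
    next
      case False
      have "?I (Suc k) s'" using k False by (auto simp: less_Suc_eq A_def)
      then show ?thesis using False b unfolding runs_wp wp_If by simp
    qed
  next
    have "(\<Sum>a\<in>{0..<n}. 6 + 6 * int (st (Suc a) - st a) + 2)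
        = 8 * int n + 6 * (\<Sum>a<n. int (st (Suc a)) - int (st a))"
      using st_Suc by (simp add: sum.distrib sum_distrib_left atLeast0LessThan of_nat_diff)
    then show "2 + (\<Sum>a\<in>{0..<n}. 6 + 6 * int (st (Suc a) - st a) + 2) \<le> 2 + 8 * int n + 6 * K"
      by (simp only: sum_degrees K_def)
  qed auto
  then show ?thesis
    unfolding set_active_def
  proof (rule runs_mono)
    fix s' :: state assume I: "?I n s'"
    show "\<forall>a\<in>A. nb (nats s' ''act'') a = P.allowed D a"
    proof
      fix a assume a: "a \<in> A"
      then have *: "st a \<le> e \<Longrightarrow> e < st (Suc a) \<Longrightarrow> 0 < nats s' ''act'' e \<longleftrightarrow> tg e \<in> P.allowed D a" for e
        using I A_less by blast
      show "nb (nats s' ''act'') a = P.allowed D a"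
      proof
        show "nb (nats s' ''act'') a \<subseteq> P.allowed D a" using * by (auto simp: nb_def)
        show "P.allowed D a \<subseteq> nb (nats s' ''act'') a"
        proof
          fix x assume x: "x \<in> P.allowed D a"
          then have "x \<in> N a" using allowed_N by blast
          then obtain e where "x = tg e" "st a \<le> e" "e < st (Suc a)" by (auto simp: N_def)
          then show "x \<in> nb (nats s' ''act'') a" using * x by (auto simp: nb_def)
        qed
      qed
    qed
  qed simp
qed

lemma zero_not_top: "a \<in> A \<Longrightarrow> 0 \<notin> P.top a"
proof
  assume a: "a \<in> A" and "0 \<in> P.top a"
  then obtain e where e: "tg e = 0" "st a \<le> e" "e < st (Suc a)" "rk e = rk (st a)"
    by (auto simp: top_eq[OF a])
  have "e = st (Suc a) - 1"
    using inj_onD[OF inj_tg[OF A_less[OF a]], of e "st (Suc a) - 1"] e last_edge[OF a] by auto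
  then show False using last_worse[OF a] e(4) by simp
qed

text \<open>A dead item is full, but the last resort is nobody's top choice and hence has load 0 in
  the first phase. This is what makes it a sentinel in the second run of
  \<open>set_active\<close>.\<close>

lemma zero_not_dead:
  assumes "progress act cap fl ck n mt" "\<And>a. a \<in> A \<Longrightarrow> nb act a = P.top a"
  shows "0 \<notin> dead act mt cap"
proof
  assume 0: "0 \<in> dead act mt cap"
  then have "0 < load A (of_code \<circ> mt) 0" using cap_pos[of 0] by (auto simp: dead_def)
  then obtain a where "a \<in> A" "(of_code \<circ> mt) a = Some 0" by (auto simp: load_pos_iff[OF finite_A])
  then have "0 \<in> P.top a" using top_matching[OF assms] unfolding partial_matching_def by blast
  then show False using zero_not_top \<open>a \<in> A\<close> by blast
qed

lemma writes_solve [simp]: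
  "writes set_active = {''a'', ''e'', ''r'', ''act''}"
  "writes match_all = {''a'', ''b'', ''c'', ''e'', ''h'', ''hp'', ''ld'', ''mt'', ''nx'', ''p'', ''par'', ''q'', ''t'', ''vis'', ''x'', ''y''}"
  "writes mark_alive = {''a'', ''b'', ''c'', ''e'', ''ev'', ''h'', ''hp'', ''ld'', ''nx'', ''p'', ''par'', ''q'', ''t'', ''vis'', ''x''}"
  "writes flag_items = {''e'', ''fl'', ''hp'', ''ld'', ''nx'', ''p'', ''vis'', ''x''}"
  "writes unmatch_all = {''a'', ''mt''}"
  "rwrites set_active = {}" "rwrites match_all = {}" "rwrites mark_alive = {}"
  "rwrites flag_items = {}" "rwrites unmatch_all = {}"
  by (auto simp: set_active_def match_all_def mark_alive_def flag_items_def unmatch_all_def)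

definition solved :: "state \<Rightarrow> bool" where
  "solved s \<longleftrightarrow>
     (if \<exists>g. P.pop g
      then nats s ''popular'' 0 = 1 \<and>
        (\<exists>f. P.pop f \<and> (\<forall>g. P.pop g \<longrightarrow> (\<Sum>a\<in>A. ck (f a)) \<le> (\<Sum>a\<in>A. ck (g a))) \<and>
          (\<forall>a<n. nats s ''match'' a = (if a \<in> A then f a else 0)))
      else nats s ''popular'' 0 = 0)"

text \<open>Only three passes are not linear: the two matchings and the search for alive items cost
  \<open>card A * W\<close> each.\<close>

lemma runs_solve:
  assumes s: "env s" and arrays: "nats s ''rk'' = rk" "nats s ''cp'' = cap" "reals s ''ck'' = ck"
    and fl: "\<forall>x. nats s ''fl'' x \<le> 1" "\<forall>x\<in>T. nats s ''fl'' x = 1"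
    and mt: "\<forall>a<n. nats s ''mt'' a = 0" and ev: "\<forall>x. nats s ''ev'' x = 0"
  shows "runs solve s (25 + 43 * int n + 22 * K + 3 * int (card A) * W) solved"
proof -
  let ?M = "2 + 4 * int n + int (card A) * W" and ?S = "2 + 8 * int n + 6 * K"
  have D0: "\<forall>x\<in>T. nats s ''fl'' x = 0 \<longleftrightarrow> x \<in> {}" using fl by auto
  show ?thesis
    unfolding solve_def
  proof (rule runs_Seq[OF runs_set_active[OF s arrays(1) refl D0]])
    fix s1 assume "\<forall>a\<in>A. nb (nats s1 ''act'') a = P.allowed {} a" and un1: "unchanged set_active s s1"
    then have act1: "\<And>a. a \<in> A \<Longrightarrow> nb (nats s1 ''act'') a = P.top a" using allowed_empty by simp
    have env1: "env s1" using env_unchanged[OF s un1] by simp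
    note keep1 = unchanged_nats[OF un1] unchanged_reals[OF un1]
    show "runs (match_all;; mark_alive;; flag_items;; unmatch_all;; set_active;; match_all;; answer) s1
      (23 + 35 * int n + 16 * K + 3 * int (card A) * W) solved"
    proof (rule runs_Seq[OF runs_match_all[OF env1 refl]])
      show "nats s1 ''cp'' = cap" "reals s1 ''ck'' = ck" "\<forall>a<n. nats s1 ''mt'' a = 0"
        using arrays mt by (simp_all add: keep1)
      fix s2 assume p1: "progress (nats s1 ''act'') cap (nats s1 ''fl'') ck n (nats s2 ''mt'')"
        and un2: "unchanged match_all s1 s2"
      define act where "act = nats s1 ''act''"
      define mt1 where "mt1 = nats s2 ''mt''"
      note p1 = p1[folded act_def mt1_def] and act1 = act1[folded act_def]
      note keep2 = unchanged_nats[OF un2] unchanged_reals[OF un2] keep1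
      have env2: "env s2" using env_unchanged[OF env1 un2] by simp
      have valid: "valid mt1" using progress_valid[OF p1] .
      let ?D = "dead act mt1 cap"
      show "runs (mark_alive;; flag_items;; unmatch_all;; set_active;; match_all;; answer) s2
        (21 + 31 * int n + 16 * K + 2 * int (card A) * W) solved"
      proof (rule runs_Seq[OF runs_mark_alive[OF env2 mt1_def[symmetric] _ _ valid]])
        show "nats s2 ''act'' = act" "nats s2 ''cp'' = cap" "\<forall>x. nats s2 ''ev'' x = 0"
          using arrays ev by (simp_all add: keep2 act_def)
        fix s3 assume ev3: "\<forall>x. 0 < nats s3 ''ev'' x \<longleftrightarrow> alive act mt1 cap x"
          and un3: "unchanged mark_alive s2 s3"
        note keep3 = unchanged_nats[OF un3] unchanged_reals[OF un3] keep2
        have env3: "env s3" using env_unchanged[OF env2 un3] by simp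
        show "runs (flag_items;; unmatch_all;; set_active;; match_all;; answer) s3
          (19 + 27 * int n + 16 * K + int (card A) * W) solved"
        proof (rule runs_Seq[OF runs_flag_items[OF env3 _ _ valid ev3]])
          show "nats s3 ''mt'' = mt1" "nats s3 ''cp'' = cap" "\<forall>x. nats s3 ''fl'' x \<le> 1"
            using arrays fl(1) by (simp_all add: keep3 mt1_def)
          fix s4 assume fl4: "(\<forall>x. nats s4 ''fl'' x \<le> 1) \<and> (\<forall>x\<in>T. nats s4 ''fl'' x = 0 \<longleftrightarrow> x \<in> ?D)"
            and un4: "unchanged flag_items s3 s4"
          note keep4 = unchanged_nats[OF un4] unchanged_reals[OF un4] keep3
          have env4: "env s4" using env_unchanged[OF env3 un4] by simp
          show "runs (unmatch_all;; set_active;; match_all;; answer) s4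
            (13 + 20 * int n + 6 * K + int (card A) * W) solved"
          proof (rule runs_Seq[OF runs_unmatch_all[OF env4]])
            fix s5 assume mt5: "\<forall>a<n. nats s5 ''mt'' a = 0" and un5: "unchanged unmatch_all s4 s5"
            note keep5 = unchanged_nats[OF un5] unchanged_reals[OF un5] keep4
            have env5: "env s5" using env_unchanged[OF env4 un5] by simp
            show "runs (set_active;; match_all;; answer) s5
              (11 + 17 * int n + 6 * K + int (card A) * W) solved"
            proof (rule runs_Seq[OF runs_set_active[OF env5 _ refl, of ?D]])
              show "nats s5 ''rk'' = rk" "\<forall>x\<in>T. nats s5 ''fl'' x = 0 \<longleftrightarrow> x \<in> ?D" "0 \<notin> ?D"
                using arrays fl4 zero_not_dead[OF p1 act1] by (simp_all add: keep5)
              fix s6 assume act6: "\<forall>a\<in>A. nb (nats s6 ''act'') a = P.allowed ?D a"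
                and un6: "unchanged set_active s5 s6"
              note keep6 = unchanged_nats[OF un6] unchanged_reals[OF un6] keep5
              have env6: "env s6" using env_unchanged[OF env5 un6] by simp
              show "runs (match_all;; answer) s6 (9 + 9 * int n + int (card A) * W) solved"
              proof (rule runs_Seq[OF runs_match_all[OF env6 refl]])
                show "nats s6 ''cp'' = cap" "reals s6 ''ck'' = ck" "\<forall>a<n. nats s6 ''mt'' a = 0"
                  using arrays mt5 by (simp_all add: keep6)
                fix s7 assume p2: "progress (nats s6 ''act'') cap (nats s6 ''fl'') ck n (nats s7 ''mt'')"
                  and un7: "unchanged match_all s6 s7"
                have env7: "env s7" using env_unchanged[OF env6 un7] by simp
                define mt2 where "mt2 = nats s7 ''mt''"
                define fl2 where "fl2 = nats s6 ''fl''"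
                note p2 = p2[folded mt2_def fl2_def]
                have fl2: "fl2 x \<le> 1" "x \<in> T \<Longrightarrow> fl2 x = 0 \<longleftrightarrow> x \<in> ?D" for x
                  using fl4 by (simp_all add: fl2_def keep6)
                have act2: "\<And>a. a \<in> A \<Longrightarrow> nb (nats s6 ''act'') a = P.allowed ?D a" using act6 by blast
                have no: "\<not> P.pop g" if "a \<in> A" "mt2 a = 0" for a g
                  using no_pop_if_unmatched[OF p1 act1 p2 act2 fl2 that] by blast
                have out: "mt2 a = 0" if "a < n" "a \<notin> A" for a
                  using progress_valid[OF p2] that by (auto simp: valid_def)
                show "runs answer s7 (3 + 5 * int n) solved"
                proof (rule runs_mono[OF runs_answer[OF env7 mt2_def[symmetric]]])
                  fix s' :: state assume s': "nats s' ''popular'' 0 = (if \<exists>a\<in>A. mt2 a = 0 then 0 else 1) \<and>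
                    (\<forall>a<n. nats s' ''match'' a = mt2 a - 1)"
                  show "solved s'"
                  proof (cases "\<exists>a\<in>A. mt2 a = 0")
                    case True
                    then show ?thesis using no s' by (auto simp: solved_def)
                  next
                    case False
                    then have complete: "mt2 a \<noteq> 0" if "a \<in> A" for a using that by simp
                    note pop = pop_result[OF p1 act1 p2 act2 fl2 complete]
                    note best = result_cheapest[OF p1 act1 p2 act2 fl2 complete]
                    have "nats s' ''match'' a = (if a \<in> A then result mt2 a else 0)" if "a < n" for a
                      using s' that out result_def[OF p1 act1 p2 act2 fl2 complete] by simp
                    then show ?thesis using pop best s' False unfolding solved_def by auto
                  qed
                qed simp
              qed simp_all
            qed simp
          qed simp
        qed simp
      qed simp_all
    qed simp_all
  qed simp_all
qed

end

section \<open>From instances to graphs\<close>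

locale preference_lists =
  fixes G :: pref_instance and pl :: "nat \<Rightarrow> nat list"
  assumes wf: "wf_instance G" and pl: "a < n_people G \<Longrightarrow> pref_list G a (pl a)"
begin

lemma set_pl: "a < n_people G \<Longrightarrow> set (pl a) = {b. (a, b) \<in> edges G}"
  using pl by (simp add: pref_list_def)

lemma edges_iff: "(a, b) \<in> edges G \<longleftrightarrow> a < n_people G \<and> b \<in> set (pl a)"
  using wf set_pl by (auto simp: wf_instance_def)

lemma item_less: "a < n_people G \<Longrightarrow> b \<in> set (pl a) \<Longrightarrow> b < n_items G"
  using wf set_pl by (auto simp: wf_instance_def)

lemma card_edges: "card (edges G) = (\<Sum>a<n_people G. length (pl a))"
proof -
  have "edges G = Sigma {..<n_people G} (\<lambda>a. set (pl a))" using edges_iff by auto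
  then have "card (edges G) = (\<Sum>a<n_people G. card (set (pl a)))" by simp
  also have "\<dots> = (\<Sum>a<n_people G. length (pl a))"
    using pl by (intro sum.cong refl distinct_card) (simp add: pref_list_def)
  finally show ?thesis .
qed

end

text \<open>The graph contains the items shifted by 1; item 0 is a last resort with room for everybody,
  appended to every nonempty preference list.\<close>

locale coded_instance = preference_lists G pl + ranked_graph "n_people G" st tg rk cap ck
  for G pl st tg rk cap ck +
  assumes A_iff: "a \<in> A \<longleftrightarrow> a < n_people G \<and> pl a \<noteq> []"
    and N_eq: "a \<in> A \<Longrightarrow> N a = insert 0 (Suc ` set (pl a))"
    and r_Suc: "a \<in> A \<Longrightarrow> b \<in> set (pl a) \<Longrightarrow> r a (Suc b) = rank G a b"
    and r_0: "a \<in> A \<Longrightarrow> b \<in> set (pl a) \<Longrightarrow> rank G a b < r a 0"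
    and cap_Suc: "a \<in> A \<Longrightarrow> b \<in> set (pl a) \<Longrightarrow> cap (Suc b) = copies G b"
    and ck_Suc: "a \<in> A \<Longrightarrow> b \<in> set (pl a) \<Longrightarrow> ck (Suc b) = cost G b"
    and ck_0: "ck 0 = 0"
begin

definition code :: "(nat \<Rightarrow> nat option) \<Rightarrow> nat \<Rightarrow> nat" where
  "code M a = (case M a of None \<Rightarrow> 0 | Some b \<Rightarrow> Suc b)"

text \<open>The restriction to \<open>A\<close> discards the values of \<open>f\<close> elsewhere,
  which assignments leave arbitrary.\<close>

definition decode :: "(nat \<Rightarrow> nat) \<Rightarrow> nat \<Rightarrow> nat option" where
  "decode f a = (if a \<in> A \<and> f a \<noteq> 0 then Some (f a - 1) else None)"

lemma A_if_item: "a < n_people G \<Longrightarrow> b \<in> set (pl a) \<Longrightarrow> a \<in> A"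
  by (auto simp: A_iff)

lemma matching_edge: "matching G M \<Longrightarrow> M a = Some b \<Longrightarrow> a \<in> A \<and> b \<in> set (pl a)"
  unfolding matching_def edges_iff using A_if_item by blast

lemma load_code:
  assumes "matching G M"
  shows "load A (Some \<circ> code M) (Suc b) = card (assigned G M b)"
proof -
  have "{a \<in> A. (Some \<circ> code M) a = Some (Suc b)} = assigned G M b"
    using matching_edge[OF assms] A_less by (auto simp: code_def assigned_def split: option.splits)
  then show ?thesis by (simp add: load_def)
qed

lemma assignment_code:
  assumes M: "matching G M"
  shows "P.assignment (code M)"
  unfolding P.assignment_def
proof (intro conjI ballI allI)
  fix a assume "a \<in> A"
  then show "code M a \<in> N a"
    using matching_edge[OF M] by (auto simp: code_def N_eq split: option.splits)
next
  fix x
  show "load A (Some \<circ> code M) x \<le> cap x"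
  proof (cases x)
    case 0
    have "load A (Some \<circ> code M) x \<le> card A"
      unfolding load_def using finite_A by (intro card_mono) auto
    then show ?thesis using P.capL 0 by simp
  next
    case (Suc b)
    show ?thesis
    proof (cases "assigned G M b = {}")
      case True
      then show ?thesis using load_code[OF M] Suc by simp
    next
      case False
      then obtain a where "M a = Some b" by (auto simp: assigned_def)
      then have *: "a \<in> A" "b \<in> set (pl a)" using matching_edge[OF M] by auto
      then have "b < n_items G" using item_less A_less by blast
      then have "card (assigned G M b) \<le> copies G b" using M by (auto simp: matching_def)
      then show ?thesis using load_code[OF M] cap_Suc[OF *] Suc by simp
    qed
  qed
qed

lemma code_decode: "a \<in> A \<Longrightarrow> code (decode f) a = f a"
  by (auto simp: code_def decode_def)

lemma matching_decode:
  assumes f: "P.assignment f"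
  shows "matching G (decode f)"
  unfolding matching_def
proof (intro conjI allI impI ballI)
  fix a b assume "decode f a = Some b"
  then have *: "a \<in> A" "f a = Suc b" by (auto simp: decode_def split: if_splits)
  then have "Suc b \<in> N a" using f by (auto simp: P.assignment_def)
  then show "(a, b) \<in> edges G" using * by (auto simp: N_eq edges_iff A_iff)
next
  fix b assume "b \<in> items G"
  have assigned: "assigned G (decode f) b = {a \<in> A. (Some \<circ> f) a = Some (Suc b)}"
    using A_less by (auto simp: assigned_def decode_def split: if_splits)
  show "card (assigned G (decode f) b) \<le> copies G b"
  proof (cases "assigned G (decode f) b = {}")
    case False
    then obtain a where a: "a \<in> A" "f a = Suc b" unfolding assigned by auto
    then have "Suc b \<in> N a" using f by (auto simp: P.assignment_def)
    then have "b \<in> set (pl a)" using a by (auto simp: N_eq)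
    moreover have "card (assigned G (decode f) b) \<le> cap (Suc b)"
      using f unfolding assigned P.assignment_def load_def by blast
    ultimately show ?thesis using cap_Suc[OF a(1)] by simp
  qed simp
qed

lemma prefers_code:
  assumes "matching G M" "matching G M'"
  shows "{a \<in> people G. prefers G a M M'} = P.votes (code M) (code M')"
proof (rule set_eqI)
  fix a
  show "a \<in> {a \<in> people G. prefers G a M M'} \<longleftrightarrow> a \<in> P.votes (code M) (code M')"
  proof (cases "a \<in> A")
    case True
    then show ?thesis
      using matching_edge[OF assms(1), of a] matching_edge[OF assms(2), of a]
        r_Suc[OF True] r_0[OF True] A_less[OF True]
      by (cases "M a"; cases "M' a")
        (fastforce simp: P.votes_def prefers_def code_def dest: less_asym)+
  next
    case False
    then have "M a = None" using matching_edge[OF assms(1)] by (cases "M a") auto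
    then show ?thesis using False by (simp add: P.votes_def prefers_def)
  qed
qed

lemma more_popular_code:
  assumes "matching G M" "matching G M'"
  shows "more_popular G M M' \<longleftrightarrow>
    card (P.votes (code M') (code M)) < card (P.votes (code M) (code M'))"
  using prefers_code[OF assms] prefers_code[OF assms(2,1)] by (simp add: more_popular_def)

lemma votes_cong:
  "(\<And>a. a \<in> A \<Longrightarrow> f a = f' a) \<Longrightarrow> (\<And>a. a \<in> A \<Longrightarrow> g a = g' a) \<Longrightarrow> P.votes f g = P.votes f' g'"
  by (auto simp: P.votes_def)

lemma assignment_cong:
  assumes "\<And>a. a \<in> A \<Longrightarrow> f a = f' a"
  shows "P.assignment f \<longleftrightarrow> P.assignment f'"
  using load_cong[of A "Some \<circ> f" "Some \<circ> f'"] assms by (simp add: P.assignment_def)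

text \<open>Being unmatched and being at the last resort compare alike with every item, so the votes
  agree. Competing assignments are decoded and coded again, which changes them at most outside
  \<open>A\<close>, where nobody votes.\<close>

lemma popular_code: "popular G M \<longleftrightarrow> matching G M \<and> P.pop (code M)"
proof (intro iffI conjI)
  assume pop: "popular G M"
  then show M: "matching G M" by (simp add: popular_def)
  show "P.pop (code M)"
    unfolding P.pop_def
  proof (intro conjI allI impI)
    show "P.assignment (code M)" by (rule assignment_code[OF M])
    fix g assume "P.assignment g"
    then have g: "matching G (decode g)" by (rule matching_decode)
    then have "\<not> more_popular G (decode g) M" using pop by (auto simp: popular_def)
    moreover have "P.votes g (code M) = P.votes (code (decode g)) (code M)"
      "P.votes (code M) g = P.votes (code M) (code (decode g))"
      by (auto intro!: votes_cong simp: code_decode)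
    ultimately show "card (P.votes g (code M)) \<le> card (P.votes (code M) g)"
      using more_popular_code[OF g M] by simp
  qed
next
  assume M: "matching G M \<and> P.pop (code M)"
  then have "\<not> more_popular G M' M" if "matching G M'" for M'
    using more_popular_code[OF that, of M] assignment_code[OF that] by (auto simp: P.pop_def not_less)
  then show "popular G M" using M by (auto simp: popular_def)
qed

lemma pop_cong:
  assumes "\<And>a. a \<in> A \<Longrightarrow> f a = f' a"
  shows "P.pop f \<longleftrightarrow> P.pop f'"
  using assignment_cong[OF assms] votes_cong[of f f'] votes_cong[of _ _ f f'] assms
  by (simp add: P.pop_def)

lemma popular_decode:
  assumes "P.pop f"
  shows "popular G (decode f)"
proof -
  have "P.pop (code (decode f))" using assms pop_cong[of "code (decode f)" f] code_decode by simp
  moreover have "matching G (decode f)" using assms matching_decode by (simp add: P.pop_def)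
  ultimately show ?thesis by (simp add: popular_code)
qed

text \<open>People at the last resort pay nothing, as \<open>ck 0 = 0\<close>; the others are
  grouped by their items.\<close>

lemma cost_code:
  assumes M: "matching G M"
  shows "matching_cost G M = (\<Sum>a\<in>A. ck (code M a))"
proof -
  let ?B = "{a \<in> A. M a \<noteq> None}"
  have "(\<Sum>a\<in>A. ck (code M a)) = (\<Sum>a\<in>?B. ck (code M a))"
    using finite_A ck_0 by (intro sum.mono_neutral_right) (auto simp: code_def)
  also have "\<dots> = (\<Sum>a\<in>?B. cost G (the (M a)))"
  proof (rule sum.cong[OF refl])
    fix a assume "a \<in> ?B"
    then obtain b where "M a = Some b" by auto
    then show "ck (code M a) = cost G (the (M a))"
      using matching_edge[OF M, of a b] ck_Suc[of a b] by (simp add: code_def)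
  qed
  also have "\<dots> = (\<Sum>b\<in>items G. \<Sum>a | a \<in> ?B \<and> the (M a) = b. cost G (the (M a)))"
    using finite_A matching_edge[OF M] item_less A_less
    by (intro sum.group[symmetric]) fastforce+
  also have "\<dots> = (\<Sum>b\<in>items G. real (card (assigned G M b)) * cost G b)"
  proof (rule sum.cong[OF refl])
    fix b
    have "{a. a \<in> ?B \<and> the (M a) = b} = assigned G M b"
      using matching_edge[OF M] A_less by (auto simp: assigned_def)
    moreover have "(\<Sum>a | a \<in> ?B \<and> the (M a) = b. cost G (the (M a))) =
        (\<Sum>a | a \<in> ?B \<and> the (M a) = b. cost G b)" by (rule sum.cong) auto
    ultimately show "(\<Sum>a | a \<in> ?B \<and> the (M a) = b. cost G (the (M a))) =
        real (card (assigned G M b)) * cost G b" by simp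
  qed
  finally show ?thesis by (simp add: matching_cost_def)
qed

lemma correct_if_solved:
  assumes "solved s"
  shows "correct_output G s"
proof (cases "\<exists>g. P.pop g")
  case True
  then obtain f where pop1: "nats s ''popular'' 0 = 1" and f: "P.pop f"
    and best: "\<And>g. P.pop g \<Longrightarrow> (\<Sum>a\<in>A. ck (f a)) \<le> (\<Sum>a\<in>A. ck (g a))"
    and out: "\<forall>a<n_people G. nats s ''match'' a = (if a \<in> A then f a else 0)"
    using assms by (auto simp: solved_def)
  have out': "output_matching G s = decode f"
  proof
    show "output_matching G s a = decode f a" for a
      using out A_less[of a] by (cases "a \<in> A") (auto simp: output_matching_def decode_def)
  qed
  have "matching_cost G (decode f) \<le> matching_cost G M'" if "popular G M'" for M'
  proof -
    have M': "matching G M'" "P.pop (code M')" using that popular_code by auto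
    have "(\<Sum>a\<in>A. ck (code (decode f) a)) = (\<Sum>a\<in>A. ck (f a))" by (simp add: code_decode)
    then show ?thesis
      using best[OF M'(2)] cost_code[OF M'(1)] cost_code[of "decode f"] popular_decode[OF f] popular_code
      by simp
  qed
  then have "min_cost_popular G (output_matching G s)"
    using popular_decode[OF f] out' by (simp add: min_cost_popular_def)
  then show ?thesis using pop1 unfolding correct_output_def min_cost_popular_def by auto
next
  case False
  then have "\<not> popular G M" for M using popular_code by blast
  then show ?thesis using assms False by (simp add: solved_def correct_output_def)
qed

end

section \<open>Reading the input\<close>

definition copy_edge :: com where
  "copy_edge =
    (''x'' ::= Inc (Get ''item'' (V ''e''));;
     Put ''tg'' (V ''k'') (V ''x'');;
     Put ''rk'' (V ''k'') (Get ''rank'' (V ''e''));;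
     Put ''cp'' (V ''x'') (Get ''copies'' (Get ''item'' (V ''e'')));;
     RPut ''ck'' (V ''x'') (RGet ''cost'' (Get ''item'' (V ''e'')));;
     Put ''fl'' (V ''x'') (Lit 1);;
     ''k'' ::= Inc (V ''k''))"

text \<open>The last resort is appended with a rank one worse than that of the last item in the
  list.\<close>

definition copy_person :: com where
  "copy_person =
    (Put ''st'' (V ''a'') (V ''k'');;
     If (Less (V ''e'') (Get ''first'' (Inc (V ''a''))))
       (For ''e'' (V ''e'') (Get ''first'' (Inc (V ''a''))) copy_edge;;
        Put ''rk'' (V ''k'') (Inc (Get ''rk'' (Dec (V ''k''))));;
        Put ''tg'' (V ''k'') (Lit 0);;
        ''k'' ::= Inc (V ''k''))
       Skip)"

definition build_graph :: com where
  "build_graph =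
    (''e'' ::= Lit 0;; ''k'' ::= Lit 0;; ''fl'' ::= Lit 1;; ''cp'' ::= V ''people'';;
     For ''a'' (Lit 0) (V ''people'') copy_person;;
     Put ''st'' (V ''people'') (V ''k''))"

text \<open>Isolated items do not occur in the graph, so they cost no time; without edges the empty
  matching is the only one.\<close>

definition algorithm :: com where
  "algorithm =
    If (Less (Lit 0) (Get ''first'' (V ''people''))) (build_graph;; solve) (''popular'' ::= Lit 1)"

lemma writes_build [simp]:
  "writes copy_edge = {''x'', ''tg'', ''rk'', ''cp'', ''fl'', ''k''}" "rwrites copy_edge = {''ck''}"
  "writes copy_person = {''e'', ''st'', ''x'', ''tg'', ''rk'', ''cp'', ''fl'', ''k''}"
  "rwrites copy_person = {''ck''}"
  "writes build_graph = {''a'', ''e'', ''st'', ''x'', ''tg'', ''rk'', ''cp'', ''fl'', ''k''}"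
  by (auto simp: copy_edge_def copy_person_def build_graph_def)

lemma length_concat_map: "length (concat (map f [0..<k])) = (\<Sum>a<k. length (f a))"
  by (induction k) auto

lemma nth_concat_map:
  assumes "a < k" "i < length (f a)"
  shows "concat (map f [0..<k]) ! ((\<Sum>b<a. length (f b)) + i) = f a ! i"
    and "(\<Sum>b<a. length (f b)) + i < (\<Sum>b<k. length (f b))"
  using assms
proof (induction k)
  case (Suc k)
  {
    case 1
    then show ?case
      using Suc.IH by (cases "a = k") (auto simp: nth_append length_concat_map less_Suc_eq)
  next
    case 2
    then show ?case using Suc.IH by (cases "a = k") (auto simp: less_Suc_eq)
  }
qed auto

context preference_lists
begin

abbreviation n :: nat where
  "n \<equiv> n_people G"

definition ext :: "nat \<Rightarrow> nat list" where
  "ext a = (if pl a = [] then [] else map Suc (pl a) @ [0])"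

definition ext_rank :: "nat \<Rightarrow> nat list" where
  "ext_rank a = (if pl a = [] then [] else map (rank G a) (pl a) @ [Suc (rank G a (last (pl a)))])"

definition start :: "nat \<Rightarrow> nat" where
  "start k = (\<Sum>a<k. length (pl a))"

definition ext_start :: "nat \<Rightarrow> nat" where
  "ext_start k = (\<Sum>a<k. length (ext a))"

definition target :: "nat \<Rightarrow> nat" where
  "target j = concat (map ext [0..<n]) ! j"

definition target_rank :: "nat \<Rightarrow> nat" where
  "target_rank j = concat (map ext_rank [0..<n]) ! j"

lemma length_ext: "length (ext a) = (if pl a = [] then 0 else Suc (length (pl a)))"
  and length_ext_rank: "length (ext_rank a) = length (ext a)"
  by (simp_all add: ext_def ext_rank_def)

lemma start_simps [simp]: "start 0 = 0" "start (Suc k) = start k + length (pl k)"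
  and ext_start_simps [simp]: "ext_start 0 = 0" "ext_start (Suc k) = ext_start k + length (ext k)"
  by (simp_all add: start_def ext_start_def)

lemma target_nth: "a < n \<Longrightarrow> i < length (ext a) \<Longrightarrow> target (ext_start a + i) = ext a ! i"
  unfolding target_def ext_start_def by (rule nth_concat_map)

lemma target_rank_nth:
  assumes "a < n" "i < length (ext a)"
  shows "target_rank (ext_start a + i) = ext_rank a ! i"
  using nth_concat_map(1)[of a n i ext_rank] assms
  unfolding target_rank_def ext_start_def by (simp add: length_ext_rank)

lemma target_item:
  assumes "a < n" "i < length (pl a)"
  shows "target (ext_start a + i) = Suc (pl a ! i)" "target_rank (ext_start a + i) = rank G a (pl a ! i)"
proof -
  have "i < length (ext a)" using assms(2) by (auto simp: length_ext)
  then show "target (ext_start a + i) = Suc (pl a ! i)"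
    "target_rank (ext_start a + i) = rank G a (pl a ! i)"
    using assms target_nth[of a i] target_rank_nth[of a i]
    by (auto simp: ext_def ext_rank_def nth_append)
qed

lemma target_last:
  assumes "a < n" "pl a \<noteq> []"
  shows "target (ext_start a + length (pl a)) = 0"
    "target_rank (ext_start a + length (pl a)) = Suc (target_rank (ext_start a + length (pl a) - 1))"
proof -
  have len: "length (pl a) < length (ext a)" using assms by (simp add: length_ext)
  show "target (ext_start a + length (pl a)) = 0"
    using target_nth[OF assms(1) len] assms by (simp add: ext_def nth_append)
  have "target_rank (ext_start a + (length (pl a) - 1)) = rank G a (last (pl a))"
    using target_item(2)[of a "length (pl a) - 1"] assms by (simp add: last_conv_nth)
  moreover have "ext_start a + (length (pl a) - 1) = ext_start a + length (pl a) - 1"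
    using assms by (cases "pl a") auto
  ultimately show "target_rank (ext_start a + length (pl a)) =
      Suc (target_rank (ext_start a + length (pl a) - 1))"
    using target_rank_nth[OF assms(1) len] assms by (simp add: ext_rank_def nth_append)
qed

lemma input_people: "nats (input_state G pl) ''people'' 0 = n"
  by (simp add: input_state_def cells_def)

lemma input_first: "k \<le> n \<Longrightarrow> nats (input_state G pl) ''first'' k = start k"
  by (simp add: input_state_def cells_def start_def del: upt_Suc)

lemma input_list:
  assumes a: "a < n" "i < length (pl a)"
  shows "nats (input_state G pl) ''item'' (start a + i) = pl a ! i"
    and "nats (input_state G pl) ''rank'' (start a + i) = rank G a (pl a ! i)"
    and "nats (input_state G pl) ''copies'' (pl a ! i) = copies G (pl a ! i)"
    and "reals (input_state G pl) ''cost'' (pl a ! i) = cost G (pl a ! i)"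
proof -
  show "nats (input_state G pl) ''item'' (start a + i) = pl a ! i"
    using nth_concat_map[of a n i pl] a
    by (simp add: input_state_def cells_def start_def length_concat_map)
  show "nats (input_state G pl) ''rank'' (start a + i) = rank G a (pl a ! i)"
    using nth_concat_map[of a n i "\<lambda>a. map (rank G a) (pl a)"] a
    by (simp add: input_state_def cells_def start_def length_concat_map)
  have "pl a ! i < n_items G" using item_less[OF a(1)] a(2) by simp
  then show "nats (input_state G pl) ''copies'' (pl a ! i) = copies G (pl a ! i)"
    "reals (input_state G pl) ''cost'' (pl a ! i) = cost G (pl a ! i)"
    by (simp_all add: input_state_def cells_def)
qed

lemma input_zero:
  "x \<notin> {''people'', ''items'', ''first'', ''item'', ''rank'', ''copies''} \<Longrightarrow>
   nats (input_state G pl) x i = 0"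
  "x \<noteq> ''cost'' \<Longrightarrow> reals (input_state G pl) x i = 0"
  by (simp_all add: input_state_def)

text \<open>An item may occur in many lists. Its flag 1 doubles as the record that its capacity and
  price have been copied.\<close>

definition copied :: "nat \<Rightarrow> state \<Rightarrow> bool" where
  "copied m s \<longleftrightarrow>
     (\<forall>j<m. nats s ''tg'' j = target j \<and> nats s ''rk'' j = target_rank j \<and> nats s ''fl'' (target j) = 1) \<and>
     (\<forall>x. nats s ''fl'' x \<le> 1) \<and>
     (\<forall>b. nats s ''fl'' (Suc b) = 1 \<longrightarrow>
        nats s ''cp'' (Suc b) = copies G b \<and> reals s ''ck'' (Suc b) = cost G b) \<and>
     nats s ''fl'' 0 = 1 \<and> nats s ''cp'' 0 = n \<and> reals s ''ck'' 0 = 0"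

lemma runs_copy_edges:
  assumes a: "a < n" "nats s ''a'' 0 = a" and s: "copied (ext_start a) s" "nats s ''k'' 0 = ext_start a"
      "nats s ''e'' 0 = start a"
    and input: "\<And>x. x \<in> {''first'', ''item'', ''rank'', ''copies''} \<Longrightarrow> nats s x = nats (input_state G pl) x"
      "reals s ''cost'' = reals (input_state G pl) ''cost''"
  shows "runs (For ''e'' (V ''e'') (Get ''first'' (Inc (V ''a''))) copy_edge) s (2 + 9 * int (length (pl a)))
    (\<lambda>s'. copied (ext_start a + length (pl a)) s' \<and> nats s' ''k'' 0 = ext_start a + length (pl a) \<and>
      nats s' ''e'' 0 = start (Suc a))"
proof -
  let ?l = "For ''e'' (V ''e'') (Get ''first'' (Inc (V ''a''))) copy_edge"
  let ?I = "\<lambda>j s'. copied (ext_start a + (j - start a)) s' \<and>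
    nats s' ''k'' 0 = ext_start a + (j - start a) \<and> nats s' ''e'' 0 = j"
  have "runs ?l s (2 + 9 * int (length (pl a))) (\<lambda>s'. ?I (start (Suc a)) s')"
  proof (rule runs_For[where M = "start a" and N = "start (Suc a)" and I = ?I and w = "\<lambda>_. 7"])
    fix s' assume un: "unchanged ?l s s'"
    have input': "nats s' ''first'' = nats (input_state G pl) ''first''"
      "nats s' ''item'' = nats (input_state G pl) ''item''"
      "nats s' ''rank'' = nats (input_state G pl) ''rank''"
      "nats s' ''copies'' = nats (input_state G pl) ''copies''"
      "reals s' ''cost'' = reals (input_state G pl) ''cost''" "nats s' ''a'' 0 = a"
      using input a by (simp_all add: unchanged_nats[OF un] unchanged_reals[OF un])
    show "nval (Get ''first'' (Inc (V ''a''))) s' = start (Suc a)"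
      using input' input_first[of "Suc a"] a by simp
    fix j assume j: "start a \<le> j" "j < start (Suc a)" and I: "?I j s'"
    define i where "i = j - start a"
    have i: "i < length (pl a)" "j = start a + i" using j by (auto simp: i_def)
    define m where "m = ext_start a + i"
    have m: "target m = Suc (pl a ! i)" "target_rank m = rank G a (pl a ! i)"
      using target_item[OF a(1) i(1)] by (simp_all add: m_def)
    have I': "copied m s'" "nats s' ''k'' 0 = m" "nats s' ''e'' 0 = start a + i"
      using I i(2) by (simp_all add: m_def)
    show "runs copy_edge s' 7 (\<lambda>s''. ?I (Suc j) (put ''e'' 0 (Suc j) s''))"
      using I' m input_list[OF a(1) i(1)] i(2)
      by (auto simp: copy_edge_def runs_wp input' copied_def less_Suc_eq m_def[symmetric] Suc_diff_le)
  qed (use s in \<open>auto simp: copied_def\<close>)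
  then show ?thesis by (rule runs_mono) simp_all
qed

lemma runs_copy_person:
  assumes a: "a < n" "nats s ''a'' 0 = a" and s: "copied (ext_start a) s" "nats s ''k'' 0 = ext_start a"
      "nats s ''e'' 0 = start a" "\<forall>b<a. nats s ''st'' b = ext_start b"
    and input: "\<And>x. x \<in> {''first'', ''item'', ''rank'', ''copies''} \<Longrightarrow> nats s x = nats (input_state G pl) x"
      "reals s ''cost'' = reals (input_state G pl) ''cost''"
  shows "runs copy_person s (7 + 9 * int (length (pl a)))
    (\<lambda>s'. copied (ext_start (Suc a)) s' \<and> nats s' ''k'' 0 = ext_start (Suc a) \<and>
      nats s' ''e'' 0 = start (Suc a) \<and> (\<forall>b<Suc a. nats s' ''st'' b = ext_start b))"
    (is "runs _ _ _ ?Q")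
proof -
  let ?l = "For ''e'' (V ''e'') (Get ''first'' (Inc (V ''a''))) copy_edge"
  let ?r = "Put ''rk'' (V ''k'') (Inc (Get ''rk'' (Dec (V ''k''))));; Put ''tg'' (V ''k'') (Lit 0);;
    ''k'' ::= Inc (V ''k'')"
  let ?b = "Less (V ''e'') (Get ''first'' (Inc (V ''a'')))"
  let ?s = "put ''st'' a (ext_start a) s"
  have s': "copied (ext_start a) ?s" using s(1) by (simp add: copied_def)
  have b: "bval ?b ?s \<longleftrightarrow> pl a \<noteq> []"
    using a s input input_first[of "Suc a"] by simp
  have st: "\<forall>b<Suc a. nats ?s ''st'' b = ext_start b" using s(4) by (auto simp: less_Suc_eq)
  have "runs (If ?b (?l;; ?r) Skip) ?s (6 + 9 * int (length (pl a))) ?Q"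
  proof (cases "pl a = []")
    case True
    then have len: "length (ext a) = 0" by (simp add: length_ext)
    have "?Q ?s" using True s s' st len by simp
    then show ?thesis using b True by (simp add: runs_wp del: bval.simps)
  next
    case False
    let ?m = "ext_start a + length (pl a)"
    have "runs (?l;; ?r) ?s (5 + 9 * int (length (pl a))) ?Q"
    proof (rule runs_Seq[OF runs_copy_edges[OF a(1) _ s']])
      fix s1 assume s1: "copied ?m s1 \<and> nats s1 ''k'' 0 = ?m \<and> nats s1 ''e'' 0 = start (Suc a)"
        and un: "unchanged ?l ?s s1"
      have st1: "\<forall>b<Suc a. nats s1 ''st'' b = ext_start b"
        using st by (simp add: unchanged_nats[OF un])
      have len: "length (ext a) = Suc (length (pl a))" using False by (simp add: length_ext)
      have "?m - 1 < ?m" using False by (cases "pl a") auto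
      then have prev: "nats s1 ''rk'' (?m - 1) = target_rank (?m - 1)"
        using s1 by (simp add: copied_def)
      note last = target_last[OF a(1) False]
      show "runs ?r s1 3 ?Q"
        using s1 st1 prev last by (auto simp: runs_wp copied_def len less_Suc_eq)
    qed (use a s input in auto)
    then show ?thesis using b False unfolding runs_wp wp_If by simp
  qed
  then show ?thesis using a s by (simp add: copy_person_def runs_wp)
qed

lemma runs_build_graph:
  "runs build_graph (input_state G pl) (7 + 9 * int n + 9 * int (start n))
    (\<lambda>s'. copied (ext_start n) s' \<and> (\<forall>a\<le>n. nats s' ''st'' a = ext_start a))"
    (is "runs _ ?input _ ?Q")
proof -
  let ?l = "For ''a'' (Lit 0) (V ''people'') copy_person"
  let ?s = "put ''cp'' 0 n (put ''fl'' 0 1 (put ''k'' 0 0 (put ''e'' 0 0 ?input)))"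
  let ?I = "\<lambda>a s'. copied (ext_start a) s' \<and> nats s' ''k'' 0 = ext_start a \<and>
      nats s' ''e'' 0 = start a \<and> (\<forall>b<a. nats s' ''st'' b = ext_start b)"
  have 1: "runs ?l ?s (2 + 9 * int n + 9 * int (start n)) (\<lambda>s'. ?I n s')"
  proof (rule runs_For[where M = 0 and N = n and I = ?I and w = "\<lambda>a. 7 + 9 * int (length (pl a))"])
    show "?I 0 (put ''a'' 0 0 ?s)" by (auto simp: copied_def input_zero)
    fix s' assume un: "unchanged ?l ?s s'"
    show "nval (V ''people'') s' = n" by (simp add: unchanged_nats[OF un] input_people)
    have input': "nats s' x = nats ?input x" if "x \<in> {''first'', ''item'', ''rank'', ''copies''}" for x
      using that by (elim insertE emptyE) (simp_all add: unchanged_nats[OF un])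
    have cost': "reals s' ''cost'' = reals ?input ''cost''" by (simp add: unchanged_reals[OF un])
    fix k assume k: "k < n" "?I k s'" "nats s' ''a'' 0 = k"
    show "runs copy_person s' (7 + 9 * int (length (pl k))) (\<lambda>s''. ?I (Suc k) (put ''a'' 0 (Suc k) s''))"
    proof (rule runs_mono[OF runs_copy_person[OF k(1,3) _ _ _ _ input' cost']])
      fix s'' assume "?I (Suc k) s''"
      then show "?I (Suc k) (put ''a'' 0 (Suc k) s'')" by (simp add: copied_def)
    qed (use k(2) in auto)
  next
    have "(\<Sum>a\<in>{0..<n}. 7 + 9 * int (length (pl a)) + 2) = 9 * int n + 9 * int (start n)"
      by (simp add: start_def sum.distrib sum_distrib_left atLeast0LessThan)
    then show "2 + (\<Sum>a\<in>{0..<n}. 7 + 9 * int (length (pl a)) + 2) \<le> 2 + 9 * int n + 9 * int (start n)"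
      by simp
  qed simp_all
  have "runs (?l;; Put ''st'' (V ''people'') (V ''k'')) ?s (3 + 9 * int n + 9 * int (start n)) ?Q"
  proof (rule runs_Seq[OF 1])
    fix s' assume I: "?I n s'" and un: "unchanged ?l ?s s'"
    have "nats s' ''people'' 0 = n" by (simp add: unchanged_nats[OF un] input_people)
    then show "runs (Put ''st'' (V ''people'') (V ''k'')) s' 1 ?Q"
      using I by (auto simp: runs_wp copied_def)
  qed simp
  then show ?thesis unfolding build_graph_def runs_wp by (simp add: input_people add.assoc)
qed

lemma ext_edge:
  assumes "a < n" "ext_start a \<le> e" "e < ext_start (Suc a)"
  obtains i where "e = ext_start a + i" "i < length (ext a)" "target e = ext a ! i"
    "target_rank e = ext_rank a ! i"
proof -
  have "e = ext_start a + (e - ext_start a)" "e - ext_start a < length (ext a)" using assms by auto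
  then show thesis using that target_nth[OF assms(1)] target_rank_nth[OF assms(1)] by metis
qed

lemma ext_start_mono: "a \<le> b \<Longrightarrow> ext_start a \<le> ext_start b"
  unfolding ext_start_def by (intro sum_mono2) auto

lemma sorted_ext_rank: "a < n \<Longrightarrow> sorted (ext_rank a)"
proof (cases "pl a = []")
  case False
  assume a: "a < n"
  have s: "sorted (map (rank G a) (pl a))" using pl[OF a] by (simp add: pref_list_def)
  have "rank G a b \<le> rank G a (last (pl a))" if "b \<in> set (pl a)" for b
  proof -
    obtain i where i: "i < length (pl a)" "b = pl a ! i" using \<open>b \<in> set (pl a)\<close> by (auto simp: in_set_conv_nth)
    then show ?thesis
      using sorted_nth_mono[OF s, of i "length (pl a) - 1"] False by (simp add: last_conv_nth)
  qed
  then show ?thesis using s False by (auto simp: ext_rank_def sorted_append intro: le_SucI)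
qed (simp add: ext_rank_def)

lemma distinct_ext: "a < n \<Longrightarrow> distinct (ext a)"
  using pl by (auto simp: ext_def pref_list_def distinct_map)

lemma coded_instance:
  assumes copied: "copied (ext_start n) s" and st: "\<forall>a\<le>n. nats s ''st'' a = ext_start a"
  shows "coded_instance G pl (nats s ''st'') (nats s ''tg'') (nats s ''rk'') (nats s ''cp'') (reals s ''ck'')"
proof -
  let ?st = "nats s ''st''" and ?tg = "nats s ''tg''" and ?rk = "nats s ''rk''"
    and ?cp = "nats s ''cp''" and ?ck = "reals s ''ck''"
  interpret g: graph n ?st ?tg
    using st by unfold_locales auto
  have A: "a \<in> g.A \<longleftrightarrow> a < n \<and> pl a \<noteq> []" for a
    using st by (auto simp: g.A_def length_ext split: if_splits)
  have st': "?st a = ext_start a" "?st (Suc a) = ext_start (Suc a)" if "a < n" for a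
    using st that by auto
  have edge: "\<exists>i<length (ext a). e = ext_start a + i \<and> ?tg e = ext a ! i \<and> ?rk e = ext_rank a ! i \<and>
      nats s ''fl'' (ext a ! i) = 1"
    if e: "a < n" "?st a \<le> e" "e < ?st (Suc a)" for a e
  proof -
    obtain i where i: "e = ext_start a + i" "i < length (ext a)" "target e = ext a ! i"
      "target_rank e = ext_rank a ! i" using ext_edge[of a e] e st' by auto
    have "e < ext_start n" using e st' ext_start_mono[of "Suc a" n] by (simp del: ext_start_simps)
    then show ?thesis using i copied by (auto simp: copied_def)
  qed
  have edge': "?tg (ext_start a + i) = ext a ! i" "?rk (ext_start a + i) = ext_rank a ! i"
    "nats s ''fl'' (ext a ! i) = 1" if "a < n" "i < length (ext a)" for a i
    using edge[of a "ext_start a + i"] that st' by auto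
  have flag: "nats s ''fl'' (Suc b) = 1" if "a < n" "b \<in> set (pl a)" for a b
  proof -
    have "Suc b \<in> set (ext a)" using that by (auto simp: ext_def)
    then show ?thesis using edge'(3)[OF that(1)] by (metis in_set_conv_nth)
  qed
  interpret rg: ranked_graph n ?st ?tg ?rk ?cp ?ck
  proof
    fix a assume a: "a < n"
    show "inj_on ?tg {?st a..<?st (Suc a)}"
    proof (rule inj_onI)
      fix e e' assume "e \<in> {?st a..<?st (Suc a)}" "e' \<in> {?st a..<?st (Suc a)}" "?tg e = ?tg e'"
      then show "e = e'"
        using edge[OF a, of e] edge[OF a, of e'] nth_eq_iff_index_eq[OF distinct_ext[OF a]] by auto
    qed
    fix e e' assume "?st a \<le> e" "e \<le> e'" "e' < ?st (Suc a)"
    then show "?rk e \<le> ?rk e'"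
      using edge[OF a, of e] edge[OF a, of e'] sorted_nth_mono[OF sorted_ext_rank[OF a]] length_ext_rank
      by auto
  next
    fix a assume a: "a \<in> g.A"
    then have an: "a < n" and ne: "pl a \<noteq> []" using A by auto
    have len: "length (ext a) = Suc (length (pl a))" using ne by (simp add: length_ext)
    have last: "?st (Suc a) - 1 = ext_start a + length (pl a)" using st'[OF an] len by simp
    show "?tg (?st (Suc a) - 1) = 0"
      unfolding last using edge'(1)[OF an, of "length (pl a)"] len ne by (simp add: ext_def nth_append)
    have "ext_rank a ! 0 \<le> ext_rank a ! (length (pl a) - 1)"
      using sorted_nth_mono[OF sorted_ext_rank[OF an], of 0 "length (pl a) - 1"] len
      by (simp add: length_ext_rank)
    also have "\<dots> < ext_rank a ! length (pl a)"
      using ne by (simp add: ext_rank_def nth_append last_conv_nth)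
    finally show "?rk (?st a) < ?rk (?st (Suc a) - 1)"
      unfolding last using edge'(2)[OF an, of "length (pl a)"] edge'(2)[OF an, of 0] len st'[OF an] by simp
  next
    fix x assume "x \<in> g.T"
    then obtain e where e: "e < ext_start n" "x = ?tg e" using st by (auto simp: g.T_def)
    then have "\<exists>a<n. ext_start a \<le> e \<and> e < ext_start (Suc a)"
    proof -
      \<comment> \<open>The list that contains edge \<open>e\<close> is the one before the first
        start position beyond \<open>e\<close>.\<close>
      let ?P = "\<lambda>k. e < ext_start k"
      have "?P (LEAST k. ?P k)" using e(1) by (rule LeastI)
      moreover have "(LEAST k. ?P k) \<le> n" using e(1) by (rule Least_le)
      moreover obtain a where a: "(LEAST k. ?P k) = Suc a"
        using calculation(1) by (cases "LEAST k. ?P k") auto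
      moreover have "\<not> ?P a" using not_less_Least[of a ?P] a by simp
      ultimately show ?thesis by (intro exI[of _ a]) auto
    qed
    then obtain a where a: "a < n" "ext_start a \<le> e" "e < ext_start (Suc a)" by blast
    then obtain i where i: "i < length (ext a)" "x = ext a ! i" "nats s ''fl'' x = 1"
      using edge[of a e] st' e(2) by auto
    show "0 < ?cp x"
    proof (cases x)
      case 0
      then show ?thesis using copied a(1) by (simp add: copied_def)
    next
      case (Suc b)
      have "x \<in> set (ext a)" using i by auto
      then have b: "b \<in> set (pl a)" using Suc by (auto simp: ext_def split: if_splits)
      have "?cp x = copies G b" using copied i(3) Suc by (auto simp: copied_def)
      moreover have "1 \<le> copies G b" using wf item_less[OF a(1) b] by (simp add: wf_instance_def)
      ultimately show ?thesis by simp
    qed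
  next
    show "n \<le> ?cp 0" using copied by (simp add: copied_def)
  qed
  show ?thesis
  proof
    fix a assume a: "a \<in> g.A"
    then have an: "a < n" and ne: "pl a \<noteq> []" using A by auto
    have set_ext: "set (ext a) = insert 0 (Suc ` set (pl a))" using ne by (auto simp: ext_def)
    have "rg.N a = set (ext a)"
    proof
      show "rg.N a \<subseteq> set (ext a)"
      proof
        fix x assume "x \<in> rg.N a"
        then obtain e where e: "x = ?tg e" "?st a \<le> e" "e < ?st (Suc a)" by (auto simp: rg.N_def)
        then show "x \<in> set (ext a)" using edge[OF an e(2,3)] by auto
      qed
      show "set (ext a) \<subseteq> rg.N a"
      proof
        fix x assume "x \<in> set (ext a)"
        then obtain i where i: "i < length (ext a)" "x = ext a ! i" by (auto simp: in_set_conv_nth)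
        then have "x = ?tg (ext_start a + i)" "ext_start a + i \<in> {?st a..<?st (Suc a)}"
          using edge'(1)[OF an] st'[OF an] by auto
        then show "x \<in> rg.N a" unfolding rg.N_def by blast
      qed
    qed
    then show "rg.N a = insert 0 (Suc ` set (pl a))" using set_ext by simp
    have r: "rg.r a (ext a ! i) = ext_rank a ! i" if "i < length (ext a)" for i
      using rg.r_tg[OF an, of "ext_start a + i"] edge'[OF an that] st'[OF an] that by simp
    have len: "length (ext a) = Suc (length (pl a))" using ne by (simp add: length_ext)
    fix b assume b: "b \<in> set (pl a)"
    then obtain i where i: "i < length (pl a)" "b = pl a ! i" by (auto simp: in_set_conv_nth)
    show rb: "rg.r a (Suc b) = rank G a b"
      using r[of i] i ne len by (simp add: ext_def ext_rank_def nth_append)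
    have r0: "rg.r a 0 = Suc (rank G a (last (pl a)))"
      using r[of "length (pl a)"] ne len by (simp add: ext_def ext_rank_def nth_append)
    have "ext_rank a ! i \<le> ext_rank a ! (length (pl a) - 1)"
      using sorted_nth_mono[OF sorted_ext_rank[OF an], of i "length (pl a) - 1"] i len
      by (simp add: length_ext_rank)
    then have "rank G a b \<le> rank G a (last (pl a))"
      using i ne by (simp add: ext_rank_def nth_append last_conv_nth)
    then show "rank G a b < rg.r a 0" using r0 by simp
    show "?cp (Suc b) = copies G b" "?ck (Suc b) = cost G b"
      using copied flag[OF an b] by (auto simp: copied_def)
  next
    show "?ck 0 = 0" using copied by (simp add: copied_def)
    show "a \<in> g.A \<longleftrightarrow> a < n \<and> pl a \<noteq> []" for a by (rule A)
  qed
qed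

text \<open>The last resort adds one edge per nonempty list, which at most doubles the number of
  edges.\<close>

lemma card_people_bound: "card {a. a < n \<and> pl a \<noteq> []} \<le> start n" "ext_start n = start n + card {a. a < n \<and> pl a \<noteq> []}"
proof -
  have "card {a. a < k \<and> pl a \<noteq> []} \<le> start k \<and> ext_start k = start k + card {a. a < k \<and> pl a \<noteq> []}" for k
  proof (induction k)
    case (Suc k)
    have "{a. a < Suc k \<and> pl a \<noteq> []} =
        (if pl k = [] then {a. a < k \<and> pl a \<noteq> []} else insert k {a. a < k \<and> pl a \<noteq> []})"
      by (auto simp: less_Suc_eq)
    then show ?case using Suc by (cases "pl k") (auto simp: length_ext)
  qed simp
  then show "card {a. a < n \<and> pl a \<noteq> []} \<le> start n" "ext_start n = start n + card {a. a < n \<and> pl a \<noteq> []}"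
    by blast+
qed

lemma correct_if_no_edges:
  assumes "edges G = {}"
  shows "correct_output G (put ''popular'' 0 1 (input_state G pl))"
proof -
  let ?s = "put ''popular'' 0 1 (input_state G pl)"
  have only: "M = (\<lambda>_. None)" if "matching G M" for M
  proof
    show "M a = None" for a using that assms by (cases "M a") (auto simp: matching_def)
  qed
  have m: "matching G (\<lambda>_. None)" by (simp add: matching_def assigned_def)
  have "popular G (\<lambda>_. None)"
  proof -
    have "\<not> more_popular G M' (\<lambda>_. None)" if "matching G M'" for M'
      unfolding only[OF that] by (simp add: more_popular_def)
    then show ?thesis using m unfolding popular_def by blast
  qed
  moreover have "output_matching G ?s = (\<lambda>_. None)"
    by (auto simp: output_matching_def input_zero)
  moreover have "M' = (\<lambda>_. None)" if "popular G M'" for M'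
    by (rule only) (use that in \<open>simp add: popular_def\<close>)
  ultimately have "min_cost_popular G (output_matching G ?s)"
    unfolding min_cost_popular_def by (metis order_refl)
  then show ?thesis unfolding correct_output_def min_cost_popular_def by auto
qed

lemma runs_algorithm:
  "runs algorithm (input_state G pl) (1000 * (int (card (edges G)) * int n + 1)) (correct_output G)"
proof (cases "edges G = {}")
  \<comment> \<open>Here the product in the bound is 0, and its summand 1 pays for the run.\<close>
  case True
  then have "start n = 0" using card_edges by (simp add: start_def)
  then show ?thesis
    using correct_if_no_edges[OF True] input_first[of n]
    by (simp add: algorithm_def runs_wp input_people)
next
  case False
  define m where "m = start n"
  have card_m: "card (edges G) = m" by (simp add: card_edges m_def start_def)
  have "finite (edges G)"
    using wf by (auto simp: wf_instance_def intro: finite_subset)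
  then have m: "0 < m" using False card_m card_gt_0_iff by metis
  define q where "q = card {a. a < n \<and> pl a \<noteq> []}"
  have q: "q \<le> m" "q \<le> n" "ext_start n = m + q"
    using card_people_bound card_mono[of "{..<n}" "{a. a < n \<and> pl a \<noteq> []}"] by (auto simp: q_def m_def)
  have n: "0 < n" using m by (cases n) (auto simp: m_def)
  define W where "W = 30 + 17 * int n + 70 * int (m + q)"
  define B where "B = (7 + 9 * int n + 9 * int m) + (25 + 43 * int n + 22 * int (m + q) + 3 * int q * W)"
  \<comment> \<open>Every quadratic term of \<open>B\<close> has a factor \<open>q\<close>, the
    number of people with edges. As \<open>q\<close> is at most \<open>m\<close> and at most
    \<open>n\<close>, the products of \<open>q\<close> with \<open>n\<close>, \<open>m\<close> and
    \<open>q\<close> are all bounded by \<open>m * n\<close>; the linear terms are too, since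
    \<open>m\<close> and \<open>n\<close> are positive.\<close>
  have B: "B + 1 \<le> 1000 * (int m * int n + 1)"
  proof -
    have le: "int n \<le> int m * int n" "int m \<le> int m * int n"
      using m n by (simp_all add: mult_le_cancel_right1 mult_le_cancel_left1)
    moreover have "int q \<le> int m * int n" using le(2) q(1) by linarith
    moreover have "int q * int n \<le> int m * int n" "int q * int m \<le> int m * int n"
      using q by (simp_all add: mult_right_mono mult.commute[of "int q" "int m"] mult_left_mono)
    moreover have "int q * int q \<le> int m * int n" using q by (intro mult_mono) simp_all
    ultimately show ?thesis unfolding B_def W_def by (simp add: algebra_simps)
  qed
  have "runs (build_graph;; solve) (input_state G pl) B (correct_output G)"
  proof (rule runs_Seq[OF runs_build_graph])
    fix s assume s: "copied (ext_start n) s \<and> (\<forall>a\<le>n. nats s ''st'' a = ext_start a)"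
      and un: "unchanged build_graph (input_state G pl) s"
    interpret c: coded_instance G pl "nats s ''st''" "nats s ''tg''" "nats s ''rk''" "nats s ''cp''"
      "reals s ''ck''"
      using coded_instance s by blast
    have env: "c.env s" by (simp add: c.env_def unchanged_nats[OF un] input_people)
    have "c.A = {a. a < n \<and> pl a \<noteq> []}" using c.A_iff by auto
    then have A: "card c.A = q" by (simp add: q_def)
    have K: "c.K = int (m + q)" using s q(3) by (simp add: c.K_def)
    have W: "c.W = W" by (simp add: c.W_def W_def K)
    have fl: "\<forall>x. nats s ''fl'' x \<le> 1" "\<forall>x\<in>c.T. nats s ''fl'' x = 1"
      using s by (auto simp: copied_def c.T_def)
    have zero: "\<forall>a<n. nats s ''mt'' a = 0" "\<forall>x. nats s ''ev'' x = 0"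
      by (simp_all add: unchanged_nats[OF un] input_zero)
    have "runs solve s (25 + 43 * int n + 22 * c.K + 3 * int (card c.A) * c.W) c.solved"
      by (rule c.runs_solve[OF env refl refl refl fl zero])
    then show "runs solve s (25 + 43 * int n + 22 * int (m + q) + 3 * int q * W) (correct_output G)"
      unfolding A K W by (rule runs_mono) (simp_all add: c.correct_if_solved)
  qed (simp add: B_def m_def)
  then have "runs (build_graph;; solve) (input_state G pl) (1000 * (int m * int n + 1) - 1) (correct_output G)"
    by (rule runs_mono) (use B in simp_all)
  moreover have "bval (Less (Lit 0) (Get ''first'' (V ''people''))) (input_state G pl)"
    using m input_first[of n] by (simp add: input_people m_def)
  ultimately show ?thesis unfolding algorithm_def card_m runs_wp wp_If by simp
qed

end

theorem theorem7:
  "\<exists>(p :: com) (c :: nat). \<forall>G s. wf_instance G \<longrightarrow> encodes s G \<longrightarrow>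
     (\<exists>t s'. exec p s t s' \<and> correct_output G s' \<and>
        t \<le> c * (card (edges G) * n_people G + 1))"
proof (rule exI[of _ algorithm], rule exI[of _ 1000], intro allI impI)
  fix G s assume wf: "wf_instance G" and "encodes s G"
  then obtain pl where pl: "\<forall>a\<in>people G. pref_list G a (pl a)" and s: "s = input_state G pl"
    by (auto simp: encodes_def)
  interpret preference_lists G pl using wf pl by unfold_locales auto
  obtain t s' where "exec algorithm s t s'" "correct_output G s'"
    and "int t \<le> 1000 * (int (card (edges G)) * int (n_people G) + 1)"
    using runs_algorithm unfolding runs_def s by blast
  moreover from this have "t \<le> 1000 * (card (edges G) * n_people G + 1)"
    by (metis (mono_tags, lifting) of_nat_1 of_nat_add of_nat_le_iff of_nat_mult of_nat_numeral)
  ultimately show "\<exists>t s'. exec algorithm s t s' \<and> correct_output G s' \<and>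
      t \<le> 1000 * (card (edges G) * n_people G + 1)" by blast
qed

end
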